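(* Let $(\Lambda,d)$ be a finitely aligned $k$-graph such that $|\Lambda^{e_i}(v)|=\infty$ for every $v\in\Lambda^0$ and $1\le i\le k$. Let $\{t_\lambda:\lambda\in\Lambda\}$ be a Cuntz-Krieger $\Lambda$-family such that $t_v\neq0$ for all $v\in\Lambda^0$. Then the representation $\pi_t$ of $C^*(\Lambda)$ (determined by sending the canonical generators $s_\lambda$ to $t_\lambda$) is faithful.
   Context: A $k$-graph $(\Lambda,d)$ is a countable category $\Lambda$ with a functor $d:\Lambda\to\mathbb{N}^k$ with the factorisation property: if $d(\lambda)=m+n$ there are unique $\mu,\nu\in\Lambda$ with $d(\mu)=m$, $d(\nu)=n$ and $\lambda=\mu\circ\nu$. Write $\lambda\mu=\lambda\circ\mu$ (defined when $\mathrm{dom}(\lambda)=\mathrm{cod}(\mu)$). $\Lambda^n:=d^{-1}(n)$; $\Lambda^0$ is identified with the objects (vertices). $\Lambda^n(v):=\{\lambda\in\Lambda:d(\lambda)=n,\ \mathrm{cod}(\lambda)=v\}$. $e_1,\dots,e_k$ are the standard generators of $\mathbb{N}^k$. For $m\le d(\gamma)$, $\gamma(0,m)$ is the unique path of degree $m$ with $\gamma=\gamma(0,m)\gamma'$ for some $\gamma'$. $m\vee n$ is the coordinatewise maximum. For $\mu,\nu\in\Lambda$, $\mathrm{MCE}(\mu,\nu):=\{\gamma\in\Lambda:d(\gamma)=d(\mu)\vee d(\nu),\ \gamma(0,d(\mu))=\mu,\ \gamma(0,d(\nu))=\nu\}$. $\Lambda$ is finitely aligned if $\mathrm{MCE}(\lambda,\mu)$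 is finite whenever $d(\lambda)=e_i$ and $d(\mu)=e_j$ for some $i,j$ (equivalently, for all $\lambda,\mu\in\Lambda$). $\Lambda$ has no sources if $\Lambda^n(v)\ne\emptyset$ for all $v\in\Lambda^0$, $n\in\mathbb{N}^k$ (this holds automatically under the hypothesis of the statement). For a finitely aligned $k$-graph $\Lambda$ without sources, a Cuntz-Krieger $\Lambda$-family in a $C^*$-algebra $B$ is a collection of partial isometries $\{t_\lambda:\lambda\in\Lambda\}\subset B$ such that: (1) $\{t_v:v\in\Lambda^0\}$ are mutually orthogonal projections; (2) $t_\lambda t_\mu=t_{\lambda\mu}$ whenever $\mathrm{dom}(\lambda)=\mathrm{cod}(\mu)$; (3) $t_\lambda^*t_\lambda=t_{\mathrm{dom}(\lambda)}$; (4) $t_v\ge\sum_{\lambda\in F}t_\lambda t_\lambda^*$ for all $n\in\mathbb{N}^k\setminus\{0\}$, $v\in\Lambda^0$ and finite $F\subset\Lambda^n(v)$; (5) $t_\mu^*t_\nu=\sum_{\mu\alpha=\nu\beta\in\mathrm{MCE}(\mu,\nu)}t_\alpha t_\beta^*$ for all $\mu,\nu\in\Lambda$ (sum over pairs $(\alpha,\beta)$ with $\mu\alpha=\nu\beta\in\mathrm{MCE}(\mu,\nu)$); (6) $t_v=\sum_{\lambda\in\Lambda^n(v)}t_\lambda t_\lambda^*$ whenever $\Lambda^n(v)$ is finite. $C^*(\Lambda)$ is the universal $C^*$-algebra generated by a Cuntz-Krieger $\Lambda$-family $\{s_\lambda\}$. *)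

theory Defs
  imports "HOL-Analysis.Analysis"
begin

section \<open>C*-algebras\<close>

text \<open>
  Not assumed unital: the C*-algebra of a \<open>k\<close>-graph with infinitely many vertices has no unit.
\<close>

class cstar_algebra = real_normed_algebra + banach +
  fixes scaleC :: "complex \<Rightarrow> 'a \<Rightarrow> 'a"  (infixr "*\<^sub>C" 75)
    and adj :: "'a \<Rightarrow> 'a"
  assumes scaleR_eq_scaleC: "r *\<^sub>R x = complex_of_real r *\<^sub>C x"
    and scaleC_add_right: "c *\<^sub>C (x + y) = c *\<^sub>C x + c *\<^sub>C y"
    and scaleC_add_left: "(b + c) *\<^sub>C x = b *\<^sub>C x + c *\<^sub>C x"
    and scaleC_scaleC: "b *\<^sub>C c *\<^sub>C x = (b * c) *\<^sub>C x"
    and scaleC_one: "1 *\<^sub>C x = x"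
    and mult_scaleC_left: "(c *\<^sub>C x) * y = c *\<^sub>C (x * y)"
    and mult_scaleC_right: "x * (c *\<^sub>C y) = c *\<^sub>C (x * y)"
    and norm_scaleC: "norm (c *\<^sub>C x) = cmod c * norm x"
    and adj_adj: "adj (adj x) = x"
    and adj_add: "adj (x + y) = adj x + adj y"
    and adj_scaleC: "adj (c *\<^sub>C x) = cnj c *\<^sub>C adj x"
    and adj_mult: "adj (x * y) = adj y * adj x"
    and cstar_identity: "norm (adj x * x) = (norm x)\<^sup>2"

text \<open>The order given by the cone of positive elements \<open>x\<^sup>* x\<close>.\<close>

definition cstar_le :: "'a::cstar_algebra \<Rightarrow> 'a \<Rightarrow> bool" where
  "cstar_le a b \<longleftrightarrow> (\<exists>x. b - a = adj x * x)"

definition projection :: "'a::cstar_algebra \<Rightarrow> bool" where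
  "projection p \<longleftrightarrow> adj p = p \<and> p * p = p"

definition partial_isometry :: "'a::cstar_algebra \<Rightarrow> bool" where
  "partial_isometry x \<longleftrightarrow> x * adj x * x = x"

definition cstar_subalgebra :: "'a::cstar_algebra set \<Rightarrow> bool" where
  "cstar_subalgebra C \<longleftrightarrow>
     closed C \<and> 0 \<in> C \<and>
     (\<forall>x\<in>C. \<forall>y\<in>C. x + y \<in> C \<and> x * y \<in> C) \<and>
     (\<forall>x\<in>C. adj x \<in> C \<and> (\<forall>c. c *\<^sub>C x \<in> C))"

definition star_hom :: "('a::cstar_algebra \<Rightarrow> 'b::cstar_algebra) \<Rightarrow> bool" where
  "star_hom f \<longleftrightarrow>
     (\<forall>x y. f (x + y) = f x + f y) \<and> (\<forall>c x. f (c *\<^sub>C x) = c *\<^sub>C f x) \<and>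
     (\<forall>x y. f (x * y) = f x * f y) \<and> (\<forall>x. f (adj x) = adj (f x))"


section \<open>Higher-rank graphs\<close>

text \<open>
  A \<open>k\<close>-graph is given by its set of morphisms, with \<open>k = CARD('k)\<close> and \<open>\<nat>\<^sup>k\<close> rendered as
  \<open>nat ^ 'k\<close>.  Objects are identified with their identity morphisms, so \<open>Dom\<close> and \<open>Cod\<close> take
  values in the morphisms.  \<open>Cmp G \<lambda> \<mu>\<close> is only meaningful if \<open>Dom G \<lambda> = Cod G \<mu>\<close>.
\<close>

record ('m, 'k) kgraph =
  Mor :: "'m set"
  Dom :: "'m \<Rightarrow> 'm"
  Cod :: "'m \<Rightarrow> 'm"
  Cmp :: "'m \<Rightarrow> 'm \<Rightarrow> 'm"
  deg :: "'m \<Rightarrow> nat ^ 'k"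

locale k_graph =
  fixes G :: "('m, 'k::finite) kgraph"
  assumes countable_Mor: "countable (Mor G)"
    and Dom_closed: "f \<in> Mor G \<Longrightarrow> Dom G f \<in> Mor G"
    and Cod_closed: "f \<in> Mor G \<Longrightarrow> Cod G f \<in> Mor G"
    and Dom_Dom: "f \<in> Mor G \<Longrightarrow> Dom G (Dom G f) = Dom G f"
    and Cod_Dom: "f \<in> Mor G \<Longrightarrow> Cod G (Dom G f) = Dom G f"
    and Dom_Cod: "f \<in> Mor G \<Longrightarrow> Dom G (Cod G f) = Cod G f"
    and Cod_Cod: "f \<in> Mor G \<Longrightarrow> Cod G (Cod G f) = Cod G f"
    and Cmp_closed: "\<lbrakk>f \<in> Mor G; g \<in> Mor G; Dom G f = Cod G g\<rbrakk> \<Longrightarrow> Cmp G f g \<in> Mor G"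
    and Dom_Cmp: "\<lbrakk>f \<in> Mor G; g \<in> Mor G; Dom G f = Cod G g\<rbrakk> \<Longrightarrow> Dom G (Cmp G f g) = Dom G g"
    and Cod_Cmp: "\<lbrakk>f \<in> Mor G; g \<in> Mor G; Dom G f = Cod G g\<rbrakk> \<Longrightarrow> Cod G (Cmp G f g) = Cod G f"
    and Cmp_assoc: "\<lbrakk>f \<in> Mor G; g \<in> Mor G; h \<in> Mor G; Dom G f = Cod G g; Dom G g = Cod G h\<rbrakk>
        \<Longrightarrow> Cmp G (Cmp G f g) h = Cmp G f (Cmp G g h)"
    and Cmp_Dom: "f \<in> Mor G \<Longrightarrow> Cmp G f (Dom G f) = f"
    and Cmp_Cod: "f \<in> Mor G \<Longrightarrow> Cmp G (Cod G f) f = f"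
    and deg_Dom: "f \<in> Mor G \<Longrightarrow> deg G (Dom G f) = 0"
    and deg_Cod: "f \<in> Mor G \<Longrightarrow> deg G (Cod G f) = 0"
    and deg_Cmp: "\<lbrakk>f \<in> Mor G; g \<in> Mor G; Dom G f = Cod G g\<rbrakk>
        \<Longrightarrow> deg G (Cmp G f g) = deg G f + deg G g"
    and factorisation: "\<lbrakk>f \<in> Mor G; deg G f = m + n\<rbrakk> \<Longrightarrow>
        \<exists>!(\<mu>, \<nu>). \<mu> \<in> Mor G \<and> \<nu> \<in> Mor G \<and> Dom G \<mu> = Cod G \<nu> \<and>
                 deg G \<mu> = m \<and> deg G \<nu> = n \<and> f = Cmp G \<mu> \<nu>"

definition vertices :: "('m, 'k::finite) kgraph \<Rightarrow> 'm set" where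
  "vertices G = {v \<in> Mor G. deg G v = 0}"

definition paths_at :: "('m, 'k::finite) kgraph \<Rightarrow> nat ^ 'k \<Rightarrow> 'm \<Rightarrow> 'm set" where
  "paths_at G n v = {f \<in> Mor G. deg G f = n \<and> Cod G f = v}"

text \<open>\<open>init_seg G \<gamma> m\<close> is the initial segment \<open>\<gamma>(0,m)\<close>, meaningful for \<open>m \<le> deg G \<gamma>\<close>.\<close>

definition init_seg :: "('m, 'k::finite) kgraph \<Rightarrow> 'm \<Rightarrow> nat ^ 'k \<Rightarrow> 'm" where
  "init_seg G \<gamma> m = (THE \<mu>. \<mu> \<in> Mor G \<and> deg G \<mu> = m \<and>
      (\<exists>\<nu>\<in>Mor G. Dom G \<mu> = Cod G \<nu> \<and> \<gamma> = Cmp G \<mu> \<nu>))"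

definition vmax :: "nat ^ 'k \<Rightarrow> nat ^ 'k \<Rightarrow> nat ^ 'k::finite" where
  "vmax m n = (\<chi> i. max (m $ i) (n $ i))"

definition MCE :: "('m, 'k::finite) kgraph \<Rightarrow> 'm \<Rightarrow> 'm \<Rightarrow> 'm set" where
  "MCE G \<mu> \<nu> = {\<gamma> \<in> Mor G. deg G \<gamma> = vmax (deg G \<mu>) (deg G \<nu>) \<and>
      init_seg G \<gamma> (deg G \<mu>) = \<mu> \<and> init_seg G \<gamma> (deg G \<nu>) = \<nu>}"

text \<open>\<open>axis i 1\<close> is the generator \<open>e\<^sub>i\<close>.\<close>

definition finitely_aligned :: "('m, 'k::finite) kgraph \<Rightarrow> bool" where
  "finitely_aligned G \<longleftrightarrow>
     (\<forall>\<mu>\<in>Mor G. \<forall>\<nu>\<in>Mor G. (\<exists>i. deg G \<mu> = axis i 1) \<and> (\<exists>j. deg G \<nu> = axis j 1)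
        \<longrightarrow> finite (MCE G \<mu> \<nu>))"

definition MCE_pairs :: "('m, 'k::finite) kgraph \<Rightarrow> 'm \<Rightarrow> 'm \<Rightarrow> ('m \<times> 'm) set" where
  "MCE_pairs G \<mu> \<nu> = {(\<alpha>, \<beta>). \<alpha> \<in> Mor G \<and> \<beta> \<in> Mor G \<and>
      Dom G \<mu> = Cod G \<alpha> \<and> Dom G \<nu> = Cod G \<beta> \<and>
      Cmp G \<mu> \<alpha> = Cmp G \<nu> \<beta> \<and> Cmp G \<mu> \<alpha> \<in> MCE G \<mu> \<nu>}"


section \<open>Cuntz-Krieger families and the universal C*-algebra\<close>

text \<open>
  A family indexed by the morphisms is a function on \<open>'m\<close> whose values outside \<open>Mor G\<close> are
  irrelevant.  For finitely aligned \<open>G\<close> the set \<open>MCE_pairs G \<mu> \<nu>\<close> is finite.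
\<close>

definition CK_family :: "('m, 'k::finite) kgraph \<Rightarrow> ('m \<Rightarrow> 'b::cstar_algebra) \<Rightarrow> bool" where
  "CK_family G t \<longleftrightarrow>
     (\<forall>f\<in>Mor G. partial_isometry (t f)) \<and>
     (\<forall>v\<in>vertices G. projection (t v)) \<and>
     (\<forall>v\<in>vertices G. \<forall>w\<in>vertices G. v \<noteq> w \<longrightarrow> t v * t w = 0) \<and>
     (\<forall>f\<in>Mor G. \<forall>g\<in>Mor G. Dom G f = Cod G g \<longrightarrow> t f * t g = t (Cmp G f g)) \<and>
     (\<forall>f\<in>Mor G. adj (t f) * t f = t (Dom G f)) \<and>
     (\<forall>n v F. n \<noteq> 0 \<and> v \<in> vertices G \<and> finite F \<and> F \<subseteq> paths_at G n v \<longrightarrow>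
        cstar_le (\<Sum>f\<in>F. t f * adj (t f)) (t v)) \<and>
     (\<forall>\<mu>\<in>Mor G. \<forall>\<nu>\<in>Mor G.
        adj (t \<mu>) * t \<nu> = (\<Sum>(\<alpha>, \<beta>)\<in>MCE_pairs G \<mu> \<nu>. t \<alpha> * adj (t \<beta>))) \<and>
     (\<forall>n. \<forall>v\<in>vertices G. finite (paths_at G n v) \<longrightarrow>
        t v = (\<Sum>f\<in>paths_at G n v. t f * adj (t f)))"

definition sends_generators ::
    "('m, 'k::finite) kgraph \<Rightarrow> ('m \<Rightarrow> 'a::cstar_algebra) \<Rightarrow> ('m \<Rightarrow> 'b::cstar_algebra)
      \<Rightarrow> ('a \<Rightarrow> 'b) \<Rightarrow> bool" where
  "sends_generators G s t \<pi> \<longleftrightarrow> star_hom \<pi> \<and> (\<forall>f\<in>Mor G. \<pi> (s f) = t f)"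

text \<open>
  \<open>universal_CK_family G s TYPE('b)\<close>: the C*-algebra \<open>'a\<close> is generated by the Cuntz-Krieger family
  \<open>s\<close>, which is universal among the Cuntz-Krieger families in the C*-algebra \<open>'b\<close>.  As HOL has no
  quantification over types inside formulas, the pair \<open>('a, s)\<close> being the universal C*-algebra
  \<open>C\<^sup>*(\<Lambda>)\<close> means this for all \<open>'b\<close> (including \<open>'a\<close> itself).  A theorem that assumes the property
  only for the C*-algebras it mentions is therefore applicable to \<open>C\<^sup>*(\<Lambda>)\<close>.
\<close>

definition universal_CK_family ::
    "('m, 'k::finite) kgraph \<Rightarrow> ('m \<Rightarrow> 'a::cstar_algebra) \<Rightarrow> 'b::cstar_algebra itself \<Rightarrow> bool" where
  "universal_CK_family G s (_ :: 'b itself) \<longleftrightarrow>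
     CK_family G s \<and>
     cstar_subalgebra hull (s ` Mor G) = UNIV \<and>
     (\<forall>t :: 'm \<Rightarrow> 'b. CK_family G t \<longrightarrow> (\<exists>!\<pi>. sends_generators G s t \<pi>))"

text \<open>The representation \<open>\<pi>\<^sub>t\<close>; it is well defined if \<open>s\<close> is universal.\<close>

definition induced_rep ::
    "('m, 'k::finite) kgraph \<Rightarrow> ('m \<Rightarrow> 'a::cstar_algebra) \<Rightarrow> ('m \<Rightarrow> 'b::cstar_algebra)
      \<Rightarrow> 'a \<Rightarrow> 'b" where
  "induced_rep G s t = (THE \<pi>. sends_generators G s t \<pi>)"

end

theory Submission
  imports Defs
begin

text \<open>
  Let \<open>\<Vert>x\<Vert>\<^sub>r\<close> be the norm in the regular representation on \<open>\<ell>\<^sup>2(\<Lambda>)\<close> of a finite linear combination \<open>x\<close> of the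
  elements \<open>t\<^sub>\<mu> t\<^sub>\<nu>\<^sup>*\<close>. Two inequalities give the result.

  If all \<open>t\<^sub>v\<close> are non-zero, then \<open>\<Vert>x\<Vert>\<^sub>r \<le> \<Vert>x\<Vert>\<close>: since every vertex receives infinitely many edges of each
  degree, below \<open>t\<^sub>v\<close> there is a non-zero projection \<open>q\<close> with \<open>q t\<^sub>\<alpha> = 0\<close> for any finitely many non-trivial
  paths \<open>\<alpha>\<close>, and the elements \<open>t\<^sub>\<lambda> q\<close> then behave like the basis vectors of \<open>\<ell>\<^sup>2(\<Lambda>v)\<close>.

  Conversely \<open>\<Vert>x\<Vert> \<le> \<Vert>x\<Vert>\<^sub>r\<close> for every Cuntz-Krieger family. By \<open>\<Vert>x\<Vert>\<^sup>2 = \<Vert>x\<^sup>* x\<Vert>\<close> and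
  \<open>\<Vert>h\<^sup>N\<Vert> = \<Vert>h\<Vert>\<^sup>N\<close> for self-adjoint \<open>h\<close> and \<open>N = 2\<^sup>j\<close>, it is enough to bound \<open>\<Vert>h\<^sup>N\<Vert>\<close> by \<open>\<Vert>h\<Vert>\<^sub>r\<^sup>N\<close> times a factor
  subexponential in \<open>N\<close>. If \<open>d(\<mu>) = d(\<nu>)\<close> in all terms, all powers lie in one finite-dimensional
  algebra, so the factor is constant. If \<open>d(\<mu>) - d(\<nu>)\<close> is constant, then \<open>x\<^sup>* x\<close> is of this kind. In general
  the homogeneous parts of \<open>x\<close> are dominated by \<open>x\<close> in the regular representation, and their number grows
  only polynomially in \<open>N\<close>.

  Hence \<open>\<pi>\<^sub>t\<close> does not decrease norms on a dense subset, and it is continuous.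
\<close>

section \<open>Elementary C*-algebra\<close>

lemma scaleC_zero_right [simp]: "c *\<^sub>C (0::'a::cstar_algebra) = 0"
  using scaleC_add_right[of c 0 "0::'a"] by simp

lemma scaleC_zero_left [simp]: "0 *\<^sub>C (x::'a::cstar_algebra) = 0"
  using scaleC_add_left[of 0 0 x] by simp

lemma scaleC_minus_one: "(-1) *\<^sub>C (x::'a::cstar_algebra) = - x"
  by (metis of_real_1 of_real_minus scaleR_eq_scaleC scaleR_minus1_left)

lemma scaleC_minus_right: "c *\<^sub>C (- x) = - (c *\<^sub>C (x::'a::cstar_algebra))"
  by (metis scaleC_minus_one scaleC_scaleC mult.commute)

lemma scaleC_minus_left: "(- c) *\<^sub>C x = - (c *\<^sub>C (x::'a::cstar_algebra))"
  by (metis scaleC_minus_one scaleC_scaleC mult_minus1)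

lemma scaleC_diff_right: "c *\<^sub>C (x - y) = c *\<^sub>C x - c *\<^sub>C (y::'a::cstar_algebra)"
  by (metis add_uminus_conv_diff scaleC_add_right scaleC_minus_right)

lemma scaleC_sum_right: "c *\<^sub>C (\<Sum>i\<in>A. f i) = (\<Sum>i\<in>A. c *\<^sub>C (f i ::'a::cstar_algebra))"
  by (induction A rule: infinite_finite_induct) (auto simp: scaleC_add_right)

lemma scaleC_sum_left: "(\<Sum>i\<in>A. f i) *\<^sub>C (x::'a::cstar_algebra) = (\<Sum>i\<in>A. f i *\<^sub>C x)"
  by (induction A rule: infinite_finite_induct) (auto simp: scaleC_add_left)

lemma adj_zero [simp]: "adj (0::'a::cstar_algebra) = 0"
  using adj_add[of 0 "0::'a"] by simp

lemma adj_minus: "adj (- x) = - adj (x::'a::cstar_algebra)"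
  using adj_scaleC[of "-1" x] by (simp add: scaleC_minus_one)

lemma adj_diff: "adj (x - y) = adj x - adj (y::'a::cstar_algebra)"
  by (metis add_uminus_conv_diff adj_add adj_minus)

lemma adj_scaleR: "adj (r *\<^sub>R x) = r *\<^sub>R adj (x::'a::cstar_algebra)"
  by (simp add: scaleR_eq_scaleC adj_scaleC)

lemma adj_sum: "adj (\<Sum>i\<in>A. f i) = (\<Sum>i\<in>A. adj (f i ::'a::cstar_algebra))"
  by (induction A rule: infinite_finite_induct) (auto simp: adj_add)

text \<open>Cancelling a factor in \<open>norm y * norm y \<le> norm (adj y) * norm y\<close> gives
  one inequality; applying it to \<open>adj x\<close> gives the other.\<close>

lemma norm_adj [simp]: "norm (adj x) = norm (x::'a::cstar_algebra)"
proof -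
  have le: "norm y \<le> norm (adj y)" for y :: 'a
  proof (cases "y = 0")
    case False
    have "norm y * norm y \<le> norm (adj y) * norm y"
      using norm_mult_ineq[of "adj y" y] by (simp add: cstar_identity power2_eq_square)
    with False show ?thesis by simp
  qed simp
  show ?thesis using le[of x] le[of "adj x"] by (simp add: adj_adj)
qed

lemma continuous_on_adj: "continuous_on A (adj :: 'a::cstar_algebra \<Rightarrow> 'a)"
proof (rule lipschitz_on_continuous_on)
  show "1-lipschitz_on A (adj :: 'a \<Rightarrow> 'a)"
    by (rule lipschitz_onI) (simp_all add: dist_norm flip: adj_diff)
qed

lemma continuous_on_scaleC: "continuous_on A (\<lambda>x::'a::cstar_algebra. c *\<^sub>C x)"
proof (rule lipschitz_on_continuous_on)
  show "(cmod c)-lipschitz_on A (\<lambda>x::'a. c *\<^sub>C x)"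
    by (rule lipschitz_onI) (simp_all add: dist_norm norm_scaleC flip: scaleC_diff_right)
qed

lemma norm_projection_le:
  assumes "projection (p::'a::cstar_algebra)"
  shows "norm p \<le> 1"
proof (cases "p = 0")
  case False
  have "norm p * norm p = norm p"
    using cstar_identity[of p] assms by (simp add: projection_def power2_eq_square)
  with False show ?thesis by simp
qed simp

lemma norm_projection:
  assumes "projection (p::'a::cstar_algebra)" "p \<noteq> 0"
  shows "norm p = 1"
proof -
  have "norm p * norm p = norm p"
    using cstar_identity[of p] assms by (simp add: projection_def power2_eq_square)
  with assms(2) show ?thesis by simp
qed

section \<open>Automatic contractivity of *-homomorphisms\<close>

lemma star_hom_add: "star_hom f \<Longrightarrow> f (x + y) = f x + f y"
  and star_hom_scaleC: "star_hom f \<Longrightarrow> f (c *\<^sub>C x) = c *\<^sub>C f x"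
  and star_hom_mult: "star_hom f \<Longrightarrow> f (x * y) = f x * f y"
  and star_hom_adj: "star_hom f \<Longrightarrow> f (adj x) = adj (f x)"
  by (auto simp: star_hom_def)

lemma star_hom_scaleR: "star_hom f \<Longrightarrow> f (r *\<^sub>R x) = r *\<^sub>R f x"
  by (simp add: scaleR_eq_scaleC star_hom_scaleC)

lemma star_hom_zero: "star_hom f \<Longrightarrow> f 0 = 0"
  by (metis star_hom_scaleC scaleC_zero_left)

lemma star_hom_minus: "star_hom f \<Longrightarrow> f (x - y) = f x - f y"
  by (metis add_diff_cancel_right' diff_add_cancel star_hom_add)

lemma star_hom_sum: "star_hom f \<Longrightarrow> f (\<Sum>i\<in>A. g i) = (\<Sum>i\<in>A. f (g i))"
  by (induction A rule: infinite_finite_induct) (auto simp: star_hom_zero star_hom_add)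

text \<open>In a unitisation, \<open>1 - y\<close> is a square root of \<open>1 - x\<^sup>2\<close>.\<close>

lemma sqrt_one_minus_square_exists:
  fixes x :: "'a::cstar_algebra"
  assumes "adj x = x" "norm x < 1"
  shows "\<exists>y. adj y = y \<and> x * y = y * x \<and> x * x + y * y = 2 *\<^sub>R y"
proof -
  \<comment> \<open>The equation for \<open>y\<close> is the fixed point equation of
    \<open>f\<close>. On the ball of radius \<open>norm x < 1\<close>, cut down to self-adjoint
    elements commuting with \<open>x\<close>, \<open>f\<close> is a contraction with constant
    \<open>norm x\<close>, so Banach's theorem applies.\<close>
  define S where "S = {y::'a. norm y \<le> norm x} \<inter> {y. adj y - y = 0} \<inter> {y. x * y - y * x = 0}"
  define f where "f y = (1/2) *\<^sub>R (x * x + y * y)" for y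
  have "closed S"
    unfolding S_def
    by (intro closed_Int closed_Collect_le closed_Collect_eq continuous_intros continuous_on_adj)
  then have c: "complete S" by (rule complete_eq_closed[THEN iffD2])
  have "0 \<in> S" by (simp add: S_def)
  then have ne: "S \<noteq> {}" by auto
  have f: "f ` S \<subseteq> S"
  proof clarify
    fix y assume y: "y \<in> S"
    have "norm (x * x + y * y) \<le> norm x * norm x + norm y * norm y"
      by (intro norm_triangle_le add_mono norm_mult_ineq)
    also have "\<dots> \<le> norm x * norm x + norm x * norm x"
      using y by (intro add_left_mono mult_mono) (auto simp: S_def)
    also have "\<dots> \<le> 2 * norm x"
      using assms(2) by (simp add: mult_left_le_one_le)
    finally have "norm (f y) \<le> norm x" by (simp add: f_def)
    moreover have "adj (f y) = f y"
      using y assms by (simp add: f_def S_def adj_scaleR adj_add adj_mult)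
    moreover have "x * f y = f y * x"
    proof -
      have "x * (y * y) = y * y * x" using y by (simp add: S_def) (metis mult.assoc)
      then show ?thesis by (simp add: f_def algebra_simps)
    qed
    ultimately show "f y \<in> S" by (simp add: S_def)
  qed
  have lip: "\<forall>y\<in>S. \<forall>z\<in>S. dist (f y) (f z) \<le> norm x * dist y z"
  proof (intro ballI)
    fix y z assume yz: "y \<in> S" "z \<in> S"
    have "f y - f z = (1/2) *\<^sub>R (y * (y - z) + (y - z) * z)"
      by (simp add: f_def algebra_simps flip: scaleR_diff_right)
    then have "norm (f y - f z) \<le> (norm (y * (y - z)) + norm ((y - z) * z)) / 2"
      by (simp add: norm_triangle_ineq)
    also have "\<dots> \<le> (norm x * norm (y - z) + norm (y - z) * norm x) / 2"
      using yz by (intro divide_right_mono add_mono order_trans[OF norm_mult_ineq] mult_mono)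
        (auto simp: S_def)
    finally show "dist (f y) (f z) \<le> norm x * dist y z" by (simp add: dist_norm)
  qed
  obtain y where y: "y \<in> S" "f y = y"
    using Banach_fix[OF c ne _ assms(2) f] lip by auto
  have "x * x + y * y = 2 *\<^sub>R f y" by (simp add: f_def)
  with y show ?thesis by (auto simp: S_def intro!: exI[of _ y])
qed

text \<open>Continuity of \<open>f\<close> is not assumed. The identity of the previous lemma is
  algebraic, so it passes to the images of \<open>x\<close> and \<open>y\<close>, and there it
  controls the norm of \<open>f x\<close>.\<close>

lemma star_hom_norm_le_one:
  fixes f :: "'a::cstar_algebra \<Rightarrow> 'b::cstar_algebra"
  assumes f: "star_hom f" and x: "adj x = x" "norm x < 1"
  shows "norm (f x) \<le> 1"
proof -
  obtain y where y: "adj y = y" "x * y = y * x" "x * x + y * y = 2 *\<^sub>R y"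
    using sqrt_one_minus_square_exists[OF x] by blast
  define b c where "b = f x" and "c = f y"
  have b: "adj b = b" and c: "adj c = c" and bc: "b * c = c * b"
    and e: "b * b + c * c = 2 *\<^sub>R c"
    using f x y by (simp_all add: b_def c_def flip: star_hom_adj star_hom_mult star_hom_add star_hom_scaleR)
  text \<open>With a unit, \<open>b \<plusminus> \<i>(1 - c)\<close> would be unitary.\<close>
  have iso: "norm (b * z + r *\<^sub>C (z - c * z)) = norm z" if "r = \<i> \<or> r = - \<i>" for z r
  proof -
    define d where "d = z - c * z"
    have ad: "adj d = adj z - adj z * c" by (simp add: d_def adj_diff adj_mult c)
    have r: "cnj r = - r" "r * r = -1" using that by auto
    have "adj (b * z + r *\<^sub>C d) * (b * z + r *\<^sub>C d)
        = adj z * b * b * z + r *\<^sub>C (adj z * b * d) - r *\<^sub>C (adj d * b * z) + adj d * d"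
      using r by (simp add: adj_add adj_mult adj_scaleC b distrib_left distrib_right
            left_diff_distrib right_diff_distrib mult.assoc mult_scaleC_left mult_scaleC_right scaleC_scaleC scaleC_minus_left
            scaleC_diff_right scaleC_minus_right scaleC_one)
    also have "adj z * b * d = adj d * b * z"
    proof -
      have "b * (c * z) = c * (b * z)" using bc by (metis mult.assoc)
      then show ?thesis unfolding ad unfolding d_def
        by (simp add: left_diff_distrib right_diff_distrib mult.assoc)
    qed
    also have "adj z * b * b * z + r *\<^sub>C (adj d * b * z) - r *\<^sub>C (adj d * b * z) + adj d * d
        = adj z * (b * b + c * c) * z + adj z * z - 2 *\<^sub>R (adj z * c * z)"
      unfolding ad unfolding d_def by (simp add: left_diff_distrib right_diff_distrib
          distrib_left distrib_right mult.assoc scaleR_2)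
    also have "\<dots> = adj z * z" by (simp add: e)
    finally have "(norm (b * z + r *\<^sub>C d))\<^sup>2 = (norm z)\<^sup>2"
      by (metis cstar_identity)
    then show ?thesis by (simp add: d_def)
  qed
  \<comment> \<open>For \<open>z = b\<close>, the square \<open>b * b\<close> is the mean of two
    elements of norm \<open>norm b\<close>; hence
    \<open>norm b * norm b \<le> norm b\<close>.\<close>
  let ?d = "\<i> *\<^sub>C (b - c * b)"
  have "2 *\<^sub>R (b * b) = (b * b + ?d) + (b * b + (-\<i>) *\<^sub>C (b - c * b))"
    by (simp add: scaleR_2 scaleC_minus_left)
  then have "norm (2 *\<^sub>R (b * b)) \<le> norm b + norm b"
    by (metis iso norm_triangle_ineq)
  then have "norm b * norm b \<le> norm b"
    using cstar_identity[of b] by (simp add: b power2_eq_square)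
  then show ?thesis
    by (cases "b = 0") (auto simp: b_def mult_le_cancel_right1)
qed

lemma star_hom_contractive:
  fixes f :: "'a::cstar_algebra \<Rightarrow> 'b::cstar_algebra"
  assumes f: "star_hom f"
  shows "norm (f x) \<le> norm x"
proof -
  have sa: "norm (f h) \<le> norm h" if h: "adj h = h" for h
  proof (rule field_le_epsilon)
    fix e :: real assume "e > 0"
    \<comment> \<open>The preceding bound needs a norm strictly below 1, so \<open>h\<close> is
      scaled by slightly more than its norm.\<close>
    define r where "r = norm h + e"
    have r: "r > 0" "norm h < r" using \<open>e > 0\<close> by (simp_all add: r_def add_nonneg_pos)
    have "norm (f ((1/r) *\<^sub>R h)) \<le> 1"
      using r h by (intro star_hom_norm_le_one f) (simp_all add: adj_scaleR)
    then show "norm (f h) \<le> norm h + e"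
      using r f by (simp add: star_hom_scaleR r_def)
  qed
  have "(norm (f x))\<^sup>2 = norm (f (adj x * x))"
    using f by (simp add: star_hom_adj star_hom_mult cstar_identity)
  also have "\<dots> \<le> norm (adj x * x)" by (rule sa) (simp add: adj_mult adj_adj)
  finally show ?thesis by (simp add: cstar_identity)
qed

section \<open>Removing subexponential constants from norm estimates\<close>

text \<open>If \<open>x / K > 1\<close>, its powers with exponent \<open>2^j\<close> grow doubly
  exponentially in \<open>j\<close> and outgrow \<open>C * R ^ j\<close>.\<close>

lemma le_of_power_growth:
  fixes x K C R :: real
  assumes x: "0 \<le> x" and K: "0 \<le> K" and le: "\<And>j. x ^ (2 ^ j) \<le> C * R ^ j * K ^ (2 ^ j)"
  shows "x \<le> K"
proof (rule ccontr)
  assume "\<not> x \<le> K"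
  then have xK: "K < x" by simp
  show False
  proof (cases "K = 0")
    case True
    then show False using le[of 0] xK by simp
  next
    case False
    define r where "r = x / K"
    define S where "S = max 1 \<bar>R\<bar>"
    define D where "D = max 1 \<bar>C\<bar>"
    have r: "r > 1" using xK K False by (simp add: r_def)
    have S: "S \<ge> 1" and D: "D \<ge> 1" by (simp_all add: S_def D_def)
    have upper: "r ^ (2 ^ j) \<le> D * S ^ j" for j
    proof -
      have "r ^ (2 ^ j) \<le> C * R ^ j"
        using le[of j] K False by (simp add: r_def power_divide field_simps)
      also have "\<dots> \<le> \<bar>C\<bar> * \<bar>R\<bar> ^ j"
        by (metis abs_ge_self abs_mult power_abs)
      also have "\<dots> \<le> D * S ^ j"
        by (intro mult_mono power_mono) (auto simp: D_def S_def)
      finally show ?thesis .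
    qed
    \<comment> \<open>The upper bound fails at \<open>j = n + i\<close>:
      \<open>D * S ^ n < 2 ^ i\<close> gives \<open>D * S ^ (n + i) < (2 * S) ^ i\<close>, and
      \<open>2 * S < r ^ n \<le> r ^ (2 ^ n)\<close>.\<close>
    obtain n where n: "2 * S < r ^ n" using real_arch_pow[OF r] by blast
    obtain i where i: "D * S ^ n < 2 ^ i" using real_arch_pow[of 2] by auto
    have "D * S ^ (n + i) < (2 * S) ^ i"
      using i S by (simp add: power_add power_mult_distrib)
    also have "\<dots> \<le> (r ^ (2 ^ n)) ^ i"
    proof (rule power_mono)
      have "r ^ n \<le> r ^ (2 ^ n)" using r by (intro power_increasing) (auto intro: less_imp_le)
      then show "2 * S \<le> r ^ (2 ^ n)" using n by simp
    qed (use S in simp)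
    also have "\<dots> \<le> (r ^ (2 ^ n)) ^ (2 ^ i)"
      using r by (intro power_increasing one_le_power) (auto intro: less_imp_le)
    also have "\<dots> = r ^ (2 ^ (n + i))" by (simp only: power_add power_mult)
    finally show False using upper[of "n + i"] by simp
  qed
qed

text \<open>The power with exponent \<open>2^j\<close>, by repeated squaring since the algebra need
  not have a unit.\<close>

fun sq_iter :: "nat \<Rightarrow> 'a::cstar_algebra \<Rightarrow> 'a" where
  "sq_iter 0 x = x"
| "sq_iter (Suc j) x = sq_iter j x * sq_iter j x"

lemma adj_sq_iter: "adj x = x \<Longrightarrow> adj (sq_iter j x) = sq_iter j x"
  by (induction j) (auto simp: adj_mult)

lemma norm_sq_iter:
  assumes "adj x = x"
  shows "norm (sq_iter j x) = norm x ^ (2 ^ j)"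
proof (induction j)
  case (Suc j)
  have "norm (sq_iter (Suc j) x) = (norm (sq_iter j x))\<^sup>2"
    using cstar_identity[of "sq_iter j x"] adj_sq_iter[OF assms, of j] by simp
  then show ?case by (simp add: Suc mult.commute flip: power_mult)
qed simp

section \<open>Paths in a k-graph\<close>

context k_graph
begin

text \<open>Bundles the side conditions of the category axioms into one premise, so that the axioms
  can serve as simp rules.\<close>

definition composable :: "'m \<Rightarrow> 'm \<Rightarrow> bool" where
  "composable \<mu> \<nu> \<longleftrightarrow> \<mu> \<in> Mor G \<and> \<nu> \<in> Mor G \<and> Dom G \<mu> = Cod G \<nu>"

abbreviation cmp (infixl "\<cdot>" 72) where "\<mu> \<cdot> \<nu> \<equiv> Cmp G \<mu> \<nu>"

lemma composable_Mor:
  assumes "composable \<mu> \<nu>"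
  shows "\<mu> \<in> Mor G" "\<nu> \<in> Mor G" "\<mu> \<cdot> \<nu> \<in> Mor G"
    "Dom G (\<mu> \<cdot> \<nu>) = Dom G \<nu>" "Cod G (\<mu> \<cdot> \<nu>) = Cod G \<mu>"
  using assms by (auto simp: composable_def Cmp_closed Dom_Cmp Cod_Cmp)

lemma composable_deg: "composable \<mu> \<nu> \<Longrightarrow> deg G (\<mu> \<cdot> \<nu>) = deg G \<mu> + deg G \<nu>"
  by (simp add: composable_def deg_Cmp)

lemma composable_assoc:
  assumes "composable \<mu> \<nu>" "composable \<nu> \<rho>"
  shows "composable (\<mu> \<cdot> \<nu>) \<rho>" "composable \<mu> (\<nu> \<cdot> \<rho>)" "\<mu> \<cdot> \<nu> \<cdot> \<rho> = \<mu> \<cdot> (\<nu> \<cdot> \<rho>)"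
  using assms by (auto simp: composable_def Cmp_closed Dom_Cmp Cod_Cmp Cmp_assoc)

lemma composable_left_iff: "composable \<mu> \<nu> \<Longrightarrow> composable (\<mu> \<cdot> \<nu>) \<rho> \<longleftrightarrow> composable \<nu> \<rho>"
  unfolding composable_def using Cmp_closed Dom_Cmp by metis

lemma composable_right_iff: "composable \<nu> \<rho> \<Longrightarrow> composable \<mu> (\<nu> \<cdot> \<rho>) \<longleftrightarrow> composable \<mu> \<nu>"
  unfolding composable_def using Cmp_closed Cod_Cmp by metis

declare composable_Mor [simp] composable_deg [simp]

lemma split_at:
  assumes "\<gamma> \<in> Mor G" "deg G \<gamma> = m + n"
  obtains \<mu> \<nu> where "composable \<mu> \<nu>" "deg G \<mu> = m" "deg G \<nu> = n" "\<gamma> = \<mu> \<cdot> \<nu>"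
  using factorisation[OF assms] unfolding composable_def by blast

text \<open>Additivity of the degree forces the second factors to have equal degrees too, so both
  pairs are the unique factorisation.\<close>

lemma factor_unique:
  assumes "composable \<mu> \<nu>" "composable \<mu>' \<nu>'" "\<mu> \<cdot> \<nu> = \<mu>' \<cdot> \<nu>'" "deg G \<mu> = deg G \<mu>'"
  shows "\<mu> = \<mu>' \<and> \<nu> = \<nu>'"
proof -
  have "deg G \<mu> + deg G \<nu> = deg G \<mu>' + deg G \<nu>'" using assms composable_deg by metis
  then have d: "deg G \<nu> = deg G \<nu>'" using assms(4) by simp
  let ?P = "\<lambda>(x, y). x \<in> Mor G \<and> y \<in> Mor G \<and> Dom G x = Cod G y \<and>
      deg G x = deg G \<mu> \<and> deg G y = deg G \<nu> \<and> \<mu> \<cdot> \<nu> = x \<cdot> y"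
  have "\<exists>!p. ?P p"
    using factorisation[of "\<mu> \<cdot> \<nu>" "deg G \<mu>" "deg G \<nu>"] assms(1) by simp
  moreover have "?P (\<mu>, \<nu>)" "?P (\<mu>', \<nu>')"
    using assms d unfolding composable_def by auto
  ultimately have "(\<mu>, \<nu>) = (\<mu>', \<nu>')" by blast
  then show ?thesis by simp
qed

lemma left_cancel:
  "composable \<mu> \<nu> \<Longrightarrow> composable \<mu> \<nu>' \<Longrightarrow> \<mu> \<cdot> \<nu> = \<mu> \<cdot> \<nu>' \<longleftrightarrow> \<nu> = \<nu>'"
  using factor_unique by blast

lemma composable_Dom [simp]: "\<mu> \<in> Mor G \<Longrightarrow> composable \<mu> (Dom G \<mu>)"
  and composable_Cod [simp]: "\<mu> \<in> Mor G \<Longrightarrow> composable (Cod G \<mu>) \<mu>"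
  unfolding composable_def by (simp_all add: Dom_closed Cod_closed Cod_Dom Dom_Cod)

text \<open>\<open>Cod G \<nu> \<cdot> \<nu>\<close> and \<open>\<nu> \<cdot> Dom G \<nu>\<close>
  are two factorisations of \<open>\<nu>\<close> whose first factors both have degree 0.\<close>

lemma deg_zero_eq:
  assumes "\<nu> \<in> Mor G" "deg G \<nu> = 0"
  shows "\<nu> = Cod G \<nu>" "\<nu> = Dom G \<nu>"
  using factor_unique[of "Cod G \<nu>" \<nu> \<nu> "Dom G \<nu>"] assms
  by (auto simp: deg_Cod Cmp_Dom Cmp_Cod)

lemma Dom_vertex: "f \<in> Mor G \<Longrightarrow> Dom G f \<in> vertices G"
  by (auto simp: vertices_def Dom_closed deg_Dom)

lemma vertex_Dom_Cod: "v \<in> vertices G \<Longrightarrow> v \<in> Mor G \<and> Dom G v = v \<and> Cod G v = v \<and> deg G v = 0"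
  using deg_zero_eq[of v] by (auto simp: vertices_def)

lemma composable_deg_zero_right:
  assumes "composable \<mu> \<nu>" "deg G \<nu> = 0"
  shows "\<nu> = Dom G \<mu>" "\<mu> \<cdot> \<nu> = \<mu>"
  using assms deg_zero_eq[of \<nu>] Cmp_Dom[of \<mu>] unfolding composable_def by auto

section \<open>Prefixes and tails of paths\<close>

definition is_prefix :: "'m \<Rightarrow> 'm \<Rightarrow> bool" where
  "is_prefix \<mu> \<gamma> \<longleftrightarrow> (\<exists>\<nu>. composable \<mu> \<nu> \<and> \<gamma> = \<mu> \<cdot> \<nu>)"

definition tail :: "'m \<Rightarrow> 'm \<Rightarrow> 'm" where
  "tail \<mu> \<gamma> = (THE \<nu>. composable \<mu> \<nu> \<and> \<gamma> = \<mu> \<cdot> \<nu>)"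

lemma tail_cmp [simp]: "composable \<mu> \<nu> \<Longrightarrow> tail \<mu> (\<mu> \<cdot> \<nu>) = \<nu>"
  unfolding tail_def by (rule the_equality) (use left_cancel in auto)

lemma is_prefix_cmp [simp]: "composable \<mu> \<nu> \<Longrightarrow> is_prefix \<mu> (\<mu> \<cdot> \<nu>)"
  by (auto simp: is_prefix_def)

lemma is_prefixE:
  assumes "is_prefix \<mu> \<gamma>"
  obtains "composable \<mu> (tail \<mu> \<gamma>)" "\<gamma> = \<mu> \<cdot> tail \<mu> \<gamma>"
  using assms by (auto simp: is_prefix_def)

lemma is_prefix_refl: "\<mu> \<in> Mor G \<Longrightarrow> is_prefix \<mu> \<mu>"
  by (metis Cmp_Dom composable_Dom is_prefix_cmp)

lemma is_prefix_trans: "is_prefix \<mu> \<nu> \<Longrightarrow> is_prefix \<nu> \<rho> \<Longrightarrow> is_prefix \<mu> \<rho>"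
  unfolding is_prefix_def using composable_assoc composable_left_iff by metis

lemma is_prefix_unique:
  assumes "is_prefix \<mu> \<gamma>" "is_prefix \<mu>' \<gamma>" "deg G \<mu> = deg G \<mu>'"
  shows "\<mu> = \<mu>'"
  using assms factor_unique unfolding is_prefix_def by metis

lemma vec_nat_diff:
  fixes m n :: "nat ^ 'k"
  assumes "\<And>i. m $ i \<le> n $ i"
  shows "m + (n - m) = n"
  using assms by (simp add: vec_eq_iff)

lemma is_prefix_exists:
  assumes "\<gamma> \<in> Mor G" "\<And>i. m $ i \<le> deg G \<gamma> $ i"
  obtains \<mu> where "is_prefix \<mu> \<gamma>" "deg G \<mu> = m"
  using split_at[OF assms(1) vec_nat_diff[OF assms(2), symmetric]] is_prefix_cmp by metis

lemma is_prefix_deg_le: "is_prefix \<mu> \<gamma> \<Longrightarrow> deg G \<mu> $ i \<le> deg G \<gamma> $ i"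
  by (auto simp: is_prefix_def)

text \<open>The prefix of \<open>\<nu>\<close> with the degree of \<open>\<mu>\<close> is also a
  prefix of \<open>\<gamma>\<close>, hence it is \<open>\<mu>\<close>.\<close>

lemma is_prefix_deg_mono:
  assumes "is_prefix \<mu> \<gamma>" "is_prefix \<nu> \<gamma>" "\<And>i. deg G \<mu> $ i \<le> deg G \<nu> $ i"
  shows "is_prefix \<mu> \<nu>"
proof -
  have "\<nu> \<in> Mor G" using assms(2) by (auto simp: is_prefix_def)
  then obtain \<mu>' where "is_prefix \<mu>' \<nu>" "deg G \<mu>' = deg G \<mu>"
    using is_prefix_exists assms(3) by blast
  then show ?thesis using assms is_prefix_trans is_prefix_unique by metis
qed

text \<open>Replaces the description operator by a relation; the degree bound ensures that the
  described prefix exists.\<close>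

lemma init_seg_eq_iff:
  assumes "\<gamma> \<in> Mor G" "\<mu> \<in> Mor G" "\<And>i. deg G \<mu> $ i \<le> deg G \<gamma> $ i"
  shows "init_seg G \<gamma> (deg G \<mu>) = \<mu> \<longleftrightarrow> is_prefix \<mu> \<gamma>"
proof -
  obtain \<mu>' where \<mu>': "is_prefix \<mu>' \<gamma>" "deg G \<mu>' = deg G \<mu>"
    using is_prefix_exists[OF assms(1,3)] by blast
  have "init_seg G \<gamma> (deg G \<mu>) = (THE x. deg G x = deg G \<mu> \<and> is_prefix x \<gamma>)"
    unfolding init_seg_def is_prefix_def composable_def by (rule arg_cong[where f = The]) auto
  also have "\<dots> = \<mu>'"
    using \<mu>' by (intro the_equality) (auto dest: is_prefix_unique)
  finally show ?thesis using \<mu>' is_prefix_unique by metis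
qed

section \<open>Minimal common extensions\<close>

lemma vmax_nth [simp]: "vmax m n $ i = max (m $ i) (n $ i)"
  by (simp add: vmax_def)

lemma MCE_iff:
  assumes "\<mu> \<in> Mor G" "\<nu> \<in> Mor G"
  shows "\<gamma> \<in> MCE G \<mu> \<nu> \<longleftrightarrow> deg G \<gamma> = vmax (deg G \<mu>) (deg G \<nu>) \<and> is_prefix \<mu> \<gamma> \<and> is_prefix \<nu> \<gamma>"
proof (cases "\<gamma> \<in> Mor G")
  case True
  then show ?thesis using assms init_seg_eq_iff[OF True] by (auto simp: MCE_def)
qed (auto simp: MCE_def is_prefix_def)

lemma MCE_commute: "MCE G \<mu> \<nu> = MCE G \<nu> \<mu>"
  by (auto simp: MCE_def vmax_def max.commute)

lemma MCE_pairs_iff: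
  assumes "\<mu> \<in> Mor G" "\<nu> \<in> Mor G"
  shows "(\<alpha>, \<beta>) \<in> MCE_pairs G \<mu> \<nu> \<longleftrightarrow> composable \<mu> \<alpha> \<and> composable \<nu> \<beta> \<and> \<mu> \<cdot> \<alpha> = \<nu> \<cdot> \<beta> \<and>
    deg G (\<mu> \<cdot> \<alpha>) = vmax (deg G \<mu>) (deg G \<nu>)"
  unfolding MCE_pairs_def composable_def
  by (auto simp: MCE_iff assms is_prefix_def composable_def simp del: composable_Mor)

lemma MCE_pairs_swap:
  assumes "\<mu> \<in> Mor G" "\<nu> \<in> Mor G"
  shows "(\<alpha>, \<beta>) \<in> MCE_pairs G \<mu> \<nu> \<longleftrightarrow> (\<beta>, \<alpha>) \<in> MCE_pairs G \<nu> \<mu>"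
  using assms by (auto simp: MCE_pairs_iff vmax_def max.commute)

text \<open>The prefix of degree \<open>vmax (deg G \<mu>) (deg G \<nu>)\<close> of the given
  extension still has \<open>\<mu>\<close> and \<open>\<nu>\<close> as prefixes;
  \<open>\<delta>\<close> is the remaining tail.\<close>

lemma common_extension:
  assumes "composable \<mu> \<beta>" "composable \<nu> \<beta>'" "\<mu> \<cdot> \<beta> = \<nu> \<cdot> \<beta>'"
  obtains \<alpha> \<alpha>' \<delta> where "(\<alpha>, \<alpha>') \<in> MCE_pairs G \<mu> \<nu>" "composable \<alpha> \<delta>" "composable \<alpha>' \<delta>"
    "\<beta> = \<alpha> \<cdot> \<delta>" "\<beta>' = \<alpha>' \<cdot> \<delta>"
proof -
  let ?g = "\<mu> \<cdot> \<beta>"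
  have g: "is_prefix \<mu> ?g" "is_prefix \<nu> ?g" using assms by (auto simp: is_prefix_def)
  then have le: "vmax (deg G \<mu>) (deg G \<nu>) $ i \<le> deg G ?g $ i" for i
    using is_prefix_deg_le by simp
  obtain \<gamma> where \<gamma>: "is_prefix \<gamma> ?g" "deg G \<gamma> = vmax (deg G \<mu>) (deg G \<nu>)"
    by (rule is_prefix_exists[OF composable_Mor(3)[OF assms(1)], of "vmax (deg G \<mu>) (deg G \<nu>)"])
      (rule le)
  have p: "is_prefix \<mu> \<gamma>" "is_prefix \<nu> \<gamma>"
    by (rule is_prefix_deg_mono[OF g(1) \<gamma>(1)] is_prefix_deg_mono[OF g(2) \<gamma>(1)], simp add: \<gamma>(2))+
  define \<alpha> \<alpha>' \<delta> where "\<alpha> = tail \<mu> \<gamma>" and "\<alpha>' = tail \<nu> \<gamma>" and "\<delta> = tail \<gamma> ?g"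
  have a: "composable \<mu> \<alpha>" "\<gamma> = \<mu> \<cdot> \<alpha>" and a': "composable \<nu> \<alpha>'" "\<gamma> = \<nu> \<cdot> \<alpha>'"
    and d: "composable \<gamma> \<delta>" "?g = \<gamma> \<cdot> \<delta>"
    using p \<gamma>(1) by (auto simp: \<alpha>_def \<alpha>'_def \<delta>_def elim: is_prefixE)
  have c: "composable \<alpha> \<delta>" "composable \<alpha>' \<delta>"
    using a a' d composable_left_iff by metis+
  have "\<mu> \<cdot> \<beta> = \<mu> \<cdot> (\<alpha> \<cdot> \<delta>)" "\<nu> \<cdot> \<beta>' = \<nu> \<cdot> (\<alpha>' \<cdot> \<delta>)"
    using a a' d c assms(3) composable_assoc(3) by metis+
  then have "\<beta> = \<alpha> \<cdot> \<delta>" "\<beta>' = \<alpha>' \<cdot> \<delta>"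
    using left_cancel assms a a' c composable_assoc(2) by metis+
  moreover have "(\<alpha>, \<alpha>') \<in> MCE_pairs G \<mu> \<nu>"
    using a a' \<gamma> assms by (subst MCE_pairs_iff) (auto simp del: composable_deg)
  ultimately show thesis using that c by blast
qed

text \<open>All first components of \<open>MCE_pairs G \<mu> \<nu>\<close> have the same degree.
  With the previous lemma, the common extensions of \<open>\<mu>\<close> and \<open>\<nu>\<close>
  split disjointly over the minimal ones.\<close>

lemma common_extension_unique:
  assumes "(\<alpha>, \<alpha>') \<in> MCE_pairs G \<mu> \<nu>" "(\<eta>, \<eta>') \<in> MCE_pairs G \<mu> \<nu>"
    and m: "\<mu> \<in> Mor G" "\<nu> \<in> Mor G"
    and "composable \<alpha> \<delta>" "composable \<eta> \<epsilon>" "\<alpha> \<cdot> \<delta> = \<eta> \<cdot> \<epsilon>"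
  shows "\<alpha> = \<eta> \<and> \<alpha>' = \<eta>' \<and> \<delta> = \<epsilon>"
proof -
  have a: "composable \<mu> \<alpha>" "composable \<nu> \<alpha>'" "\<mu> \<cdot> \<alpha> = \<nu> \<cdot> \<alpha>'"
      "deg G \<mu> + deg G \<alpha> = vmax (deg G \<mu>) (deg G \<nu>)"
    and e: "composable \<mu> \<eta>" "composable \<nu> \<eta>'" "\<mu> \<cdot> \<eta> = \<nu> \<cdot> \<eta>'"
      "deg G \<mu> + deg G \<eta> = vmax (deg G \<mu>) (deg G \<nu>)"
    using assms(1,2) MCE_pairs_iff[OF m] composable_deg by metis+
  have "deg G \<alpha> = deg G \<eta>" using a e by (metis add_left_cancel)
  then have "\<alpha> = \<eta> \<and> \<delta> = \<epsilon>" using assms factor_unique by blast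
  moreover from this have "\<alpha>' = \<eta>'" using a e left_cancel by metis
  ultimately show ?thesis by simp
qed

section \<open>Finite alignment for paths of arbitrary degree\<close>

definition len :: "'m \<Rightarrow> nat" where "len \<mu> = (\<Sum>i\<in>UNIV. deg G \<mu> $ i)"

lemma len_cmp [simp]: "composable \<mu> \<nu> \<Longrightarrow> len (\<mu> \<cdot> \<nu>) = len \<mu> + len \<nu>"
  by (simp add: len_def sum.distrib)

lemma len_zero_iff: "len \<mu> = 0 \<longleftrightarrow> deg G \<mu> = 0"
  by (simp add: len_def vec_eq_iff)

lemma finite_MCE_pairs_iff:
  assumes "\<mu> \<in> Mor G" "\<nu> \<in> Mor G"
  shows "finite (MCE_pairs G \<mu> \<nu>) \<longleftrightarrow> finite (MCE G \<mu> \<nu>)"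
proof -
  have "MCE_pairs G \<mu> \<nu> = (\<lambda>\<gamma>. (tail \<mu> \<gamma>, tail \<nu> \<gamma>)) ` MCE G \<mu> \<nu>"
  proof (intro equalityI subsetI)
    fix x assume "x \<in> MCE_pairs G \<mu> \<nu>"
    then obtain \<alpha> \<beta> where x: "x = (\<alpha>, \<beta>)" "(\<alpha>, \<beta>) \<in> MCE_pairs G \<mu> \<nu>" by (cases x) auto
    then have "\<mu> \<cdot> \<alpha> \<in> MCE G \<mu> \<nu>" "composable \<mu> \<alpha>" "composable \<nu> \<beta>" "\<mu> \<cdot> \<alpha> = \<nu> \<cdot> \<beta>"
      using MCE_pairs_iff[OF assms, of \<alpha> \<beta>] by (auto simp: MCE_pairs_def)
    then have "\<mu> \<cdot> \<alpha> \<in> MCE G \<mu> \<nu>" "tail \<mu> (\<mu> \<cdot> \<alpha>) = \<alpha>" "tail \<nu> (\<mu> \<cdot> \<alpha>) = \<beta>"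
      by (metis tail_cmp)+
    then show "x \<in> (\<lambda>\<gamma>. (tail \<mu> \<gamma>, tail \<nu> \<gamma>)) ` MCE G \<mu> \<nu>" using x by force
  next
    fix x assume "x \<in> (\<lambda>\<gamma>. (tail \<mu> \<gamma>, tail \<nu> \<gamma>)) ` MCE G \<mu> \<nu>"
    then show "x \<in> MCE_pairs G \<mu> \<nu>"
      using assms by (auto simp: MCE_pairs_iff MCE_iff simp del: composable_deg elim!: is_prefixE)
  qed
  moreover have "inj_on (\<lambda>\<gamma>. (tail \<mu> \<gamma>, tail \<nu> \<gamma>)) (MCE G \<mu> \<nu>)"
    by (intro inj_onI) (metis MCE_iff assms is_prefixE prod.inject)
  ultimately show ?thesis by (simp add: finite_image_iff)
qed

text \<open>A minimal common extension of \<open>\<rho> \<cdot> \<mu>\<close> and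
  \<open>\<nu>\<close> passes through some \<open>\<rho> \<cdot> \<alpha>\<close> in
  \<open>MCE G \<rho> \<nu>\<close>; after removing \<open>\<rho>\<close> it is a minimal common
  extension of \<open>\<mu>\<close> and \<open>\<alpha>\<close>. Both choices are finite.\<close>

lemma finite_MCE_cmp:
  assumes c: "composable \<rho> \<mu>" and \<nu>: "\<nu> \<in> Mor G"
    and fin: "finite (MCE G \<rho> \<nu>)"
    and fin': "\<And>\<alpha>. \<alpha> \<in> Mor G \<Longrightarrow> deg G \<rho> + deg G \<alpha> = vmax (deg G \<rho>) (deg G \<nu>) \<Longrightarrow> finite (MCE G \<mu> \<alpha>)"
  shows "finite (MCE G (\<rho> \<cdot> \<mu>) \<nu>)"
proof -
  have "MCE G (\<rho> \<cdot> \<mu>) \<nu> \<subseteq> (\<Union>p\<in>MCE_pairs G \<rho> \<nu>. (\<lambda>\<gamma>. \<rho> \<cdot> \<gamma>) ` MCE G \<mu> (fst p))"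
  proof
    fix \<gamma> assume \<gamma>: "\<gamma> \<in> MCE G (\<rho> \<cdot> \<mu>) \<nu>"
    then obtain \<beta> \<beta>' where b: "composable (\<rho> \<cdot> \<mu>) \<beta>" "composable \<nu> \<beta>'"
        "\<gamma> = \<rho> \<cdot> \<mu> \<cdot> \<beta>" "\<gamma> = \<nu> \<cdot> \<beta>'"
      using c \<nu> by (auto simp: MCE_iff is_prefix_def)
    have mb: "composable \<mu> \<beta>" "composable \<rho> (\<mu> \<cdot> \<beta>)" "\<gamma> = \<rho> \<cdot> (\<mu> \<cdot> \<beta>)"
      using b c composable_left_iff composable_assoc by auto
    then obtain \<alpha> \<alpha>' \<delta> where a: "(\<alpha>, \<alpha>') \<in> MCE_pairs G \<rho> \<nu>" "composable \<alpha> \<delta>" "\<mu> \<cdot> \<beta> = \<alpha> \<cdot> \<delta>"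
      using common_extension[OF mb(2) b(2)] b(4) by metis
    have "composable \<rho> \<alpha>" "deg G (\<rho> \<cdot> \<alpha>) = vmax (deg G \<rho>) (deg G \<nu>)"
      using a(1) c \<nu> MCE_pairs_iff by auto
    then have d: "deg G \<rho> + deg G \<alpha> = vmax (deg G \<rho>) (deg G \<nu>)" by simp
    have "deg G \<gamma> = vmax (deg G \<rho> + deg G \<mu>) (deg G \<nu>)"
      using \<gamma> c \<nu> by (simp add: MCE_iff)
    then have "deg G \<rho> + deg G (\<mu> \<cdot> \<beta>) = vmax (deg G \<rho> + deg G \<mu>) (deg G \<nu>)"
      using mb by simp
    then have "deg G \<rho> $ i + deg G (\<mu> \<cdot> \<beta>) $ i = max (deg G \<rho> $ i + deg G \<mu> $ i) (deg G \<nu> $ i)" for i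
      by (metis vector_add_component vmax_nth)
    moreover have "deg G \<rho> $ i + deg G \<alpha> $ i = max (deg G \<rho> $ i) (deg G \<nu> $ i)" for i
      using d by (metis vector_add_component vmax_nth)
    \<comment> \<open>In each coordinate, subtracting the degree of \<open>\<rho>\<close> from
      \<open>max (\<rho> + \<mu>) \<nu>\<close> gives \<open>max \<mu> (\<nu> - \<rho>)\<close> with
      truncated subtraction, and \<open>\<alpha>\<close> has degree
      \<open>\<nu> - \<rho>\<close>.\<close>
    ultimately have "deg G (\<mu> \<cdot> \<beta>) $ i = max (deg G \<mu> $ i) (deg G \<alpha> $ i)" for i
      by (smt (verit) add_le_cancel_left add_left_cancel le_add1 max_def nat_le_linear add_cancel_right_right le_antisym)
    then have "deg G (\<mu> \<cdot> \<beta>) = vmax (deg G \<mu>) (deg G \<alpha>)"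
      by (auto simp only: vec_eq_iff vmax_nth)
    then have "\<mu> \<cdot> \<beta> \<in> MCE G \<mu> \<alpha>"
      using mb a c by (subst MCE_iff) (auto simp: is_prefix_def simp del: composable_deg)
    then show "\<gamma> \<in> (\<Union>p\<in>MCE_pairs G \<rho> \<nu>. (\<lambda>\<gamma>. \<rho> \<cdot> \<gamma>) ` MCE G \<mu> (fst p))"
      using a mb(3) by force
  qed
  moreover have "finite (MCE_pairs G \<rho> \<nu>)"
    using finite_MCE_pairs_iff[of \<rho> \<nu>] c \<nu> fin by simp
  moreover have "finite (MCE G \<mu> (fst p))" if "p \<in> MCE_pairs G \<rho> \<nu>" for p
  proof -
    obtain \<alpha> \<beta> where p: "p = (\<alpha>, \<beta>)" by (cases p)
    then have "composable \<rho> \<alpha>" "deg G (\<rho> \<cdot> \<alpha>) = vmax (deg G \<rho>) (deg G \<nu>)"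
      using that c \<nu> MCE_pairs_iff by auto
    then show ?thesis using fin' p by simp
  qed
  ultimately show ?thesis by (meson finite_UN_I finite_imageI finite_subset)
qed

lemma finite_MCE_vertex:
  assumes "\<mu> \<in> Mor G" "\<nu> \<in> Mor G" "deg G \<mu> = 0"
  shows "finite (MCE G \<mu> \<nu>)"
proof -
  have "\<gamma> = \<nu>" if "\<gamma> \<in> MCE G \<mu> \<nu>" for \<gamma>
  proof -
    have "deg G \<gamma> = deg G \<nu>" "is_prefix \<nu> \<gamma>"
      using that assms by (auto simp: MCE_iff vec_eq_iff)
    moreover have "\<gamma> \<in> Mor G" using that by (simp add: MCE_def)
    ultimately show ?thesis using is_prefix_unique[of \<nu> \<gamma> \<gamma>] is_prefix_refl by metis
  qed
  then have "MCE G \<mu> \<nu> \<subseteq> {\<nu>}" by blast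
  then show ?thesis by (rule finite_subset) simp
qed

lemma split_edge:
  assumes "\<mu> \<in> Mor G" "deg G \<mu> $ i \<noteq> 0"
  obtains \<rho> e where "composable \<rho> e" "deg G e = axis i 1" "\<mu> = \<rho> \<cdot> e" "len \<mu> = Suc (len \<rho>)"
proof -
  have "deg G \<mu> = (deg G \<mu> - axis i 1) + axis i 1"
    using assms(2) by (auto simp: vec_eq_iff axis_def)
  then obtain \<rho> e where "composable \<rho> e" "deg G e = axis i 1" "\<mu> = \<rho> \<cdot> e"
    using split_at[OF assms(1)] by metis
  moreover from this have "len \<mu> = Suc (len \<rho>)"
    by (simp add: len_def axis_def sum.distrib)
  ultimately show thesis using that by blast
qed

text \<open>Induction over the second path, removing its last edge \<open>f\<close>: what remains of
  \<open>e\<close> after the initial segment is a vertex, which is harmless, or again an edge, and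
  then the assumption on pairs of edges applies to it and \<open>f\<close>.\<close>

lemma finite_MCE_edge:
  assumes fa: "finitely_aligned G"
  shows "e \<in> Mor G \<Longrightarrow> deg G e = axis i 1 \<Longrightarrow> \<nu> \<in> Mor G \<Longrightarrow> finite (MCE G e \<nu>)"
proof (induction "len \<nu>" arbitrary: e \<nu>)
  case 0
  then show ?case using finite_MCE_vertex[of \<nu> e] len_zero_iff[of \<nu>] by (simp add: MCE_commute[of e])
next
  case (Suc n)
  then have "deg G \<nu> \<noteq> 0" using len_zero_iff[of \<nu>] by auto
  then obtain j where "deg G \<nu> $ j \<noteq> 0" by (auto simp: vec_eq_iff)
  then obtain \<rho> f where f: "composable \<rho> f" "deg G f = axis j 1" "\<nu> = \<rho> \<cdot> f" "len \<nu> = Suc (len \<rho>)"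
    using split_edge Suc.prems by blast
  have "finite (MCE G (\<rho> \<cdot> f) e)"
  proof (rule finite_MCE_cmp)
    show "finite (MCE G \<rho> e)"
      using Suc f by (simp add: MCE_commute[of \<rho>])
    fix \<alpha> assume \<alpha>: "\<alpha> \<in> Mor G" "deg G \<rho> + deg G \<alpha> = vmax (deg G \<rho>) (deg G e)"
    \<comment> \<open>A positive \<open>deg G \<rho> $ i\<close> already absorbs
      \<open>axis i 1\<close>; otherwise all of \<open>axis i 1\<close> remains for
      \<open>\<alpha>\<close>.\<close>
    have "deg G \<alpha> = 0 \<or> deg G \<alpha> = axis i 1"
    proof -
      have *: "deg G \<rho> $ l + deg G \<alpha> $ l = max (deg G \<rho> $ l) (axis i 1 $ l)" for l
        using \<alpha>(2) Suc.prems(2) by (metis vector_add_component vmax_nth)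
      have "deg G \<alpha> $ l = axis i 1 $ l - deg G \<rho> $ l" for l
        using *[of l] by (cases "deg G \<rho> $ l \<le> axis i 1 $ l") auto
      then have "deg G \<alpha> $ l = (if l = i \<and> deg G \<rho> $ l = 0 then 1 else 0)" for l
        by (auto simp: axis_def)
      then show ?thesis
        by (cases "deg G \<rho> $ i = 0") (auto simp: vec_eq_iff axis_def)
    qed
    then show "finite (MCE G f \<alpha>)"
    proof
      assume "deg G \<alpha> = 0"
      then show ?thesis using finite_MCE_vertex[of \<alpha> f] f \<alpha> by (simp add: MCE_commute[of f])
    next
      assume "deg G \<alpha> = axis i 1"
      then show ?thesis using fa f \<alpha> composable_Mor(2)[OF f(1)] unfolding finitely_aligned_def by blast
    qed
  qed (use f Suc.prems in auto)
  then show ?case using f by (simp add: MCE_commute[of e])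
qed

text \<open>A second induction removes edges from the first path. Since
  \<open>finite_MCE_edge\<close> allows any second path, it covers whatever \<open>\<alpha>\<close>
  arises in \<open>finite_MCE_cmp\<close>.\<close>

lemma finite_MCE:
  assumes fa: "finitely_aligned G"
  shows "\<mu> \<in> Mor G \<Longrightarrow> \<nu> \<in> Mor G \<Longrightarrow> finite (MCE G \<mu> \<nu>)"
proof (induction "len \<mu>" arbitrary: \<mu>)
  case 0
  then show ?case using finite_MCE_vertex[of \<mu> \<nu>] len_zero_iff by simp
next
  case (Suc n)
  then have "deg G \<mu> \<noteq> 0" using len_zero_iff[of \<mu>] by auto
  then obtain j where "deg G \<mu> $ j \<noteq> 0" by (auto simp: vec_eq_iff)
  then obtain \<rho> f where f: "composable \<rho> f" "deg G f = axis j 1" "\<mu> = \<rho> \<cdot> f" "len \<mu> = Suc (len \<rho>)"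
    using split_edge Suc.prems by blast
  then have "finite (MCE G \<rho> \<nu>)" using Suc by simp
  then show ?case
    unfolding f(3) using f Suc.prems finite_MCE_edge[OF fa composable_Mor(2)[OF f(1)] f(2)]
    by (intro finite_MCE_cmp)
qed

lemma finite_MCE_pairs:
  assumes "finitely_aligned G" "\<mu> \<in> Mor G" "\<nu> \<in> Mor G"
  shows "finite (MCE_pairs G \<mu> \<nu>)"
  using assms finite_MCE finite_MCE_pairs_iff by blast

end

section \<open>The regular representation\<close>

context k_graph
begin

definition path_pairs :: "('m \<times> 'm) set" where
  "path_pairs = {(\<mu>, \<nu>). \<mu> \<in> Mor G \<and> \<nu> \<in> Mor G \<and> Dom G \<mu> = Dom G \<nu>}"

text \<open>The operator of \<open>s\<^sub>\<mu> s\<^sub>\<nu>\<^sup>*\<close> in the regular representation on \<open>\<ell>\<^sup>2(\<Lambda>)\<close>, where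
  \<open>s\<^sub>\<mu>\<close> sends the basis vector of \<open>\<rho>\<close> to that of \<open>\<mu>\<rho>\<close>.\<close>

definition shift_op :: "'m \<times> 'm \<Rightarrow> ('m \<Rightarrow> complex) \<Rightarrow> 'm \<Rightarrow> complex" where
  "shift_op p \<xi> x = (if is_prefix (fst p) x then \<xi> (snd p \<cdot> tail (fst p) x) else 0)"

text \<open>The finitely supported vectors of l2(\<Lambda>v). Shift operators preserve the source of
  a path, so l2(\<Lambda>) splits into these invariant summands.\<close>

definition fin_vec :: "'m \<Rightarrow> ('m \<Rightarrow> complex) set" where
  "fin_vec v = {\<xi>. finite {x. \<xi> x \<noteq> 0} \<and> (\<forall>x. \<xi> x \<noteq> 0 \<longrightarrow> x \<in> Mor G \<and> Dom G x = v)}"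

end

section \<open>Norm and inner product of finitely supported vectors\<close>

definition l2 :: "('m \<Rightarrow> complex) \<Rightarrow> real" where
  "l2 \<xi> = L2_set (\<lambda>x. cmod (\<xi> x)) {x. \<xi> x \<noteq> 0}"

text \<open>Conjugate-linear in the first argument, whose support indexes the sum; as with
  \<open>l2\<close>, an infinite support would give 0 by default.\<close>

definition ip :: "('m \<Rightarrow> complex) \<Rightarrow> ('m \<Rightarrow> complex) \<Rightarrow> complex" where
  "ip \<xi> \<eta> = (\<Sum>x | \<xi> x \<noteq> 0. cnj (\<xi> x) * \<eta> x)"

lemma l2_superset:
  assumes "finite A" "\<And>x. \<xi> x \<noteq> 0 \<Longrightarrow> x \<in> A"
  shows "l2 \<xi> = L2_set (\<lambda>x. cmod (\<xi> x)) A"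
  unfolding l2_def L2_set_def
  by (rule arg_cong[where f = sqrt], rule sum.mono_neutral_left) (use assms in auto)

lemma l2_nonneg [simp]: "0 \<le> l2 \<xi>"
  by (simp add: l2_def)

lemma l2_power2: "(l2 \<xi>)\<^sup>2 = (\<Sum>x | \<xi> x \<noteq> 0. (cmod (\<xi> x))\<^sup>2)"
  by (simp add: l2_def L2_set_def sum_nonneg)

lemma l2_power2_superset:
  assumes "finite A" "\<And>x. \<xi> x \<noteq> 0 \<Longrightarrow> x \<in> A"
  shows "(l2 \<xi>)\<^sup>2 = (\<Sum>x\<in>A. (cmod (\<xi> x))\<^sup>2)"
proof -
  have "l2 \<xi> = L2_set (\<lambda>x. cmod (\<xi> x)) A" by (rule l2_superset[OF assms])
  then show ?thesis by (simp add: L2_set_def sum_nonneg)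
qed

lemma ip_superset:
  assumes "finite A" "\<And>x. \<xi> x \<noteq> 0 \<Longrightarrow> x \<in> A"
  shows "ip \<xi> \<eta> = (\<Sum>x\<in>A. cnj (\<xi> x) * \<eta> x)"
  unfolding ip_def by (rule sum.mono_neutral_left) (use assms in auto)

lemma ip_self: "ip \<xi> \<xi> = of_real ((l2 \<xi>)\<^sup>2)"
  by (simp add: ip_def l2_power2 complex_norm_square mult.commute del: of_real_power)

lemma ip_bound:
  assumes "finite {x. \<xi> x \<noteq> 0}" "finite {x. \<eta> x \<noteq> 0}"
  shows "cmod (ip \<xi> \<eta>) \<le> l2 \<xi> * l2 \<eta>"
proof -
  let ?A = "{x. \<xi> x \<noteq> 0} \<union> {x. \<eta> x \<noteq> 0}"
  have "ip \<xi> \<eta> = (\<Sum>x\<in>?A. cnj (\<xi> x) * \<eta> x)"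
    by (rule ip_superset) (use assms in auto)
  then have "cmod (ip \<xi> \<eta>) \<le> (\<Sum>x\<in>?A. \<bar>cmod (\<xi> x)\<bar> * \<bar>cmod (\<eta> x)\<bar>)"
    by (simp add: sum_norm_le norm_mult)
  also have "\<dots> \<le> L2_set (\<lambda>x. cmod (\<xi> x)) ?A * L2_set (\<lambda>x. cmod (\<eta> x)) ?A"
    by (rule L2_set_mult_ineq)
  also have "\<dots> = l2 \<xi> * l2 \<eta>"
    by (intro arg_cong2[where f = "(*)"] l2_superset[symmetric]) (use assms in auto)
  finally show ?thesis .
qed

lemma cmod_le_l2: "finite {x. \<xi> x \<noteq> 0} \<Longrightarrow> cmod (\<xi> x) \<le> l2 \<xi>"
proof (cases "\<xi> x = 0")
  case False
  assume "finite {x. \<xi> x \<noteq> 0}"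
  then show ?thesis unfolding l2_def using False by (intro member_le_L2_set) auto
qed simp

section \<open>Shift operators, their adjoints, bounds and products\<close>

context k_graph
begin

lemma fin_vec_sum:
  assumes "finite I" "\<And>i. i \<in> I \<Longrightarrow> \<xi> i \<in> fin_vec v"
  shows "(\<lambda>x. \<Sum>i\<in>I. c i * \<xi> i x) \<in> fin_vec v"
proof -
  have *: "\<exists>i\<in>I. \<xi> i x \<noteq> 0" if "(\<Sum>i\<in>I. c i * \<xi> i x) \<noteq> 0" for x
    using that by (metis (no_types, lifting) mult_zero_right sum.neutral)
  then have "{x. (\<Sum>i\<in>I. c i * \<xi> i x) \<noteq> 0} \<subseteq> (\<Union>i\<in>I. {x. \<xi> i x \<noteq> 0})" by auto
  moreover have "finite (\<Union>i\<in>I. {x. \<xi> i x \<noteq> 0})" using assms by (auto simp: fin_vec_def)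
  ultimately have "finite {x. (\<Sum>i\<in>I. c i * \<xi> i x) \<noteq> 0}" by (rule finite_subset)
  then show ?thesis using assms(2) * by (fastforce simp: fin_vec_def)
qed

lemma path_pairs_iff: "p \<in> path_pairs \<longleftrightarrow> fst p \<in> Mor G \<and> snd p \<in> Mor G \<and> Dom G (fst p) = Dom G (snd p)"
  by (cases p) (auto simp: path_pairs_def)

lemma path_pairs_composable: "p \<in> path_pairs \<Longrightarrow> composable (fst p) \<beta> \<longleftrightarrow> composable (snd p) \<beta>"
  by (auto simp: path_pairs_iff composable_def simp del: composable_Mor)

lemma shift_op_cmp [simp]: "composable (fst p) \<beta> \<Longrightarrow> shift_op p \<xi> (fst p \<cdot> \<beta>) = \<xi> (snd p \<cdot> \<beta>)"
  by (simp add: shift_op_def)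

lemma shift_op_sum: "shift_op p (\<lambda>x. \<Sum>i\<in>I. c i * \<xi> i x) x = (\<Sum>i\<in>I. c i * shift_op p (\<xi> i) x)"
  by (simp add: shift_op_def)

lemma shift_op_nonzero:
  assumes "p \<in> path_pairs" "shift_op p \<xi> x \<noteq> 0"
  obtains \<beta> where "composable (fst p) \<beta>" "composable (snd p) \<beta>" "x = fst p \<cdot> \<beta>" "\<xi> (snd p \<cdot> \<beta>) \<noteq> 0"
  using assms path_pairs_composable by (auto simp: shift_op_def is_prefix_def split: if_splits)

lemma shift_op_fin_vec:
  assumes p: "p \<in> path_pairs" and \<xi>: "\<xi> \<in> fin_vec v"
  shows "shift_op p \<xi> \<in> fin_vec v"
proof -
  have "{x. shift_op p \<xi> x \<noteq> 0} \<subseteq> (\<lambda>y. fst p \<cdot> tail (snd p) y) ` {y. \<xi> y \<noteq> 0}"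
  proof clarify
    fix x assume "shift_op p \<xi> x \<noteq> 0"
    then obtain \<beta> where b: "composable (fst p) \<beta>" "composable (snd p) \<beta>" "x = fst p \<cdot> \<beta>" "\<xi> (snd p \<cdot> \<beta>) \<noteq> 0"
      by (rule shift_op_nonzero[OF p])
    then show "x \<in> (\<lambda>y. fst p \<cdot> tail (snd p) y) ` {y. \<xi> y \<noteq> 0}"
      by (intro image_eqI[of _ _ "snd p \<cdot> \<beta>"]) simp_all
  qed
  then have "finite {x. shift_op p \<xi> x \<noteq> 0}"
    using \<xi> finite_surj by (auto simp: fin_vec_def)
  moreover have "x \<in> Mor G \<and> Dom G x = v" if nz: "shift_op p \<xi> x \<noteq> 0" for x
  proof -
    obtain \<beta> where b: "composable (fst p) \<beta>" "composable (snd p) \<beta>" "x = fst p \<cdot> \<beta>" "\<xi> (snd p \<cdot> \<beta>) \<noteq> 0"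
      by (rule shift_op_nonzero[OF p nz])
    then have "Dom G (snd p \<cdot> \<beta>) = v" using \<xi> by (auto simp: fin_vec_def)
    then show ?thesis using b by simp
  qed
  ultimately show ?thesis by (simp add: fin_vec_def)
qed

lemma swap_path_pairs: "prod.swap p \<in> path_pairs \<longleftrightarrow> p \<in> path_pairs"
  by (auto simp: path_pairs_iff)

text \<open>Change of variables along the bijection \<nu>\<beta> \<mapsto> \<mu>\<beta> given by
  \<open>p = (\<mu>, \<nu>)\<close>. \<open>F\<close> is arbitrary so that the formula serves both
  for inner products and for sums in a C*-algebra.\<close>

lemma sum_shift_op:
  assumes p: "p \<in> path_pairs"
  shows "(\<Sum>x | shift_op p \<xi> x \<noteq> 0. F x (shift_op p \<xi> x)) =
    (\<Sum>y | \<xi> y \<noteq> 0 \<and> is_prefix (snd p) y. F (fst p \<cdot> tail (snd p) y) (\<xi> y))"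
proof (rule sum.reindex_bij_witness[where j = "\<lambda>x. snd p \<cdot> tail (fst p) x" and i = "\<lambda>y. fst p \<cdot> tail (snd p) y"])
  fix y assume "y \<in> {y. \<xi> y \<noteq> 0 \<and> is_prefix (snd p) y}"
  then obtain \<beta> where b: "composable (snd p) \<beta>" "y = snd p \<cdot> \<beta>" "\<xi> y \<noteq> 0"
    by (auto simp: is_prefix_def)
  then have "composable (fst p) \<beta>" using path_pairs_composable[OF p] by blast
  with b show "snd p \<cdot> tail (fst p) (fst p \<cdot> tail (snd p) y) = y"
    "fst p \<cdot> tail (snd p) y \<in> {x. shift_op p \<xi> x \<noteq> 0}" by simp_all
next
  fix x assume "x \<in> {x. shift_op p \<xi> x \<noteq> 0}"
  then obtain \<beta> where b: "composable (fst p) \<beta>" "composable (snd p) \<beta>" "x = fst p \<cdot> \<beta>" "\<xi> (snd p \<cdot> \<beta>) \<noteq> 0"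
    using shift_op_nonzero[OF p] by blast
  then show "fst p \<cdot> tail (snd p) (snd p \<cdot> tail (fst p) x) = x"
    "snd p \<cdot> tail (fst p) x \<in> {y. \<xi> y \<noteq> 0 \<and> is_prefix (snd p) y}"
    "F (fst p \<cdot> tail (snd p) (snd p \<cdot> tail (fst p) x)) (\<xi> (snd p \<cdot> tail (fst p) x)) = F x (shift_op p \<xi> x)"
    by simp_all
qed

lemma ip_shift_op:
  assumes p: "p \<in> path_pairs" and \<xi>: "\<xi> \<in> fin_vec v"
  shows "ip (shift_op p \<xi>) \<eta> = ip \<xi> (shift_op (prod.swap p) \<eta>)"
proof -
  have "ip \<xi> (shift_op (prod.swap p) \<eta>) =
      (\<Sum>y | \<xi> y \<noteq> 0 \<and> is_prefix (snd p) y. cnj (\<xi> y) * \<eta> (fst p \<cdot> tail (snd p) y))"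
    unfolding ip_def by (rule sum.mono_neutral_cong_right) (use \<xi> in \<open>auto simp: shift_op_def fin_vec_def\<close>)
  also have "\<dots> = ip (shift_op p \<xi>) \<eta>"
    unfolding ip_def by (rule sum_shift_op[OF p, where F = "\<lambda>x z. cnj z * \<eta> x", symmetric])
  finally show ?thesis by simp
qed

text \<open>One constant serves all \<open>v\<close>; for operators preserving the orthogonal
  summands l2(\<Lambda>v) this amounts to boundedness on l2(\<Lambda>), without forming a
  completion.\<close>

definition bounded_op :: "(('m \<Rightarrow> complex) \<Rightarrow> 'm \<Rightarrow> complex) \<Rightarrow> real \<Rightarrow> bool" where
  "bounded_op T K \<longleftrightarrow> 0 \<le> K \<and> (\<forall>v. \<forall>\<xi>\<in>fin_vec v. l2 (T \<xi>) \<le> K * l2 \<xi>)"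

lemma bounded_op_comp:
  assumes "bounded_op T K" "bounded_op S L" "\<And>v \<xi>. \<xi> \<in> fin_vec v \<Longrightarrow> S \<xi> \<in> fin_vec v"
  shows "bounded_op (\<lambda>\<xi>. T (S \<xi>)) (K * L)"
  unfolding bounded_op_def
proof (intro conjI allI ballI)
  show "0 \<le> K * L" using assms by (simp add: bounded_op_def)
  fix v \<xi> assume \<xi>: "\<xi> \<in> fin_vec v"
  then have "l2 (T (S \<xi>)) \<le> K * l2 (S \<xi>)" using assms by (auto simp: bounded_op_def)
  also have "\<dots> \<le> K * (L * l2 \<xi>)"
    using assms \<xi> by (intro mult_left_mono) (auto simp: bounded_op_def)
  finally show "l2 (T (S \<xi>)) \<le> K * L * l2 \<xi>" by (simp add: mult.assoc)
qed

text \<open>Test with \<open>\<xi> = S \<eta>\<close>: the square of \<open>l2 \<xi>\<close> is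
  \<open>ip (T \<xi>) \<eta>\<close>, at most \<open>K * l2 \<xi> * l2 \<eta>\<close>; then cancel
  \<open>l2 \<xi>\<close>.\<close>

lemma bounded_op_adjoint:
  assumes T: "bounded_op T K" "\<And>v \<xi>. \<xi> \<in> fin_vec v \<Longrightarrow> T \<xi> \<in> fin_vec v"
    and S: "\<And>v \<xi>. \<xi> \<in> fin_vec v \<Longrightarrow> S \<xi> \<in> fin_vec v"
    and adjoint: "\<And>v \<xi> \<eta>. \<xi> \<in> fin_vec v \<Longrightarrow> \<eta> \<in> fin_vec v \<Longrightarrow> ip (T \<xi>) \<eta> = ip \<xi> (S \<eta>)"
  shows "bounded_op S K"
  unfolding bounded_op_def
proof (intro conjI allI ballI)
  show K: "0 \<le> K" using T by (simp add: bounded_op_def)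
  fix v \<eta> assume \<eta>: "\<eta> \<in> fin_vec v"
  define \<xi> where "\<xi> = S \<eta>"
  have \<xi>: "\<xi> \<in> fin_vec v" using S \<eta> by (simp add: \<xi>_def)
  have "complex_of_real ((l2 \<xi>)\<^sup>2) = ip (T \<xi>) \<eta>"
    using adjoint[OF \<xi> \<eta>] by (simp add: ip_self flip: \<xi>_def)
  then have "(l2 \<xi>)\<^sup>2 = cmod (ip (T \<xi>) \<eta>)"
    by (metis norm_of_real abs_of_nonneg zero_le_power2)
  also have "\<dots> \<le> l2 (T \<xi>) * l2 \<eta>"
    using T(2)[OF \<xi>] \<eta> by (intro ip_bound) (auto simp: fin_vec_def)
  also have "\<dots> \<le> K * l2 \<xi> * l2 \<eta>"
    using T(1) \<xi> by (intro mult_right_mono) (auto simp: bounded_op_def)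
  finally have "l2 \<xi> * l2 \<xi> \<le> l2 \<xi> * (K * l2 \<eta>)" by (simp add: power2_eq_square mult_ac)
  then show "l2 (S \<eta>) \<le> K * l2 \<eta>"
  proof (cases "l2 \<xi> = 0")
    case False
    then have "0 < l2 \<xi>" using l2_nonneg[of \<xi>] by linarith
    with \<open>l2 \<xi> * l2 \<xi> \<le> l2 \<xi> * (K * l2 \<eta>)\<close> show ?thesis by (simp add: \<xi>_def)
  qed (use K in \<open>simp add: \<xi>_def\<close>)
qed

text \<open>The indices that occur when the product of the spanning elements for \<open>p\<close>
  and \<open>r\<close> is expanded by the Cuntz-Krieger relation for
  \<open>adj (t \<mu>) * t \<nu>\<close>.\<close>

definition pair_prods :: "'m \<times> 'm \<Rightarrow> 'm \<times> 'm \<Rightarrow> ('m \<times> 'm) set" where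
  "pair_prods p r = (\<lambda>(\<alpha>, \<beta>). (fst p \<cdot> \<alpha>, snd r \<cdot> \<beta>)) ` MCE_pairs G (snd p) (fst r)"

lemma pair_prodsE:
  assumes "z \<in> pair_prods p r" "p \<in> path_pairs" "r \<in> path_pairs"
  obtains \<alpha> \<beta> where "z = (fst p \<cdot> \<alpha>, snd r \<cdot> \<beta>)" "(\<alpha>, \<beta>) \<in> MCE_pairs G (snd p) (fst r)"
    "composable (fst p) \<alpha>" "composable (snd p) \<alpha>" "composable (fst r) \<beta>" "composable (snd r) \<beta>"
    "snd p \<cdot> \<alpha> = fst r \<cdot> \<beta>"
proof -
  obtain \<alpha> \<beta> where ab: "z = (fst p \<cdot> \<alpha>, snd r \<cdot> \<beta>)" "(\<alpha>, \<beta>) \<in> MCE_pairs G (snd p) (fst r)"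
    using assms(1) by (auto simp: pair_prods_def)
  moreover have "composable (snd p) \<alpha>" "composable (fst r) \<beta>" "snd p \<cdot> \<alpha> = fst r \<cdot> \<beta>"
    using ab(2) MCE_pairs_iff[of "snd p" "fst r"] assms(2,3) by (auto simp: path_pairs_iff)
  ultimately show thesis using that path_pairs_composable assms(2,3) by blast
qed

lemma pair_prods_path_pairs:
  assumes "p \<in> path_pairs" "r \<in> path_pairs"
  shows "pair_prods p r \<subseteq> path_pairs"
proof
  fix z assume "z \<in> pair_prods p r"
  then obtain \<alpha> \<beta> where z: "z = (fst p \<cdot> \<alpha>, snd r \<cdot> \<beta>)"
    "composable (fst p) \<alpha>" "composable (snd p) \<alpha>" "composable (fst r) \<beta>" "composable (snd r) \<beta>"
    "snd p \<cdot> \<alpha> = fst r \<cdot> \<beta>"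
    using assms pair_prodsE by metis
  then have "Dom G \<alpha> = Dom G \<beta>" by (metis composable_Mor(4))
  then show "z \<in> path_pairs" using z by (simp add: path_pairs_iff)
qed

text \<open>A path \<open>x\<close> can be reached by both shifts in turn only through a minimal
  common extension of \<open>snd p\<close> and \<open>fst r\<close>, and by uniqueness a single
  summand is then responsible for it.\<close>

lemma shift_op_mult:
  assumes p: "p \<in> path_pairs" and r: "r \<in> path_pairs" and fin: "finite (MCE_pairs G (snd p) (fst r))"
  shows "shift_op p (shift_op r \<xi>) x =
    (\<Sum>(\<alpha>, \<beta>)\<in>MCE_pairs G (snd p) (fst r). shift_op (fst p \<cdot> \<alpha>, snd r \<cdot> \<beta>) \<xi> x)"
proof -
  let ?M = "MCE_pairs G (snd p) (fst r)"
  let ?f = "\<lambda>\<alpha> \<beta>. shift_op (fst p \<cdot> \<alpha>, snd r \<cdot> \<beta>) \<xi> x"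
  have mor: "snd p \<in> Mor G" "fst r \<in> Mor G" using p r by (auto simp: path_pairs_iff)
  have M: "composable (fst p) \<alpha>" "composable (snd p) \<alpha>" "composable (fst r) \<beta>" "composable (snd r) \<beta>"
    "snd p \<cdot> \<alpha> = fst r \<cdot> \<beta>" if "(\<alpha>, \<beta>) \<in> ?M" for \<alpha> \<beta>
    using that MCE_pairs_iff[OF mor] path_pairs_composable p r by blast+
  show ?thesis
  proof (cases "\<exists>\<alpha> \<beta> \<delta>. (\<alpha>, \<beta>) \<in> ?M \<and> composable \<alpha> \<delta> \<and> x = fst p \<cdot> (\<alpha> \<cdot> \<delta>)")
    case True
    then obtain \<alpha> \<beta> \<delta> where a: "(\<alpha>, \<beta>) \<in> ?M" "composable \<alpha> \<delta>" "x = fst p \<cdot> (\<alpha> \<cdot> \<delta>)" by blast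
    note Ma = M[OF a(1)]
    have bd: "composable \<beta> \<delta>" using Ma a(2) composable_left_iff by metis
    \<comment> \<open>A second non-vanishing summand would factor
      \<open>\<alpha> \<cdot> \<delta>\<close> through another minimal pair.\<close>
    have zero: "?f \<alpha>' \<beta>' = 0" if "(\<alpha>', \<beta>') \<in> ?M" "(\<alpha>', \<beta>') \<noteq> (\<alpha>, \<beta>)" for \<alpha>' \<beta>'
    proof (rule ccontr)
      note Ma' = M[OF that(1)]
      assume "?f \<alpha>' \<beta>' \<noteq> 0"
      then have "is_prefix (fst p \<cdot> \<alpha>') x" by (auto simp: shift_op_def split: if_splits)
      then obtain \<epsilon> where e: "composable (fst p \<cdot> \<alpha>') \<epsilon>" "x = fst p \<cdot> \<alpha>' \<cdot> \<epsilon>"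
        by (auto simp: is_prefix_def)
      then have e': "composable \<alpha>' \<epsilon>" "x = fst p \<cdot> (\<alpha>' \<cdot> \<epsilon>)"
        using Ma' composable_left_iff composable_assoc(3) by metis+
      then have "\<alpha>' \<cdot> \<epsilon> = \<alpha> \<cdot> \<delta>"
        using left_cancel[of "fst p"] a Ma(1) Ma'(1) composable_assoc(2) by metis
      then show False
        using common_extension_unique[OF that(1) a(1) mor e'(1) a(2)] that(2) by simp
    qed
    have "(\<Sum>(\<alpha>, \<beta>)\<in>?M. ?f \<alpha> \<beta>) = (\<Sum>z\<in>{(\<alpha>, \<beta>)}. case z of (\<alpha>, \<beta>) \<Rightarrow> ?f \<alpha> \<beta>)"
      using fin a(1) zero by (intro sum.mono_neutral_right) auto
    also have "\<dots> = ?f \<alpha> \<beta>" by simp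
    also have "\<dots> = \<xi> (snd r \<cdot> \<beta> \<cdot> \<delta>)"
    proof -
      have "composable (fst p \<cdot> \<alpha>) \<delta>" "x = fst p \<cdot> \<alpha> \<cdot> \<delta>"
        using a(2,3) Ma(1) composable_assoc by metis+
      then show ?thesis using shift_op_cmp[of "(fst p \<cdot> \<alpha>, snd r \<cdot> \<beta>)"] by simp
    qed
    also have "\<dots> = \<xi> (snd r \<cdot> (\<beta> \<cdot> \<delta>))"
      using Ma bd composable_assoc by metis
    also have "\<dots> = shift_op r \<xi> (fst r \<cdot> (\<beta> \<cdot> \<delta>))"
      using Ma(3) bd composable_assoc(2) by simp
    also have "fst r \<cdot> (\<beta> \<cdot> \<delta>) = snd p \<cdot> (\<alpha> \<cdot> \<delta>)"
      using Ma bd a(2) composable_assoc(3) by metis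
    also have "shift_op r \<xi> \<dots> = shift_op p (shift_op r \<xi>) x"
      using a(2,3) Ma(1) composable_assoc(2) by simp
    finally show ?thesis by simp
  next
    case False
    have "?f \<alpha> \<beta> = 0" if "(\<alpha>, \<beta>) \<in> ?M" for \<alpha> \<beta>
    proof (rule ccontr)
      assume "?f \<alpha> \<beta> \<noteq> 0"
      then have "is_prefix (fst p \<cdot> \<alpha>) x" by (auto simp: shift_op_def split: if_splits)
      then obtain \<epsilon> where "composable (fst p \<cdot> \<alpha>) \<epsilon>" "x = fst p \<cdot> \<alpha> \<cdot> \<epsilon>"
        by (auto simp: is_prefix_def)
      then show False
        using False that M[OF that] composable_left_iff composable_assoc(3) by metis
    qed
    then have "(\<Sum>(\<alpha>, \<beta>)\<in>?M. ?f \<alpha> \<beta>) = 0" by (intro sum.neutral) auto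
    moreover have "shift_op p (shift_op r \<xi>) x = 0"
    proof (rule ccontr)
      assume "shift_op p (shift_op r \<xi>) x \<noteq> 0"
      then obtain \<beta> where b: "composable (fst p) \<beta>" "composable (snd p) \<beta>" "x = fst p \<cdot> \<beta>"
          "shift_op r \<xi> (snd p \<cdot> \<beta>) \<noteq> 0"
        by (rule shift_op_nonzero[OF p])
      then obtain \<beta>' where "composable (fst r) \<beta>'" "snd p \<cdot> \<beta> = fst r \<cdot> \<beta>'"
        using shift_op_nonzero[OF r] by blast
      then show False using common_extension[OF b(2)] b(3) False by metis
    qed
    ultimately show ?thesis by simp
  qed
qed

end

section \<open>Spanning elements of a Cuntz-Krieger family and their operators\<close>

locale cuntz_krieger = k_graph G for G :: "('m, 'k::finite) kgraph" +
  fixes t :: "'m \<Rightarrow> 'b::cstar_algebra"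
  assumes fa: "finitely_aligned G" and ck: "CK_family G t"
begin

lemma t_partial_isometry: "f \<in> Mor G \<Longrightarrow> t f * adj (t f) * t f = t f"
  using ck by (simp add: CK_family_def partial_isometry_def)

lemma t_vertex: "v \<in> vertices G \<Longrightarrow> projection (t v)"
  using ck by (simp add: CK_family_def)

lemma t_mult: "composable f g \<Longrightarrow> t f * t g = t (f \<cdot> g)"
proof -
  have "\<forall>f\<in>Mor G. \<forall>g\<in>Mor G. Dom G f = Cod G g \<longrightarrow> t f * t g = t (f \<cdot> g)"
    using ck unfolding CK_family_def by (elim conjE)
  then show "composable f g \<Longrightarrow> t f * t g = t (f \<cdot> g)" unfolding composable_def by blast
qed

lemma t_isometry: "f \<in> Mor G \<Longrightarrow> adj (t f) * t f = t (Dom G f)"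
  using ck by (simp add: CK_family_def)

lemma t_adj_mult:
  assumes "\<mu> \<in> Mor G" "\<nu> \<in> Mor G"
  shows "adj (t \<mu>) * t \<nu> = (\<Sum>(\<alpha>, \<beta>)\<in>MCE_pairs G \<mu> \<nu>. t \<alpha> * adj (t \<beta>))"
proof -
  have "\<forall>\<mu>\<in>Mor G. \<forall>\<nu>\<in>Mor G.
      adj (t \<mu>) * t \<nu> = (\<Sum>(\<alpha>, \<beta>)\<in>MCE_pairs G \<mu> \<nu>. t \<alpha> * adj (t \<beta>))"
    using ck unfolding CK_family_def by (elim conjE)
  then show ?thesis using assms by blast
qed

lemma norm_t_le: "f \<in> Mor G \<Longrightarrow> norm (t f) \<le> 1"
proof -
  assume f: "f \<in> Mor G"
  have "(norm (t f))\<^sup>2 = norm (t (Dom G f))" using cstar_identity[of "t f"] t_isometry[OF f] by simp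
  also have "\<dots> \<le> 1" by (rule norm_projection_le[OF t_vertex[OF Dom_vertex[OF f]]])
  finally show ?thesis using power2_le_imp_le[of "norm (t f)" 1] by simp
qed

definition elem :: "'m \<times> 'm \<Rightarrow> 'b" where "elem p = t (fst p) * adj (t (snd p))"

lemma norm_elem_le: "p \<in> path_pairs \<Longrightarrow> norm (elem p) \<le> 1"
  unfolding elem_def path_pairs_iff
  using norm_mult_ineq[of "t (fst p)" "adj (t (snd p))"] norm_t_le[of "fst p"] norm_t_le[of "snd p"]
  by (metis mult_le_one norm_adj norm_ge_zero order_trans)

lemma adj_elem: "adj (elem p) = elem (prod.swap p)"
  by (simp add: elem_def adj_mult adj_adj)

lemma elem_mult:
  assumes p: "p \<in> path_pairs" and r: "r \<in> path_pairs"
  shows "elem p * elem r =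
    (\<Sum>(\<alpha>, \<beta>)\<in>MCE_pairs G (snd p) (fst r). elem (fst p \<cdot> \<alpha>, snd r \<cdot> \<beta>))"
proof -
  have mor: "snd p \<in> Mor G" "fst r \<in> Mor G" using p r by (auto simp: path_pairs_iff)
  have "elem p * elem r = t (fst p) * (adj (t (snd p)) * t (fst r)) * adj (t (snd r))"
    by (simp add: elem_def mult.assoc)
  also have "\<dots> = (\<Sum>(\<alpha>, \<beta>)\<in>MCE_pairs G (snd p) (fst r). t (fst p) * (t \<alpha> * adj (t \<beta>)) * adj (t (snd r)))"
    by (simp add: t_adj_mult[OF mor] sum_distrib_left sum_distrib_right case_prod_unfold)
  also have "\<dots> = (\<Sum>(\<alpha>, \<beta>)\<in>MCE_pairs G (snd p) (fst r). elem (fst p \<cdot> \<alpha>, snd r \<cdot> \<beta>))"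
  proof (rule sum.cong[OF refl], clarify)
    fix \<alpha> \<beta> assume "(\<alpha>, \<beta>) \<in> MCE_pairs G (snd p) (fst r)"
    then have "composable (fst p) \<alpha>" "composable (snd r) \<beta>"
      using MCE_pairs_iff[OF mor] path_pairs_composable p r by blast+
    then show "t (fst p) * (t \<alpha> * adj (t \<beta>)) * adj (t (snd r)) = elem (fst p \<cdot> \<alpha>, snd r \<cdot> \<beta>)"
      by (simp add: elem_def mult.assoc flip: t_mult adj_mult)
  qed
  finally show ?thesis .
qed

text \<open>One coefficient vector gives both \<open>x\<close> and \<open>T\<close>. This is a
  relation because it is not clear at this stage that \<open>x\<close> determines \<open>T\<close>
  or conversely. \<open>W\<close> contains the indices used, so that finiteness and degrees can be
  tracked.\<close>

definition represents :: "('m \<times> 'm) set \<Rightarrow> 'b \<Rightarrow> (('m \<Rightarrow> complex) \<Rightarrow> 'm \<Rightarrow> complex) \<Rightarrow> bool" where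
  "represents W x T \<longleftrightarrow> finite W \<and> W \<subseteq> path_pairs \<and>
     (\<exists>c. x = (\<Sum>p\<in>W. c p *\<^sub>C elem p) \<and> T = (\<lambda>\<xi> y. \<Sum>p\<in>W. c p * shift_op p \<xi> y))"

lemma represents_single:
  assumes "finite W" "W \<subseteq> path_pairs" "p \<in> W"
  shows "represents W (elem p) (shift_op p)"
  unfolding represents_def
proof (intro conjI exI[of _ "\<lambda>q. if q = p then 1 else 0"])
  show "elem p = (\<Sum>q\<in>W. (if q = p then 1 else 0) *\<^sub>C elem q)"
    using assms by (simp add: if_distrib[of "\<lambda>z. z *\<^sub>C _"] scaleC_one sum.delta' cong: if_cong)
  show "shift_op p = (\<lambda>\<xi> y. \<Sum>q\<in>W. (if q = p then 1 else 0) * shift_op q \<xi> y)"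
    using assms by (intro ext) (simp add: if_distrib[of "\<lambda>z. z * _"] sum.delta' cong: if_cong)
qed (use assms in auto)

lemma represents_scaled_sum:
  assumes "finite I" "finite W" "W \<subseteq> path_pairs" "\<And>i. i \<in> I \<Longrightarrow> represents W (x i) (T i)"
  shows "represents W (\<Sum>i\<in>I. a i *\<^sub>C x i) (\<lambda>\<xi> y. \<Sum>i\<in>I. a i * T i \<xi> y)"
proof -
  have "\<forall>i\<in>I. \<exists>c. x i = (\<Sum>p\<in>W. c p *\<^sub>C elem p) \<and> T i = (\<lambda>\<xi> y. \<Sum>p\<in>W. c p * shift_op p \<xi> y)"
    using assms(4) by (simp add: represents_def)
  from bchoice[OF this] obtain c where c: "\<And>i. i \<in> I \<Longrightarrow> x i = (\<Sum>p\<in>W. c i p *\<^sub>C elem p)"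
      "\<And>i. i \<in> I \<Longrightarrow> T i = (\<lambda>\<xi> y. \<Sum>p\<in>W. c i p * shift_op p \<xi> y)"
    by blast
  have "(\<Sum>i\<in>I. a i *\<^sub>C x i) = (\<Sum>i\<in>I. \<Sum>p\<in>W. (a i * c i p) *\<^sub>C elem p)"
    by (simp add: c scaleC_sum_right scaleC_scaleC)
  also have "\<dots> = (\<Sum>p\<in>W. (\<Sum>i\<in>I. a i * c i p) *\<^sub>C elem p)"
    unfolding scaleC_sum_left by (rule sum.swap)
  finally have "(\<Sum>i\<in>I. a i *\<^sub>C x i) = (\<Sum>p\<in>W. (\<Sum>i\<in>I. a i * c i p) *\<^sub>C elem p)" .
  moreover have "(\<Sum>i\<in>I. a i * T i \<xi> y) = (\<Sum>p\<in>W. (\<Sum>i\<in>I. a i * c i p) * shift_op p \<xi> y)" for \<xi> y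
    by (simp add: c sum_distrib_left sum_distrib_right mult.assoc) (rule sum.swap)
  ultimately have "\<exists>c. (\<Sum>i\<in>I. a i *\<^sub>C x i) = (\<Sum>p\<in>W. c p *\<^sub>C elem p) \<and>
      (\<lambda>\<xi> y. \<Sum>i\<in>I. a i * T i \<xi> y) = (\<lambda>\<xi> y. \<Sum>p\<in>W. c p * shift_op p \<xi> y)"
    by (intro exI[of _ "\<lambda>p. \<Sum>i\<in>I. a i * c i p"]) simp
  then show ?thesis unfolding represents_def using assms(2,3) by blast
qed

lemma represents_mono:
  assumes "represents W x T" "finite W'" "W \<subseteq> W'" "W' \<subseteq> path_pairs"
  shows "represents W' x T"
proof -
  obtain c where c: "x = (\<Sum>p\<in>W. c p *\<^sub>C elem p)" "T = (\<lambda>\<xi> y. \<Sum>p\<in>W. c p * shift_op p \<xi> y)"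
    using assms unfolding represents_def by blast
  have fW: "finite W" using assms by (simp add: represents_def)
  have "represents W' (elem p) (shift_op p)" if "p \<in> W" for p
    using represents_single assms that by blast
  then show ?thesis
    unfolding c by (intro represents_scaled_sum) (use assms fW in auto)
qed

lemma represents_fin_vec:
  assumes "represents W x T" "\<xi> \<in> fin_vec v"
  shows "T \<xi> \<in> fin_vec v"
proof -
  obtain c where c: "T = (\<lambda>\<xi> y. \<Sum>p\<in>W. c p * shift_op p \<xi> y)"
    using assms unfolding represents_def by blast
  show ?thesis unfolding c using assms
    by (intro fin_vec_sum shift_op_fin_vec) (auto simp: represents_def)
qed

text \<open>\<open>elem_mult\<close> and \<open>shift_op_mult\<close> expand elements and operators
  by the same formula, so the coefficients agree on any finite \<open>Z\<close> containing all
  product indices.\<close>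

lemma represents_mult:
  assumes x: "represents W x T" and y: "represents W' y S"
    and Z: "finite Z" "\<And>p r. p \<in> W \<Longrightarrow> r \<in> W' \<Longrightarrow> pair_prods p r \<subseteq> Z" "Z \<subseteq> path_pairs"
  shows "represents Z (x * y) (\<lambda>\<xi>. T (S \<xi>))"
proof -
  obtain c where c: "x = (\<Sum>p\<in>W. c p *\<^sub>C elem p)" "T = (\<lambda>\<xi> y. \<Sum>p\<in>W. c p * shift_op p \<xi> y)"
    using x unfolding represents_def by blast
  obtain d where d: "y = (\<Sum>p\<in>W'. d p *\<^sub>C elem p)" "S = (\<lambda>\<xi> y. \<Sum>p\<in>W'. d p * shift_op p \<xi> y)"
    using y unfolding represents_def by blast
  have W: "finite W" "W \<subseteq> path_pairs" "finite W'" "W' \<subseteq> path_pairs"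
    using x y by (auto simp: represents_def)
  let ?I = "W \<times> W'"
  have *: "represents Z (elem p * elem r) (\<lambda>\<xi>. shift_op p (shift_op r \<xi>))" if "p \<in> W" "r \<in> W'" for p r
  proof -
    have p: "p \<in> path_pairs" and r: "r \<in> path_pairs" using that W by auto
    let ?M = "MCE_pairs G (snd p) (fst r)"
    have fin: "finite ?M" using p r finite_MCE_pairs[OF fa] by (auto simp: path_pairs_iff)
    let ?g = "\<lambda>(\<alpha>, \<beta>). (fst p \<cdot> \<alpha>, snd r \<cdot> \<beta>)"
    have "represents Z (\<Sum>z\<in>?M. 1 *\<^sub>C elem (?g z)) (\<lambda>\<xi> y. \<Sum>z\<in>?M. 1 * shift_op (?g z) \<xi> y)"
      using Z(2)[OF that] by (intro represents_scaled_sum represents_single) (use fin Z in \<open>auto simp: pair_prods_def\<close>)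
    moreover have "(\<Sum>z\<in>?M. 1 *\<^sub>C elem (?g z)) = elem p * elem r"
      unfolding elem_mult[OF p r] by (rule sum.cong) (auto simp: scaleC_one)
    moreover have "(\<lambda>\<xi> y. \<Sum>z\<in>?M. 1 * shift_op (?g z) \<xi> y) = (\<lambda>\<xi>. shift_op p (shift_op r \<xi>))"
      by (intro ext, subst shift_op_mult[OF p r fin]) (auto intro: sum.cong)
    ultimately show ?thesis by simp
  qed
  have "represents Z (\<Sum>z\<in>?I. (c (fst z) * d (snd z)) *\<^sub>C (elem (fst z) * elem (snd z)))
      (\<lambda>\<xi> y. \<Sum>z\<in>?I. (c (fst z) * d (snd z)) * shift_op (fst z) (shift_op (snd z) \<xi>) y)"
    by (intro represents_scaled_sum *) (use W Z in auto)
  moreover have "(\<Sum>z\<in>?I. (c (fst z) * d (snd z)) *\<^sub>C (elem (fst z) * elem (snd z))) = x * y"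
    by (simp add: c d sum_product sum.cartesian_product case_prod_unfold mult_scaleC_left
        mult_scaleC_right scaleC_scaleC mult.commute)
  moreover have "(\<lambda>\<xi> y. \<Sum>z\<in>?I. (c (fst z) * d (snd z)) * shift_op (fst z) (shift_op (snd z) \<xi>) y) = (\<lambda>\<xi>. T (S \<xi>))"
    by (intro ext) (simp add: c d shift_op_sum sum_distrib_left sum.cartesian_product case_prod_unfold mult.assoc)
  ultimately show ?thesis by simp
qed

text \<open>Swapping each pair and conjugating its coefficient yields both the adjoint element and
  the formal adjoint operator.\<close>

lemma represents_adj:
  assumes x: "represents W x T"
  obtains S where "represents (prod.swap ` W) (adj x) S"
    "\<And>v \<xi> \<eta>. \<xi> \<in> fin_vec v \<Longrightarrow> \<eta> \<in> fin_vec v \<Longrightarrow> ip (T \<xi>) \<eta> = ip \<xi> (S \<eta>)"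
proof -
  obtain c where c: "x = (\<Sum>p\<in>W. c p *\<^sub>C elem p)" "T = (\<lambda>\<xi> y. \<Sum>p\<in>W. c p * shift_op p \<xi> y)"
    using x unfolding represents_def by blast
  have W: "finite W" "W \<subseteq> path_pairs" using x by (auto simp: represents_def)
  define S where "S = (\<lambda>\<xi> y. \<Sum>p\<in>W. cnj (c p) * shift_op (prod.swap p) \<xi> y)"
  have "represents (prod.swap ` W) (\<Sum>p\<in>W. cnj (c p) *\<^sub>C elem (prod.swap p)) S"
    unfolding S_def by (intro represents_scaled_sum represents_single) (use W swap_path_pairs in auto)
  moreover have "(\<Sum>p\<in>W. cnj (c p) *\<^sub>C elem (prod.swap p)) = adj x"
    by (simp add: c adj_sum adj_scaleC adj_elem)
  moreover have "ip (T \<xi>) \<eta> = ip \<xi> (S \<eta>)" if \<xi>: "\<xi> \<in> fin_vec v" for v \<xi> \<eta>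
  proof -
    \<comment> \<open>A common finite set containing the supports of all summands, so that the sums
      can be interchanged.\<close>
    define A where "A = (\<Union>p\<in>W. {y. shift_op p \<xi> y \<noteq> 0})"
    have A: "finite A"
      unfolding A_def
    proof (rule finite_UN_I[OF W(1)])
      fix p assume "p \<in> W"
      then have "shift_op p \<xi> \<in> fin_vec v" using W(2) \<xi> by (intro shift_op_fin_vec) auto
      then show "finite {y. shift_op p \<xi> y \<noteq> 0}" by (simp add: fin_vec_def)
    qed
    have "ip (T \<xi>) \<eta> = (\<Sum>y\<in>A. cnj (T \<xi> y) * \<eta> y)"
    proof (rule ip_superset[OF A])
      fix y assume "T \<xi> y \<noteq> 0"
      then obtain p where "p \<in> W" "c p * shift_op p \<xi> y \<noteq> 0"
        unfolding c by (rule sum.not_neutral_contains_not_neutral)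
      then show "y \<in> A" by (auto simp: A_def)
    qed
    also have "\<dots> = (\<Sum>p\<in>W. cnj (c p) * (\<Sum>y\<in>A. cnj (shift_op p \<xi> y) * \<eta> y))"
      unfolding c by (simp add: cnj_sum sum_distrib_right sum_distrib_left mult.assoc) (rule sum.swap)
    also have "\<dots> = (\<Sum>p\<in>W. cnj (c p) * ip (shift_op p \<xi>) \<eta>)"
      by (intro sum.cong refl arg_cong2[where f = "(*)"] ip_superset[symmetric] A) (auto simp: A_def)
    also have "\<dots> = (\<Sum>p\<in>W. cnj (c p) * ip \<xi> (shift_op (prod.swap p) \<eta>))"
      using ip_shift_op \<xi> W by (intro sum.cong) auto
    also have "\<dots> = ip \<xi> (S \<eta>)"
      by (simp add: ip_def S_def sum_distrib_left mult_ac) (subst sum.swap, simp)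
    finally show ?thesis .
  qed
  ultimately show thesis using that by simp
qed

end

section \<open>Norms dominate the regular representation\<close>

context k_graph
begin

text \<open>The path \<open>\<mu>\<close> has degree (1,...,1) and is built edge by edge so that no
  initial edge of a path in \<open>S\<close> is a prefix of it. A common extension with
  \<open>\<alpha>\<close> in \<open>S\<close> would start with an edge of \<open>\<alpha>\<close>,
  which would then be a prefix of \<open>\<mu>\<close>.\<close>

lemma exists_avoiding_path:
  assumes fa: "finitely_aligned G"
    and inf: "\<And>v i. v \<in> vertices G \<Longrightarrow> infinite (paths_at G (axis i 1) v)"
    and v: "v \<in> vertices G" and S: "finite S" "\<And>\<alpha>. \<alpha> \<in> S \<Longrightarrow> \<alpha> \<in> Mor G \<and> deg G \<alpha> \<noteq> 0"
  obtains \<mu> where "\<mu> \<in> Mor G" "Cod G \<mu> = v" "\<And>\<alpha>. \<alpha> \<in> S \<Longrightarrow> MCE_pairs G \<mu> \<alpha> = {}"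
proof -
  \<comment> \<open>All initial edges of paths in \<open>S\<close>, finitely many because a path has
    just one initial segment of each degree.\<close>
  define F where "F = {f. \<exists>\<alpha>\<in>S. \<exists>i. is_prefix f \<alpha> \<and> deg G f = axis i 1}"
  have "F \<subseteq> (\<Union>\<alpha>\<in>S. \<Union>i\<in>UNIV. {f. is_prefix f \<alpha> \<and> deg G f = axis i 1})"
    by (auto simp: F_def)
  moreover have "finite {f. is_prefix f \<alpha> \<and> deg G f = axis i 1}" for \<alpha> and i :: 'k
  proof (cases "\<exists>f. is_prefix f \<alpha> \<and> deg G f = axis i 1")
    case True
    then obtain f where f: "is_prefix f \<alpha>" "deg G f = axis i 1" by blast
    have "{f. is_prefix f \<alpha> \<and> deg G f = axis i 1} \<subseteq> {f}"
      using is_prefix_unique[OF _ f(1)] f(2) by auto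
    then show ?thesis by (rule finite_subset) simp
  next
    case False
    then have "{f. is_prefix f \<alpha> \<and> deg G f = axis i 1} = {}" by blast
    then show ?thesis by (simp only: finite.emptyI)
  qed
  ultimately have F: "finite F" using S(1) by (meson finite_UN_I finite finite_subset)
  have F_Mor: "f \<in> Mor G" if "f \<in> F" for f
    using that by (auto simp: F_def is_prefix_def)
  have "\<exists>\<mu>\<in>Mor G. Cod G \<mu> = v \<and> (\<forall>i. deg G \<mu> $ i = (if i \<in> I then 1 else 0)) \<and>
      (\<forall>i\<in>I. \<forall>f\<in>F. deg G f = axis i 1 \<longrightarrow> \<not> is_prefix f \<mu>)" if "finite I" for I
    using that
  proof (induction I)
    case empty
    then show ?case using vertex_Dom_Cod[OF v] by (intro bexI[of _ v]) auto
  next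
    case (insert i I)
    then obtain \<mu> where \<mu>: "\<mu> \<in> Mor G" "Cod G \<mu> = v" "\<And>j. deg G \<mu> $ j = (if j \<in> I then 1 else 0)"
      "\<And>j f. j \<in> I \<Longrightarrow> f \<in> F \<Longrightarrow> deg G f = axis j 1 \<Longrightarrow> \<not> is_prefix f \<mu>" by metis
    \<comment> \<open>If \<open>\<mu> \<cdot> e\<close> begins with some \<open>f\<close> in
      \<open>F\<close> of degree \<open>axis i 1\<close>, it is a minimal common extension of
      \<open>\<mu>\<close> and \<open>f\<close>; alignment leaves only finitely many such
      \<open>e\<close> to avoid.\<close>
    let ?bad = "\<Union>f\<in>F. tail \<mu> ` MCE G \<mu> f"
    have "finite ?bad" using F finite_MCE[OF fa \<mu>(1)] F_Mor by blast
    moreover have "infinite (paths_at G (axis i 1) (Dom G \<mu>))"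
      using inf Dom_vertex \<mu>(1) by blast
    ultimately obtain e where e: "e \<in> paths_at G (axis i 1) (Dom G \<mu>)" "e \<notin> ?bad"
      by (meson finite_subset subsetI)
    have c: "composable \<mu> e" and de: "deg G e = axis i 1"
      using e(1) \<mu>(1) by (auto simp: paths_at_def composable_def simp del: composable_Mor)
    have deg: "deg G (\<mu> \<cdot> e) $ j = (if j \<in> insert i I then 1 else 0)" for j
      using insert.hyps \<mu>(3) by (simp add: c de axis_def)
    have "\<not> is_prefix f (\<mu> \<cdot> e)" if j: "j \<in> insert i I" and f: "f \<in> F" "deg G f = axis j 1" for j f
    proof
      assume p: "is_prefix f (\<mu> \<cdot> e)"
      show False
      proof (cases "j = i")
        case True
        have "deg G (\<mu> \<cdot> e) = vmax (deg G \<mu>) (deg G f)"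
          using \<mu>(3) insert.hyps True f(2) by (simp add: c de vec_eq_iff axis_def)
        then have "\<mu> \<cdot> e \<in> MCE G \<mu> f"
          using MCE_iff[OF \<mu>(1) F_Mor[OF f(1)]] p c by (simp del: composable_deg)
        then show False using e(2) f(1) c tail_cmp[OF c] by (metis UN_I image_eqI)
      next
        case False
        then have "j \<in> I" using j by simp
        moreover have "is_prefix f \<mu>"
          by (rule is_prefix_deg_mono[OF p is_prefix_cmp[OF c]])
            (use \<open>j \<in> I\<close> f(2) \<mu>(3) in \<open>simp add: axis_def\<close>)
        ultimately show False using \<mu>(4) f by blast
      qed
    qed
    then show ?case
      using c \<mu>(2) deg by (intro bexI[of _ "\<mu> \<cdot> e"]) auto
  qed
  from this[of UNIV] obtain \<mu> where \<mu>: "\<mu> \<in> Mor G" "Cod G \<mu> = v" "\<And>i. deg G \<mu> $ i = 1"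
      "\<And>i f. f \<in> F \<Longrightarrow> deg G f = axis i 1 \<Longrightarrow> \<not> is_prefix f \<mu>"
    by auto
  have "MCE_pairs G \<mu> \<alpha> = {}" if \<alpha>: "\<alpha> \<in> S" for \<alpha>
  proof (rule ccontr)
    assume "MCE_pairs G \<mu> \<alpha> \<noteq> {}"
    then obtain \<beta> \<beta>' where "(\<beta>, \<beta>') \<in> MCE_pairs G \<mu> \<alpha>" by auto
    then have b: "composable \<mu> \<beta>" "composable \<alpha> \<beta>'" "\<mu> \<cdot> \<beta> = \<alpha> \<cdot> \<beta>'"
      using MCE_pairs_iff[OF \<mu>(1)] S(2)[OF \<alpha>] by auto
    obtain i where i: "deg G \<alpha> $ i \<noteq> 0" using S(2)[OF \<alpha>] by (auto simp: vec_eq_iff)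
    obtain f where f: "is_prefix f \<alpha>" "deg G f = axis i 1"
      by (rule is_prefix_exists[of \<alpha> "axis i 1"]) (use i S(2)[OF \<alpha>] in \<open>auto simp: axis_def\<close>)
    then have "f \<in> F" using \<alpha> by (auto simp: F_def)
    moreover have "is_prefix f (\<mu> \<cdot> \<beta>)"
      unfolding b(3) by (rule is_prefix_trans[OF f(1) is_prefix_cmp[OF b(2)]])
    then have "is_prefix f \<mu>"
      by (rule is_prefix_deg_mono[OF _ is_prefix_cmp[OF b(1)]]) (simp add: f(2) \<mu>(3) axis_def)
    ultimately show False using \<mu>(4) f(2) by blast
  qed
  then show thesis using that \<mu>(1,2) by blast
qed

end

locale nonzero_cuntz_krieger = cuntz_krieger +
  assumes inf: "\<And>v i. v \<in> vertices G \<Longrightarrow> infinite (paths_at G (axis i 1) v)"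
    and nonzero: "\<And>v. v \<in> vertices G \<Longrightarrow> t v \<noteq> 0"
begin

text \<open>\<open>q\<close> is the range projection of \<open>t \<mu>\<close> for an avoiding path:
  the sum in \<open>t_adj_mult\<close> is empty for \<open>\<mu>\<close> and
  \<open>\<alpha>\<close>, and \<open>q\<close> is non-zero because \<open>t (Dom G \<mu>)\<close>
  is.\<close>

lemma exists_small_projection:
  assumes v: "v \<in> vertices G" and S: "finite S" "\<And>\<alpha>. \<alpha> \<in> S \<Longrightarrow> \<alpha> \<in> Mor G \<and> deg G \<alpha> \<noteq> 0"
  obtains q where "projection q" "q \<noteq> 0" "t v * q = q" "\<And>\<alpha>. \<alpha> \<in> S \<Longrightarrow> q * t \<alpha> = 0"
proof -
  obtain \<mu> where \<mu>: "\<mu> \<in> Mor G" "Cod G \<mu> = v" "\<And>\<alpha>. \<alpha> \<in> S \<Longrightarrow> MCE_pairs G \<mu> \<alpha> = {}"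
    using exists_avoiding_path[OF fa inf v S] by blast
  define q where "q = t \<mu> * adj (t \<mu>)"
  have q\<mu>: "q * t \<mu> = t \<mu>" using t_partial_isometry[OF \<mu>(1)] by (simp add: q_def)
  have "projection q"
    unfolding projection_def
  proof
    show "adj q = q" by (simp add: q_def adj_mult adj_adj)
    show "q * q = q" using q\<mu> by (simp add: q_def flip: mult.assoc)
  qed
  moreover have "q \<noteq> 0"
  proof
    assume "q = 0"
    then have "t \<mu> = 0" using q\<mu> by simp
    then have "t (Dom G \<mu>) = 0" using t_isometry[OF \<mu>(1)] by simp
    then show False using nonzero Dom_vertex[OF \<mu>(1)] by blast
  qed
  moreover have "t v * q = q"
  proof -
    have "t v * t \<mu> = t \<mu>" using t_mult[OF composable_Cod[OF \<mu>(1)]] Cmp_Cod[OF \<mu>(1)] \<mu>(2) by simp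
    then show ?thesis by (simp add: q_def flip: mult.assoc)
  qed
  moreover have "q * t \<alpha> = 0" if "\<alpha> \<in> S" for \<alpha>
    using t_adj_mult[OF \<mu>(1), of \<alpha>] S(2)[OF that] \<mu>(3)[OF that] by (simp add: q_def mult.assoc)
  ultimately show thesis using that by blast
qed

text \<open>In \<open>t_adj_mult\<close> every summand with non-trivial \<open>\<beta>\<close> is
  killed by \<open>q\<close>, while a trivial \<open>\<beta>\<close> means that \<open>b\<close>
  extends \<open>a\<close>. So \<open>adj (t a)\<close> acts on \<open>t b * q\<close> like a
  backward shift on a basis vector.\<close>

lemma adj_t_mult_small_projection:
  assumes a: "a \<in> Mor G" and b: "b \<in> Mor G" "Dom G b = v"
    and q: "projection q" "t v * q = q"
    and small: "\<And>\<alpha> \<beta>. (\<alpha>, \<beta>) \<in> MCE_pairs G a b \<Longrightarrow> deg G \<beta> \<noteq> 0 \<Longrightarrow> q * t \<beta> = 0"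
  shows "adj (t a) * t b * q = (if is_prefix a b then t (tail a b) * q else 0)"
proof -
  let ?M = "MCE_pairs G a b"
  have fin: "finite ?M" using finite_MCE_pairs[OF fa a b(1)] .
  have v: "projection (t v)" using b t_vertex Dom_vertex by blast
  have sum: "adj (t a) * t b * q = (\<Sum>z\<in>?M. t (fst z) * (adj (t (snd z)) * q))"
    by (simp add: t_adj_mult[OF a b(1)] sum_distrib_right case_prod_unfold mult.assoc)
  have zero: "adj (t \<beta>) * q = 0" if "(\<alpha>, \<beta>) \<in> ?M" "deg G \<beta> \<noteq> 0" for \<alpha> \<beta>
    using arg_cong[OF small[OF that], of adj] q(1) by (simp add: adj_mult projection_def)
  have triv: "\<beta> = v \<and> composable a \<alpha> \<and> b = a \<cdot> \<alpha>" if "(\<alpha>, \<beta>) \<in> ?M" "deg G \<beta> = 0" for \<alpha> \<beta>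
    using that MCE_pairs_iff[OF a b(1)] composable_deg_zero_right[of b \<beta>] b(2) by auto
  show ?thesis
  proof (cases "is_prefix a b")
    case True
    let ?z = "(tail a b, v)"
    have t: "composable a (tail a b)" "b = a \<cdot> tail a b" using True by (auto elim: is_prefixE)
    have "deg G b = vmax (deg G a) (deg G b)"
      using is_prefix_deg_le[OF True] by (simp add: vec_eq_iff max_def)
    moreover have "composable b v" "b \<cdot> v = b" using b composable_Dom Cmp_Dom by auto
    ultimately have z: "?z \<in> ?M" using t MCE_pairs_iff[OF a b(1)] by metis
    have "(\<Sum>z\<in>?M. t (fst z) * (adj (t (snd z)) * q)) = (\<Sum>z\<in>{?z}. t (fst z) * (adj (t (snd z)) * q))"
    proof (rule sum.mono_neutral_right[OF fin], use z in simp, rule ballI)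
      fix z assume z: "z \<in> ?M - {?z}"
      obtain \<alpha> \<beta> where ab: "z = (\<alpha>, \<beta>)" by (cases z)
      have "deg G \<beta> \<noteq> 0"
      proof
        assume "deg G \<beta> = 0"
        then have "\<beta> = v" "composable a \<alpha>" "b = a \<cdot> \<alpha>" using triv z ab by auto
        then have "z = ?z" using ab tail_cmp[of a \<alpha>] by simp
        then show False using z by simp
      qed
      then show "t (fst z) * (adj (t (snd z)) * q) = 0" using zero z ab by auto
    qed
    also have "\<dots> = t (tail a b) * q" using q v by (simp add: projection_def)
    finally show ?thesis using True sum by simp
  next
    case False
    have "t (fst z) * (adj (t (snd z)) * q) = 0" if "z \<in> ?M" for z
    proof -
      obtain \<alpha> \<beta> where ab: "z = (\<alpha>, \<beta>)" by (cases z)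
      have "deg G \<beta> \<noteq> 0" using triv that False ab is_prefix_cmp by metis
      then show ?thesis using zero that ab by auto
    qed
    then show ?thesis using sum False by simp
  qed
qed

text \<open>For a fixed \<open>\<xi>\<close> only finitely many paths \<open>y\<close> matter. The
  map \<open>X\<close> sends their basis vectors to \<open>t y * q\<close>; it is isometric and
  \<open>X (T \<xi>) = x * X \<xi>\<close>, so submultiplicativity of the norm gives the
  bound.\<close>

lemma bounded_op_norm:
  assumes x: "represents W x T"
  shows "bounded_op T (norm x)"
  unfolding bounded_op_def
proof (intro conjI allI ballI norm_ge_zero)
  fix v \<xi> assume \<xi>: "\<xi> \<in> fin_vec v"
  obtain c where c: "x = (\<Sum>p\<in>W. c p *\<^sub>C elem p)" "T = (\<lambda>\<xi> y. \<Sum>p\<in>W. c p * shift_op p \<xi> y)"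
    using x unfolding represents_def by blast
  have W: "finite W" "W \<subseteq> path_pairs" using x by (auto simp: represents_def)
  show "l2 (T \<xi>) \<le> norm x * l2 \<xi>"
  proof (cases "\<exists>y. \<xi> y \<noteq> 0")
    case False
    then have "shift_op p \<xi> y = 0" for p y by (simp add: shift_op_def)
    then have "T \<xi> = (\<lambda>y. 0)" by (simp add: c)
    then have "l2 (T \<xi>) = 0" by (simp add: l2_def)
    then show ?thesis by simp
  next
    case True
    then have v: "v \<in> vertices G" using \<xi> Dom_vertex by (auto simp: fin_vec_def)
    define H where "H = {y. \<xi> y \<noteq> 0} \<union> (\<Union>p\<in>W. {y. shift_op p \<xi> y \<noteq> 0})"
    have shift: "shift_op p \<xi> \<in> fin_vec v" if "p \<in> W" for p
      using shift_op_fin_vec \<xi> W that by blast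
    have H: "finite H" "\<And>y. y \<in> H \<Longrightarrow> y \<in> Mor G \<and> Dom G y = v"
      using \<xi> shift W(1) by (auto simp: H_def fin_vec_def)
    \<comment> \<open>The paths \<open>a\<close> for which products \<open>adj (t a) * t b\<close>
      with \<open>b \<in> H\<close> are computed: second components from \<open>W\<close> for the
      action of \<open>x\<close>, and \<open>H\<close> itself for orthogonality. \<open>S\<close>
      collects the non-trivial \<beta> arising from them.\<close>
    define A where "A = snd ` W \<union> H"
    have A: "finite A" "A \<subseteq> Mor G" using W H by (auto simp: A_def path_pairs_iff)
    define S where "S = {\<beta>. deg G \<beta> \<noteq> 0 \<and> (\<exists>a\<in>A. \<exists>b\<in>H. \<exists>\<alpha>. (\<alpha>, \<beta>) \<in> MCE_pairs G a b)}"
    have "S \<subseteq> (\<Union>a\<in>A. \<Union>b\<in>H. snd ` MCE_pairs G a b)" by (force simp: S_def)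
    moreover have "finite (MCE_pairs G a b)" if "a \<in> A" "b \<in> H" for a b
      using finite_MCE_pairs[OF fa] A H that by blast
    ultimately have S: "finite S" using A(1) H(1) by (meson finite_UN_I finite_imageI finite_subset)
    have S': "\<beta> \<in> Mor G \<and> deg G \<beta> \<noteq> 0" if "\<beta> \<in> S" for \<beta>
      using that by (auto simp: S_def MCE_pairs_def)
    obtain q where q: "projection q" "q \<noteq> 0" "t v * q = q" "\<And>\<alpha>. \<alpha> \<in> S \<Longrightarrow> q * t \<alpha> = 0"
      using exists_small_projection[OF v S S'] by blast
    have qq: "adj q = q" "q * q = q" using q(1) by (auto simp: projection_def)
    have key: "adj (t a) * t b * q = (if is_prefix a b then t (tail a b) * q else 0)"
      if "a \<in> A" "b \<in> H" for a b
    proof (rule adj_t_mult_small_projection)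
      fix \<alpha> \<beta> assume "(\<alpha>, \<beta>) \<in> MCE_pairs G a b" "deg G \<beta> \<noteq> 0"
      then show "q * t \<beta> = 0" using that q(4) unfolding S_def by blast
    qed (use that A H q in auto)
    have orth: "adj (t y * q) * (t y' * q) = (if y = y' then q else 0)" if y: "y \<in> H" "y' \<in> H" for y y'
    proof -
      have "adj (t y * q) * (t y' * q) = q * (adj (t y) * t y' * q)"
        by (simp add: adj_mult qq mult.assoc)
      also have "\<dots> = (if is_prefix y y' then q * t (tail y y') * q else 0)"
        using key[of y y'] y by (simp add: A_def mult.assoc)
      also have "\<dots> = (if y = y' then q else 0)"
      proof (cases "is_prefix y y'")
        case True
        then have t: "composable y (tail y y')" "y' = y \<cdot> tail y y'" by (auto elim: is_prefixE)
        show ?thesis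
        proof (cases "deg G (tail y y') = 0")
          case True
          then have "tail y y' = v" "y = y'" using composable_deg_zero_right[OF t(1)] t(2) H(2)[OF y(1)] by auto
          then show ?thesis using \<open>is_prefix y y'\<close> q(3) qq by (simp add: mult.assoc)
        next
          case False
          have m: "y \<in> Mor G" "y' \<in> Mor G" using H y by auto
          have "y \<noteq> y'"
          proof
            assume "y = y'"
            then have "deg G y + deg G (tail y y') = deg G y" using t composable_deg by metis
            then show False using False by simp
          qed
          \<comment> \<open>When \<open>y\<close> is a proper prefix of \<open>y'\<close>, the tail
            is the second component of a pair for \<open>y'\<close> and \<open>y\<close> in
            exchanged order, so it lies in \<open>S\<close> and \<open>q\<close> kills it.\<close>
          have "deg G y' = vmax (deg G y') (deg G y)"
            using is_prefix_deg_le[OF True] by (auto simp: vec_eq_iff max_def intro: antisym)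
          then have "(Dom G y', tail y y') \<in> MCE_pairs G y' y"
            using t MCE_pairs_iff[OF m(2,1)] composable_Dom[OF m(2)] Cmp_Dom[OF m(2)] by metis
          then have "tail y y' \<in> S" using False y unfolding S_def A_def by blast
          then show ?thesis using q(4) \<open>y \<noteq> y'\<close> by simp
        qed
      next
        case False
        then show ?thesis using is_prefix_refl H y by auto
      qed
      finally show ?thesis .
    qed
    define X where "X \<zeta> = (\<Sum>y\<in>H. \<zeta> y *\<^sub>C (t y * q))" for \<zeta>
    have norm_X: "norm (X \<zeta>) = l2 \<zeta>" if "\<And>y. \<zeta> y \<noteq> 0 \<Longrightarrow> y \<in> H" for \<zeta>
    proof -
      have "adj (X \<zeta>) * X \<zeta> = (\<Sum>y\<in>H. \<Sum>y'\<in>H. (cnj (\<zeta> y) * \<zeta> y') *\<^sub>C (adj (t y * q) * (t y' * q)))"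
        by (simp add: X_def adj_sum adj_scaleC sum_product mult_scaleC_left mult_scaleC_right
            scaleC_scaleC mult.commute)
      also have "\<dots> = (\<Sum>y\<in>H. (cnj (\<zeta> y) * \<zeta> y) *\<^sub>C q)"
        by (intro sum.cong refl) (simp add: orth if_distrib[of "\<lambda>z. _ *\<^sub>C z"] sum.delta' sum.delta H(1) cong: if_cong)
      also have "\<dots> = complex_of_real (\<Sum>y\<in>H. (cmod (\<zeta> y))\<^sup>2) *\<^sub>C q"
        by (simp add: scaleC_sum_left complex_norm_square mult.commute del: of_real_power)
      also have "(\<Sum>y\<in>H. (cmod (\<zeta> y))\<^sup>2) = (l2 \<zeta>)\<^sup>2"
        by (rule l2_power2_superset[symmetric, OF H(1) that])
      finally have "(norm (X \<zeta>))\<^sup>2 = (l2 \<zeta>)\<^sup>2"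
        using cstar_identity[of "X \<zeta>"] norm_projection[OF q(1,2)] by (simp add: norm_scaleC del: of_real_power)
      then show ?thesis by simp
    qed
    have X_shift: "elem p * X \<xi> = X (shift_op p \<xi>)" if p: "p \<in> W" for p
    proof -
      have pp: "p \<in> path_pairs" and sA: "snd p \<in> A" using p W by (auto simp: A_def)
      have "elem p * X \<xi> = (\<Sum>y\<in>H. \<xi> y *\<^sub>C (t (fst p) * (adj (t (snd p)) * t y * q)))"
        by (simp add: X_def elem_def sum_distrib_left mult_scaleC_right mult.assoc)
      also have "\<dots> = (\<Sum>y | \<xi> y \<noteq> 0 \<and> is_prefix (snd p) y. \<xi> y *\<^sub>C (t (fst p \<cdot> tail (snd p) y) * q))"
      proof (rule sum.mono_neutral_cong_right[OF H(1)])
        show "{y. \<xi> y \<noteq> 0 \<and> is_prefix (snd p) y} \<subseteq> H" by (auto simp: H_def)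
        show "\<forall>y\<in>H - {y. \<xi> y \<noteq> 0 \<and> is_prefix (snd p) y}. \<xi> y *\<^sub>C (t (fst p) * (adj (t (snd p)) * t y * q)) = 0"
          using key[OF sA] by auto
      next
        fix y assume "y \<in> {y. \<xi> y \<noteq> 0 \<and> is_prefix (snd p) y}"
        then have y: "y \<in> H" "is_prefix (snd p) y" by (auto simp: H_def)
        then have "composable (snd p) (tail (snd p) y)" by (auto elim: is_prefixE)
        then have "composable (fst p) (tail (snd p) y)" using path_pairs_composable[OF pp] by blast
        then have "t (fst p) * t (tail (snd p) y) = t (fst p \<cdot> tail (snd p) y)" by (rule t_mult)
        then show "\<xi> y *\<^sub>C (t (fst p) * (adj (t (snd p)) * t y * q)) = \<xi> y *\<^sub>C (t (fst p \<cdot> tail (snd p) y) * q)"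
          using key[OF sA y(1)] y(2) by (simp flip: mult.assoc)
      qed
      also have "\<dots> = (\<Sum>x | shift_op p \<xi> x \<noteq> 0. shift_op p \<xi> x *\<^sub>C (t x * q))"
        by (rule sum_shift_op[OF pp, where F = "\<lambda>x z. z *\<^sub>C (t x * q)", symmetric])
      also have "\<dots> = X (shift_op p \<xi>)"
        unfolding X_def using p by (intro sum.mono_neutral_left H(1)) (auto simp: H_def)
      finally show ?thesis .
    qed
    have "x * X \<xi> = (\<Sum>p\<in>W. c p *\<^sub>C X (shift_op p \<xi>))"
      using X_shift by (simp add: c sum_distrib_right mult_scaleC_left)
    also have "\<dots> = (\<Sum>p\<in>W. \<Sum>y\<in>H. (c p * shift_op p \<xi> y) *\<^sub>C (t y * q))"
      by (simp add: X_def scaleC_sum_right scaleC_scaleC)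
    also have "\<dots> = X (T \<xi>)"
      unfolding X_def c(2) scaleC_sum_left by (rule sum.swap)
    finally have "norm (X (T \<xi>)) \<le> norm x * norm (X \<xi>)"
      using norm_mult_ineq[of x "X \<xi>"] by simp
    moreover have "norm (X \<xi>) = l2 \<xi>" by (rule norm_X) (simp add: H_def)
    moreover have "norm (X (T \<xi>)) = l2 (T \<xi>)"
    proof (rule norm_X)
      fix y assume "T \<xi> y \<noteq> 0"
      then obtain p where "p \<in> W" "c p * shift_op p \<xi> y \<noteq> 0"
        unfolding c by (rule sum.not_neutral_contains_not_neutral)
      then show "y \<in> H" by (auto simp: H_def)
    qed
    ultimately show ?thesis by simp
  qed
qed

end

section \<open>The core\<close>

context k_graph
begin

text \<open>Closes \<open>E\<close> under the first components of products of pairs with equal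
  sources and degrees. One rule suffices, since passing to adjoints exchanges the two
  components.\<close>

inductive_set path_closure :: "'m set \<Rightarrow> 'm set" for E where
  base: "\<mu> \<in> E \<Longrightarrow> \<mu> \<in> path_closure E"
| step: "\<lbrakk>\<mu> \<in> path_closure E; \<nu> \<in> path_closure E; \<sigma> \<in> path_closure E; Dom G \<mu> = Dom G \<nu>;
    deg G \<mu> = deg G \<nu>; (\<alpha>, \<beta>) \<in> MCE_pairs G \<nu> \<sigma>\<rbrakk> \<Longrightarrow> \<mu> \<cdot> \<alpha> \<in> path_closure E"

lemma path_closure_Mor:
  assumes "E \<subseteq> Mor G" "\<mu> \<in> path_closure E"
  shows "\<mu> \<in> Mor G"
  using assms(2)
proof induction
  case (step \<mu> \<nu> \<sigma> \<alpha> \<beta>)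
  then have "composable \<mu> \<alpha>"
    by (auto simp: MCE_pairs_def composable_def simp del: composable_Mor)
  then show ?case by simp
qed (use assms in auto)

lemma path_closure_step_facts:
  assumes E: "E \<subseteq> Mor G" and "\<mu> \<in> path_closure E" "\<nu> \<in> path_closure E" "\<sigma> \<in> path_closure E"
    "Dom G \<mu> = Dom G \<nu>" "deg G \<mu> = deg G \<nu>" "(\<alpha>, \<beta>) \<in> MCE_pairs G \<nu> \<sigma>"
  shows "composable \<mu> \<alpha>" "composable \<nu> \<alpha>" "composable \<sigma> \<beta>" "\<nu> \<cdot> \<alpha> = \<sigma> \<cdot> \<beta>"
    "deg G (\<mu> \<cdot> \<alpha>) = vmax (deg G \<nu>) (deg G \<sigma>)"
proof -
  have m: "\<mu> \<in> Mor G" "\<nu> \<in> Mor G" "\<sigma> \<in> Mor G" using path_closure_Mor[OF E] assms by auto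
  show *: "composable \<nu> \<alpha>" "composable \<sigma> \<beta>" "\<nu> \<cdot> \<alpha> = \<sigma> \<cdot> \<beta>"
    using MCE_pairs_iff[OF m(2,3)] assms(7) by blast+
  show c: "composable \<mu> \<alpha>"
    using * m assms(5) by (auto simp: composable_def simp del: composable_Mor)
  have "deg G (\<nu> \<cdot> \<alpha>) = vmax (deg G \<nu>) (deg G \<sigma>)"
    using MCE_pairs_iff[OF m(2,3)] assms(7) by blast
  then show "deg G (\<mu> \<cdot> \<alpha>) = vmax (deg G \<nu>) (deg G \<sigma>)"
    using composable_deg[OF *(1)] composable_deg[OF c] assms(6) by simp
qed

text \<open>Since \<open>\<mu>\<close> and \<open>\<nu>\<close> have equal degrees, the degree of a
  new path is the maximum of two old degrees.\<close>

lemma path_closure_deg_le: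
  assumes E: "E \<subseteq> Mor G" and le: "\<And>\<mu>. \<mu> \<in> E \<Longrightarrow> deg G \<mu> $ i \<le> N" and "\<mu> \<in> path_closure E"
  shows "deg G \<mu> $ i \<le> N"
  using assms(3)
proof induction
  case (step \<mu> \<nu> \<sigma> \<alpha> \<beta>)
  have "deg G (\<mu> \<cdot> \<alpha>) = vmax (deg G \<nu>) (deg G \<sigma>)"
    by (rule path_closure_step_facts[OF E step.hyps(1-6)])
  then have "deg G (\<mu> \<cdot> \<alpha>) $ i = max (deg G \<nu> $ i) (deg G \<sigma> $ i)" by simp
  then show ?case using step.IH by simp
qed (use le in auto)

lemma finite_vec_le: "finite {m :: nat ^ 'k. \<forall>i. m $ i \<le> n $ i}"
proof -
  define N where "N = (\<Sum>i\<in>UNIV. n $ i)"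
  have N: "n $ i \<le> N" for i unfolding N_def by (rule member_le_sum) auto
  have "{m :: nat ^ 'k. \<forall>i. m $ i \<le> n $ i} \<subseteq> vec_lambda ` (PiE UNIV (\<lambda>_. {..N}))"
  proof
    fix m :: "nat ^ 'k" assume "m \<in> {m. \<forall>i. m $ i \<le> n $ i}"
    then have "(\<lambda>i. m $ i) \<in> PiE UNIV (\<lambda>_. {..N})" using N order_trans by (auto simp: PiE_iff) blast
    moreover have "m = vec_lambda (\<lambda>i. m $ i)" by simp
    ultimately show "m \<in> vec_lambda ` (PiE UNIV (\<lambda>_. {..N}))" by blast
  qed
  then show ?thesis by (rule finite_subset) (intro finite_imageI finite_PiE, auto)
qed

lemma finite_prefixes: "finite {\<mu>. is_prefix \<mu> \<gamma>}"
proof (rule inj_on_finite)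
  show "inj_on (deg G) {\<mu>. is_prefix \<mu> \<gamma>}" using is_prefix_unique by (auto intro: inj_onI)
  show "deg G ` {\<mu>. is_prefix \<mu> \<gamma>} \<subseteq> {m. \<forall>i. m $ i \<le> deg G \<gamma> $ i}"
    using is_prefix_deg_le by auto
qed (rule finite_vec_le)

text \<open>A new path of length \<open>n\<close> either extends two shorter paths minimally, or it replaces an initial
  segment of a path of length \<open>n\<close>; the remaining end piece then comes from a finite supply.\<close>

lemma finite_path_closure_step:
  assumes fa: "finitely_aligned G" and E: "finite E" "E \<subseteq> Mor G"
    and fin: "finite {\<mu> \<in> path_closure E. len \<mu> < n}"
  shows "finite {\<mu> \<in> path_closure E. len \<mu> < Suc n}"
proof -
  let ?C = "{\<mu> \<in> path_closure E. len \<mu> < n}"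
  \<comment> \<open>Paths obtained in one step from shorter ones; finite by alignment.\<close>
  define B where "B = (\<Union>\<mu>\<in>?C. \<Union>\<nu>\<in>?C. \<Union>\<sigma>\<in>?C. (\<lambda>z. \<mu> \<cdot> fst z) ` MCE_pairs G \<nu> \<sigma>)"
  have C_Mor: "\<mu> \<in> Mor G" if "\<mu> \<in> ?C" for \<mu> using that path_closure_Mor[OF E(2)] by blast
  have B: "finite B"
    unfolding B_def by (intro finite_UN_I fin finite_imageI finite_MCE_pairs[OF fa] C_Mor)
  \<comment> \<open>The finite supply of end pieces; it is closed under passing to tails.\<close>
  define Tl where "Tl = (\<Union>\<gamma>\<in>E \<union> B. (\<lambda>\<mu>. tail \<mu> \<gamma>) ` {\<mu>. is_prefix \<mu> \<gamma>})"
  have Tl: "finite Tl"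
    unfolding Tl_def by (intro finite_UN_I finite_imageI finite_prefixes) (use B E in auto)
  have TlI: "\<delta> \<in> Tl" if "composable \<mu> \<delta>" "\<mu> \<cdot> \<delta> \<in> E \<union> B" for \<mu> \<delta>
    unfolding Tl_def using that by (intro UN_I[OF that(2)] image_eqI[of _ _ \<mu>]) auto
  have Tl_tail: "\<epsilon> \<in> Tl" if d: "\<delta>' \<cdot> \<epsilon> \<in> Tl" and c: "composable \<delta>' \<epsilon>" for \<delta>' \<epsilon>
  proof -
    obtain \<gamma> \<mu> where "\<gamma> \<in> E \<union> B" "is_prefix \<mu> \<gamma>" "\<delta>' \<cdot> \<epsilon> = tail \<mu> \<gamma>"
      using d by (auto simp: Tl_def)
    then have g: "composable \<mu> (\<delta>' \<cdot> \<epsilon>)" "\<mu> \<cdot> (\<delta>' \<cdot> \<epsilon>) \<in> E \<union> B"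
      by (auto elim: is_prefixE)
    then have "composable \<mu> \<delta>'" using c composable_right_iff by blast
    then show ?thesis using TlI[of "\<mu> \<cdot> \<delta>'" \<epsilon>] composable_assoc[of \<mu> \<delta>' \<epsilon>] c g by metis
  qed
  define R where "R = E \<union> B \<union> (\<lambda>z. fst z \<cdot> snd z) ` {z \<in> ?C \<times> Tl. composable (fst z) (snd z)}"
  have RI: "\<mu> \<cdot> \<delta> \<in> R" if "\<mu> \<in> ?C" "\<delta> \<in> Tl" "composable \<mu> \<delta>" for \<mu> \<delta>
    unfolding R_def using that by (intro UnI2 image_eqI[of _ _ "(\<mu>, \<delta>)"]) auto
  have "finite R" unfolding R_def
    using B E fin Tl by (intro finite_UnI finite_imageI finite_Collect_conjI disjI1) auto
  \<comment> \<open>Rule induction over the closure itself: the last step may start from a path of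
    the same length \<open>n\<close>, for which membership in \<open>R\<close> is the induction
    hypothesis.\<close>
  moreover have "len \<rho> = n \<Longrightarrow> \<rho> \<in> R" if "\<rho> \<in> path_closure E" for \<rho>
    using that
  proof induction
    case (base \<mu>)
    then show ?case by (simp add: R_def)
  next
    case (step \<mu> \<nu> \<sigma> \<alpha> \<beta>)
    note f = path_closure_step_facts[OF E(2) step.hyps(1-6)]
    have len_\<mu>\<nu>: "len \<mu> = len \<nu>" using step.hyps(5) by (simp add: len_def)
    show ?case
    proof (cases "len \<alpha> = 0")
      case True
      then have "\<mu> \<cdot> \<alpha> = \<mu>" using f(1) composable_deg_zero_right(2) len_zero_iff by blast
      then show ?thesis using step by simp
    next
      case False
      then have lt: "len \<mu> < n" "len \<nu> < n" using step.prems f(1) len_\<mu>\<nu> by auto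
      have len_\<sigma>: "len \<sigma> + len \<beta> = n"
        using step.prems f(1-4) len_\<mu>\<nu> len_cmp by metis
      show ?thesis
      proof (cases "len \<sigma> < n")
        case True
        then have "\<mu> \<cdot> \<alpha> \<in> B" using lt step.hyps unfolding B_def by force
        then show ?thesis by (simp add: R_def)
      next
        case False
        \<comment> \<open>Here \<open>\<sigma>\<close> is \<open>\<nu> \<cdot> \<alpha>\<close>
          itself, so the step replaces its initial segment \<open>\<nu>\<close> by
          \<open>\<mu>\<close>, and the induction hypothesis describes
          \<open>\<sigma>\<close>.\<close>
        then have "len \<beta> = 0" and n\<sigma>: "len \<sigma> = n" using len_\<sigma> by auto
        then have \<sigma>: "\<sigma> = \<nu> \<cdot> \<alpha>" using f(3,4) composable_deg_zero_right(2) len_zero_iff by metis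
        then have "\<nu> \<cdot> \<alpha> \<in> R" using step.IH(3) n\<sigma> by simp
        then consider "\<nu> \<cdot> \<alpha> \<in> E \<union> B" | \<mu>' \<delta> where "\<mu>' \<in> ?C" "\<delta> \<in> Tl" "composable \<mu>' \<delta>" "\<nu> \<cdot> \<alpha> = \<mu>' \<cdot> \<delta>"
          unfolding R_def by auto
        then show ?thesis
        proof cases
          case 1
          then have "\<alpha> \<in> Tl" using TlI f(2) by blast
          then show ?thesis using lt(1) step.hyps(1) f(1) by (intro RI) auto
        next
          case 2
          \<comment> \<open>The path \<open>\<nu> \<cdot> \<alpha> = \<mu>' \<cdot> \<delta>\<close>
            is split at the minimal common extension of \<open>\<nu>\<close> and
            \<open>\<mu>'\<close>: \<open>\<mu> \<cdot> \<alpha>'\<close> is again in the closure,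
            and only a tail \<open>\<epsilon>\<close> of \<open>\<delta>\<close> remains.\<close>
          obtain \<alpha>' \<delta>' \<epsilon> where e: "(\<alpha>', \<delta>') \<in> MCE_pairs G \<nu> \<mu>'" "composable \<alpha>' \<epsilon>"
              "composable \<delta>' \<epsilon>" "\<alpha> = \<alpha>' \<cdot> \<epsilon>" "\<delta> = \<delta>' \<cdot> \<epsilon>"
            using common_extension[OF f(2) 2(3,4)] by blast
          have \<mu>': "\<mu>' \<in> path_closure E" using 2(1) by simp
          have \<mu>\<alpha>': "\<mu> \<cdot> \<alpha>' \<in> path_closure E"
            by (rule path_closure.step[OF step.hyps(1,2) \<mu>' step.hyps(4,5) e(1)])
          have c: "composable \<mu> \<alpha>'"
            by (rule path_closure_step_facts[OF E(2) step.hyps(1,2) \<mu>' step.hyps(4,5) e(1)])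
          show ?thesis
          proof (cases "len \<epsilon> = 0")
            case True
            then have "\<alpha> = \<alpha>'" using e composable_deg_zero_right(2) len_zero_iff by metis
            then have "\<mu> \<cdot> \<alpha> \<in> B" using lt step.hyps(1,2) 2(1) e(1) unfolding B_def by force
            then show ?thesis by (simp add: R_def)
          next
            case False
            have a: "\<mu> \<cdot> \<alpha> = \<mu> \<cdot> \<alpha>' \<cdot> \<epsilon>" "composable (\<mu> \<cdot> \<alpha>') \<epsilon>"
              using e c composable_assoc by metis+
            then have "len (\<mu> \<cdot> \<alpha>') < n" using step.prems False by simp
            moreover have "\<epsilon> \<in> Tl" using Tl_tail 2(2) e(3,5) by blast
            ultimately show ?thesis unfolding a(1) using \<mu>\<alpha>' a(2) by (intro RI) auto
          qed
        qed
      qed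
    qed
  qed
  ultimately have "finite (R \<union> ?C)" using fin by simp
  moreover have "{\<mu> \<in> path_closure E. len \<mu> < Suc n} \<subseteq> R \<union> ?C"
    using \<open>\<And>\<rho>. \<rho> \<in> path_closure E \<Longrightarrow> len \<rho> = n \<Longrightarrow> \<rho> \<in> R\<close> by (auto simp: less_Suc_eq)
  ultimately show ?thesis by (rule finite_subset[rotated])
qed

text \<open>The coordinates of degrees in the closure are bounded by \<open>N\<close>, hence so are
  the lengths, and finitely many length steps exhaust it.\<close>

lemma finite_path_closure:
  assumes fa: "finitely_aligned G" and E: "finite E" "E \<subseteq> Mor G"
  shows "finite (path_closure E)"
proof -
  have fin: "finite {\<mu> \<in> path_closure E. len \<mu> < n}" for n
    by (induction n) (simp, rule finite_path_closure_step[OF fa E])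
  define N where "N = (\<Sum>\<mu>\<in>E. len \<mu>)"
  have le: "deg G \<mu> $ i \<le> N" if "\<mu> \<in> E" for \<mu> i
  proof -
    have "deg G \<mu> $ i \<le> len \<mu>" unfolding len_def by (rule member_le_sum) auto
    also have "\<dots> \<le> N" unfolding N_def using that E(1) by (intro member_le_sum) auto
    finally show ?thesis .
  qed
  have "len \<mu> \<le> (\<Sum>i\<in>(UNIV :: 'k set). N)" if "\<mu> \<in> path_closure E" for \<mu>
    unfolding len_def using path_closure_deg_le[OF E(2) le that] by (intro sum_mono)
  then have "path_closure E \<subseteq> {\<mu> \<in> path_closure E. len \<mu> < Suc (\<Sum>i\<in>(UNIV :: 'k set). N)}"
    by (auto simp: less_Suc_eq_le)
  then show ?thesis using fin finite_subset by blast
qed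

section \<open>Norm bounds in finite-dimensional parts of the core\<close>

definition core_pairs :: "'m set \<Rightarrow> ('m \<times> 'm) set" where
  "core_pairs C = {(\<mu>, \<nu>). \<mu> \<in> C \<and> \<nu> \<in> C \<and> Dom G \<mu> = Dom G \<nu> \<and> deg G \<mu> = deg G \<nu>}"

lemma finite_core_pairs: "finite C \<Longrightarrow> finite (core_pairs C)"
  by (rule finite_subset[of _ "C \<times> C"]) (auto simp: core_pairs_def)

lemma core_pairs_path_pairs: "E \<subseteq> Mor G \<Longrightarrow> core_pairs (path_closure E) \<subseteq> path_pairs"
  using path_closure_Mor by (auto simp: core_pairs_def path_pairs_def)

text \<open>The second component of a product comes from the closure rule applied to the exchanged
  pair. So these indices span an algebra.\<close>

lemma pair_prods_core_pairs:
  assumes E: "E \<subseteq> Mor G" and p: "p \<in> core_pairs (path_closure E)" and r: "r \<in> core_pairs (path_closure E)"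
  shows "pair_prods p r \<subseteq> core_pairs (path_closure E)"
proof
  let ?C = "path_closure E"
  fix z assume "z \<in> pair_prods p r"
  then obtain \<alpha> \<beta> where z: "z = (fst p \<cdot> \<alpha>, snd r \<cdot> \<beta>)" "(\<alpha>, \<beta>) \<in> MCE_pairs G (snd p) (fst r)"
    by (auto simp: pair_prods_def)
  have pr: "fst p \<in> ?C" "snd p \<in> ?C" "Dom G (fst p) = Dom G (snd p)" "deg G (fst p) = deg G (snd p)"
    "fst r \<in> ?C" "snd r \<in> ?C" "Dom G (snd r) = Dom G (fst r)" "deg G (snd r) = deg G (fst r)"
    using p r by (auto simp: core_pairs_def)
  have "snd p \<in> Mor G" "fst r \<in> Mor G" using path_closure_Mor[OF E] pr by auto
  then have z': "(\<beta>, \<alpha>) \<in> MCE_pairs G (fst r) (snd p)" using MCE_pairs_swap z(2) by blast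
  note f = path_closure_step_facts[OF E pr(1,2,5,3,4) z(2)]
  note g = path_closure_step_facts[OF E pr(6,5,2,7,8) z']
  have "Dom G \<alpha> = Dom G \<beta>" using composable_Mor(4) f(2-4) by metis
  moreover have "deg G (fst p \<cdot> \<alpha>) = deg G (snd r \<cdot> \<beta>)"
    unfolding f(5) g(5) by (simp add: vmax_def max.commute)
  moreover have "fst p \<cdot> \<alpha> \<in> ?C" "snd r \<cdot> \<beta> \<in> ?C"
    by (rule path_closure.step[OF pr(1,2,5,3,4) z(2)] path_closure.step[OF pr(6,5,2,7,8) z'])+
  ultimately show "z \<in> core_pairs ?C"
    using f(1) g(1) by (simp add: core_pairs_def z(1) del: composable_deg)
qed

text \<open>Applying the operator to the basis vector at \<open>snd p\<close> and reading off the
  coordinate at \<open>fst p\<close> gives \<open>c p\<close> plus coefficients of pairs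
  \<open>r\<close> with strictly shorter \<open>fst r\<close>. Induction on this length bounds
  \<open>c p\<close> by \<open>K\<close> times a factor independent of \<open>c\<close>.\<close>

lemma coefficient_bound:
  assumes W: "finite W" "W \<subseteq> path_pairs" "\<And>p. p \<in> W \<Longrightarrow> deg G (fst p) = deg G (snd p)"
    and K: "bounded_op (\<lambda>\<xi> y. \<Sum>p\<in>W. c p * shift_op p \<xi> y) K"
  shows "p \<in> W \<Longrightarrow> cmod (c p) \<le> K * (1 + real (card W)) ^ len (fst p)"
proof (induction "len (fst p)" arbitrary: p rule: less_induct)
  case less
  let ?N = "real (card W)"
  let ?l = "len (fst p)"
  have K0: "0 \<le> K" using K by (simp add: bounded_op_def)
  have p: "p \<in> path_pairs" "fst p \<in> Mor G" "snd p \<in> Mor G" "Dom G (fst p) = Dom G (snd p)"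
    using W(2) less.prems by (auto simp: path_pairs_iff)
  define \<xi> where "\<xi> = (\<lambda>x. if x = snd p then 1 else 0 :: complex)"
  have \<xi>: "\<xi> \<in> fin_vec (Dom G (snd p))" using p by (simp add: fin_vec_def \<xi>_def)
  have l\<xi>: "l2 \<xi> = 1" by (simp add: l2_def \<xi>_def)
  define T where "T = (\<lambda>\<xi> y. \<Sum>p\<in>W. c p * shift_op p \<xi> y)"
  have T\<xi>: "T \<xi> \<in> fin_vec (Dom G (snd p))"
    unfolding T_def using W \<xi> by (intro fin_vec_sum shift_op_fin_vec) auto
  have "cmod (T \<xi> (fst p)) \<le> l2 (T \<xi>)"
    using T\<xi> by (intro cmod_le_l2) (simp add: fin_vec_def)
  also have "\<dots> \<le> K" using K \<xi> l\<xi> unfolding bounded_op_def T_def by fastforce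
  finally have TK: "cmod (T \<xi> (fst p)) \<le> K" .
  have one: "shift_op p \<xi> (fst p) = 1"
  proof -
    have "composable (fst p) (Dom G (fst p))" by (rule composable_Dom[OF p(2)])
    from shift_op_cmp[OF this, of \<xi>] have "shift_op p \<xi> (fst p) = \<xi> (snd p \<cdot> Dom G (fst p))"
      unfolding Cmp_Dom[OF p(2)] .
    then show ?thesis unfolding p(4) Cmp_Dom[OF p(3)] by (simp add: \<xi>_def)
  qed
  have other: "cmod (shift_op r \<xi> (fst p)) \<le> 1" for r
    by (simp add: shift_op_def \<xi>_def)
  \<comment> \<open>Such an \<open>r\<close> satisfies \<open>fst p = fst r \<cdot> \<beta>\<close>
    and \<open>snd p = snd r \<cdot> \<beta>\<close> with the same \<open>\<beta>\<close>, and
    \<open>r \<noteq> p\<close> makes \<open>\<beta>\<close> non-trivial.\<close>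
  have short: "len (fst r) < ?l" if r: "r \<in> W - {p}" and nz: "shift_op r \<xi> (fst p) \<noteq> 0" for r
  proof -
    have rp: "r \<in> path_pairs" using r W(2) by auto
    obtain \<beta> where b: "composable (fst r) \<beta>" "composable (snd r) \<beta>" "fst p = fst r \<cdot> \<beta>" "\<xi> (snd r \<cdot> \<beta>) \<noteq> 0"
      by (rule shift_op_nonzero[OF rp nz])
    then have sp: "snd p = snd r \<cdot> \<beta>" by (simp add: \<xi>_def split: if_splits)
    have "len \<beta> \<noteq> 0"
    proof
      assume "len \<beta> = 0"
      then have "fst p = fst r" "snd p = snd r" using b sp composable_deg_zero_right(2) len_zero_iff by metis+
      then show False using r by (simp add: prod_eq_iff)
    qed
    then show ?thesis using b by simp
  qed
  have "T \<xi> (fst p) = c p + (\<Sum>r\<in>W - {p}. c r * shift_op r \<xi> (fst p))"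
    unfolding T_def using sum.remove[OF W(1) less.prems, of "\<lambda>r. c r * shift_op r \<xi> (fst p)"] one by simp
  then have "c p = T \<xi> (fst p) - (\<Sum>r\<in>W - {p}. c r * shift_op r \<xi> (fst p))" by simp
  then have "cmod (c p) \<le> cmod (T \<xi> (fst p)) + cmod (\<Sum>r\<in>W - {p}. c r * shift_op r \<xi> (fst p))"
    using norm_triangle_ineq4 by metis
  also have "\<dots> \<le> K + (\<Sum>r\<in>W - {p}. cmod (c r * shift_op r \<xi> (fst p)))"
    by (intro add_mono TK norm_sum)
  \<comment> \<open>At most \<open>?N\<close> further terms occur, and
    \<open>K + ?N * (K * (1 + ?N) ^ l) \<le> K * (1 + ?N) ^ Suc l\<close>.\<close>
  also have "\<dots> \<le> K * (1 + ?N) ^ ?l"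
  proof (cases ?l)
    case 0
    then have "(\<Sum>r\<in>W - {p}. cmod (c r * shift_op r \<xi> (fst p))) = 0"
      using short by (intro sum.neutral) auto
    then show ?thesis using 0 by simp
  next
    case (Suc l)
    have "cmod (c r * shift_op r \<xi> (fst p)) \<le> K * (1 + ?N) ^ l" if r: "r \<in> W - {p}" for r
    proof (cases "shift_op r \<xi> (fst p) = 0")
      case True
      then show ?thesis using K0 by simp
    next
      case False
      have "cmod (c r * shift_op r \<xi> (fst p)) \<le> cmod (c r)"
        using other[of r] by (simp add: norm_mult mult_left_le)
      also have "\<dots> \<le> K * (1 + ?N) ^ len (fst r)"
        using less.hyps[OF short[OF r False]] r by simp
      also have "\<dots> \<le> K * (1 + ?N) ^ l"
        using short[OF r False] Suc K0 by (intro mult_left_mono power_increasing) auto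
      finally show ?thesis .
    qed
    then have "(\<Sum>r\<in>W - {p}. cmod (c r * shift_op r \<xi> (fst p))) \<le> (\<Sum>r\<in>W - {p}. K * (1 + ?N) ^ l)"
      by (rule sum_mono)
    also have "\<dots> \<le> ?N * (K * (1 + ?N) ^ l)"
      using K0 card_mono[OF W(1), of "W - {p}"] by (simp add: mult_right_mono)
    finally have "K + (\<Sum>r\<in>W - {p}. cmod (c r * shift_op r \<xi> (fst p))) \<le> K * 1 + ?N * (K * (1 + ?N) ^ l)"
      by simp
    also have "\<dots> \<le> K * (1 + ?N) ^ l + ?N * (K * (1 + ?N) ^ l)"
      using K0 by (intro add_mono mult_left_mono one_le_power) auto
    also have "\<dots> = K * (1 + ?N) ^ ?l" by (simp add: Suc algebra_simps)
    finally show ?thesis .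
  qed
  finally show ?case .
qed

end

context cuntz_krieger
begin

text \<open>A crude bound from the coefficients, but its factor depends only on \<open>W\<close>;
  \<open>core_norm_le\<close> removes it.\<close>

lemma represents_core_norm_le:
  assumes x: "represents W x T" and core: "\<And>p. p \<in> W \<Longrightarrow> deg G (fst p) = deg G (snd p)"
    and K: "bounded_op T K"
  shows "norm x \<le> (\<Sum>p\<in>W. (1 + real (card W)) ^ len (fst p)) * K"
proof -
  obtain c where c: "x = (\<Sum>p\<in>W. c p *\<^sub>C elem p)" "T = (\<lambda>\<xi> y. \<Sum>p\<in>W. c p * shift_op p \<xi> y)"
    using x unfolding represents_def by blast
  have W: "finite W" "W \<subseteq> path_pairs" using x by (auto simp: represents_def)
  have "norm x \<le> (\<Sum>p\<in>W. norm (c p *\<^sub>C elem p))" unfolding c by (rule norm_sum)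
  also have "\<dots> \<le> (\<Sum>p\<in>W. K * (1 + real (card W)) ^ len (fst p))"
  proof (rule sum_mono)
    fix p assume p: "p \<in> W"
    have "norm (c p *\<^sub>C elem p) \<le> cmod (c p)"
      using norm_elem_le[of p] W p by (auto simp: norm_scaleC mult_left_le)
    also have "\<dots> \<le> K * (1 + real (card W)) ^ len (fst p)"
      by (rule coefficient_bound[OF W core K[unfolded c(2)] p])
    finally show "norm (c p *\<^sub>C elem p) \<le> K * (1 + real (card W)) ^ len (fst p)" .
  qed
  finally show ?thesis by (simp add: sum_distrib_left mult.commute)
qed

lemma represents_adj_mult_self:
  assumes x: "represents W x T" and K: "bounded_op T K"
    and Z: "finite Z" "\<And>p r. p \<in> W \<Longrightarrow> r \<in> W \<Longrightarrow> pair_prods (prod.swap p) r \<subseteq> Z" "Z \<subseteq> path_pairs"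
  obtains S where "represents Z (adj x * x) S" "bounded_op S (K * K)"
proof -
  obtain S where S: "represents (prod.swap ` W) (adj x) S"
    "\<And>v \<xi> \<eta>. \<xi> \<in> fin_vec v \<Longrightarrow> \<eta> \<in> fin_vec v \<Longrightarrow> ip (T \<xi>) \<eta> = ip \<xi> (S \<eta>)"
    using represents_adj[OF x] by blast
  have "bounded_op S K"
    by (rule bounded_op_adjoint[OF K represents_fin_vec[OF x] represents_fin_vec[OF S(1)] S(2)])
  then have "bounded_op (\<lambda>\<xi>. S (T \<xi>)) (K * K)"
    using K represents_fin_vec[OF x] by (rule bounded_op_comp)
  moreover have "represents Z (adj x * x) (\<lambda>\<xi>. S (T \<xi>))"
    by (rule represents_mult[OF S(1) x Z(1) _ Z(3)]) (use Z(2) in blast)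
  ultimately show thesis using that by blast
qed

lemma core_norm_le:
  assumes x: "represents W x T" and core: "\<And>p. p \<in> W \<Longrightarrow> deg G (fst p) = deg G (snd p)"
    and K: "bounded_op T K"
  shows "norm x \<le> K"
proof -
  have W: "finite W" "W \<subseteq> path_pairs" using x by (auto simp: represents_def)
  have K0: "0 \<le> K" using K by (simp add: bounded_op_def)
  define E where "E = fst ` W \<union> snd ` W"
  have E: "finite E" "E \<subseteq> Mor G" using W by (auto simp: E_def path_pairs_iff)
  define P where "P = core_pairs (path_closure E)"
  have P: "finite P" "P \<subseteq> path_pairs"
    unfolding P_def using finite_path_closure[OF fa E] E(2) by (simp_all add: finite_core_pairs core_pairs_path_pairs)
  have prods: "pair_prods p r \<subseteq> P" if "p \<in> P" "r \<in> P" for p r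
    using that pair_prods_core_pairs[OF E(2)] by (simp add: P_def)
  have coreP: "deg G (fst p) = deg G (snd p)" if "p \<in> P" for p
    using that by (auto simp: P_def core_pairs_def)
  have WP: "W \<subseteq> P"
  proof
    fix p assume p: "p \<in> W"
    then have "fst p \<in> path_closure E" "snd p \<in> path_closure E"
      by (auto simp: E_def intro!: path_closure.base)
    moreover have "Dom G (fst p) = Dom G (snd p)" using p W(2) by (auto simp: path_pairs_iff)
    ultimately show "p \<in> P" using core[OF p] by (cases p) (simp add: P_def core_pairs_def)
  qed
  have swapP: "prod.swap p \<in> P" if "p \<in> P" for p
    using that by (auto simp: P_def core_pairs_def)
  have "pair_prods (prod.swap p) r \<subseteq> P" if "p \<in> W" "r \<in> W" for p r
    using that WP by (intro prods swapP) auto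
  then obtain S where S: "represents P (adj x * x) S" "bounded_op S (K * K)"
    by (rule represents_adj_mult_self[OF x K P(1) _ P(2)])
  have iter: "\<exists>R. represents P (sq_iter j (adj x * x)) R \<and> bounded_op R ((K * K) ^ (2 ^ j))" for j
  proof (induction j)
    case (Suc j)
    then obtain R where R: "represents P (sq_iter j (adj x * x)) R" "bounded_op R ((K * K) ^ (2 ^ j))" by blast
    have "represents P (sq_iter (Suc j) (adj x * x)) (\<lambda>\<xi>. R (R \<xi>))"
      unfolding sq_iter.simps by (rule represents_mult[OF R(1) R(1) P(1) prods P(2)])
    moreover have "bounded_op (\<lambda>\<xi>. R (R \<xi>)) ((K * K) ^ (2 ^ j) * (K * K) ^ (2 ^ j))"
      by (rule bounded_op_comp[OF R(2) R(2) represents_fin_vec[OF R(1)]])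
    ultimately show ?case by (auto simp: mult_2 simp flip: power_add)
  qed (use S in auto)
  \<comment> \<open>\<open>R = 1\<close> because all powers are indexed by the same
    \<open>P\<close>, so the factor is independent of \<open>j\<close>.\<close>
  have "norm (adj x * x) \<le> K * K"
  proof (rule le_of_power_growth[where R = 1])
    fix j
    have "norm (sq_iter j (adj x * x)) \<le> (\<Sum>p\<in>P. (1 + real (card P)) ^ len (fst p)) * (K * K) ^ (2 ^ j)"
      using iter[of j] represents_core_norm_le[OF _ coreP] by blast
    then show "norm (adj x * x) ^ (2 ^ j) \<le> (\<Sum>p\<in>P. (1 + real (card P)) ^ len (fst p)) * 1 ^ j * (K * K) ^ (2 ^ j)"
      by (simp add: norm_sq_iter adj_mult adj_adj)
  qed (use K0 in auto)
  then have "(norm x)\<^sup>2 \<le> K\<^sup>2" by (simp add: cstar_identity power2_eq_square)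
  then show ?thesis using K0 by (rule power2_le_imp_le)
qed

end

section \<open>The grading by degree differences\<close>

context k_graph
begin

text \<open>The degree of a spanning element under the gauge action, hence integer-valued.\<close>

definition deg_diff :: "'m \<times> 'm \<Rightarrow> 'k \<Rightarrow> int" where
  "deg_diff p = (\<lambda>i. int (deg G (fst p) $ i) - int (deg G (snd p) $ i))"

lemma deg_diff_swap: "deg_diff (prod.swap p) = (\<lambda>i. - deg_diff p i)"
  by (simp add: deg_diff_def)

lemma deg_diff_zero_iff: "deg_diff p = (\<lambda>i. 0) \<longleftrightarrow> deg G (fst p) = deg G (snd p)"
  by (simp add: deg_diff_def fun_eq_iff vec_eq_iff)

text \<open>The degrees of \<open>\<alpha>\<close> and \<open>\<beta>\<close> are related by
  \<open>snd p \<cdot> \<alpha> = fst r \<cdot> \<beta>\<close>, which makes the differences add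
  up.\<close>

lemma deg_diff_pair_prods:
  assumes "z \<in> pair_prods p r" "p \<in> path_pairs" "r \<in> path_pairs"
  shows "deg_diff z = (\<lambda>i. deg_diff p i + deg_diff r i)"
proof -
  obtain \<alpha> \<beta> where z: "z = (fst p \<cdot> \<alpha>, snd r \<cdot> \<beta>)"
    "composable (fst p) \<alpha>" "composable (snd p) \<alpha>" "composable (fst r) \<beta>" "composable (snd r) \<beta>"
    "snd p \<cdot> \<alpha> = fst r \<cdot> \<beta>"
    using assms pair_prodsE by metis
  have "deg G (snd p) + deg G \<alpha> = deg G (fst r) + deg G \<beta>"
    using z composable_deg by metis
  then have "deg G (snd p) $ i + deg G \<alpha> $ i = deg G (fst r) $ i + deg G \<beta> $ i" for i
    by (metis vector_add_component)
  then have "int (deg G (snd p) $ i) + int (deg G \<alpha> $ i) = int (deg G (fst r) $ i) + int (deg G \<beta> $ i)" for i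
    by (metis of_nat_add)
  then show ?thesis
    using z by (auto simp: deg_diff_def algebra_simps)
qed

text \<open>The homogeneous part of degree \<open>n\<close> maps paths of degree \<open>m\<close> to paths of degree \<open>m + n\<close>,
  where it agrees with the whole operator.\<close>

lemma bounded_op_homogeneous_part:
  assumes W: "finite W" "W \<subseteq> path_pairs"
    and K: "bounded_op (\<lambda>\<xi> y. \<Sum>p\<in>W. c p * shift_op p \<xi> y) K"
  shows "bounded_op (\<lambda>\<xi> y. \<Sum>p | p \<in> W \<and> deg_diff p = n. c p * shift_op p \<xi> y) K"
proof -
  define T where "T = (\<lambda>\<xi> y. \<Sum>p\<in>W. c p * shift_op p \<xi> y)"
  define Wn where "Wn = {p \<in> W. deg_diff p = n}"
  define Tn where "Tn = (\<lambda>\<xi> y. \<Sum>p\<in>Wn. c p * shift_op p \<xi> y)"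
  have Wn: "finite Wn" "Wn \<subseteq> path_pairs" "Wn \<subseteq> W" using W by (auto simp: Wn_def)
  have K0: "0 \<le> K" using K by (simp add: bounded_op_def)
  have "l2 (Tn \<xi>) \<le> K * l2 \<xi>" if \<xi>: "\<xi> \<in> fin_vec v" for v \<xi>
  proof -
    \<comment> \<open>\<open>part m\<close> is the component of \<open>\<xi>\<close> on paths of
      degree \<open>m\<close>, and \<open>src x\<close> is the degree from which terms of degree
      \<open>n\<close> reach \<open>x\<close>. On the support of \<open>Tn \<xi>\<close> the
      truncation by \<open>nat\<close> has no effect.\<close>
    define part where "part m = (\<lambda>x. if deg G x = m then \<xi> x else 0)" for m
    define M where "M = deg G ` {x. \<xi> x \<noteq> 0}"
    define src :: "'m \<Rightarrow> nat ^ 'k" where "src x = (\<chi> i. nat (int (deg G x $ i) - n i))" for x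
    have fin: "finite {x. \<xi> x \<noteq> 0}" using \<xi> by (simp add: fin_vec_def)
    then have M: "finite M" by (simp add: M_def)
    have part: "part m \<in> fin_vec v" for m
    proof -
      have "finite {x. part m x \<noteq> 0}"
        by (rule finite_subset[OF _ fin]) (auto simp: part_def)
      then show ?thesis using \<xi> by (simp add: fin_vec_def part_def)
    qed
    define A where "A = {x. Tn \<xi> x \<noteq> 0}"
    have Tn\<xi>: "Tn \<xi> \<in> fin_vec v"
      unfolding Tn_def using Wn \<xi> by (intro fin_vec_sum shift_op_fin_vec) auto
    then have A: "finite A" by (simp add: fin_vec_def A_def)
    have agree: "src x \<in> M \<and> T (part (src x)) x = Tn \<xi> x" if x: "x \<in> A" for x
    proof -
      obtain p where p: "p \<in> Wn" "c p * shift_op p \<xi> x \<noteq> 0"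
        using x unfolding A_def Tn_def by (auto elim: sum.not_neutral_contains_not_neutral)
      then have pp: "p \<in> path_pairs" and nz: "shift_op p \<xi> x \<noteq> 0" using Wn by auto
      obtain \<beta> where b: "composable (fst p) \<beta>" "composable (snd p) \<beta>" "x = fst p \<cdot> \<beta>" "\<xi> (snd p \<cdot> \<beta>) \<noteq> 0"
        by (rule shift_op_nonzero[OF pp nz])
      have n: "n = deg_diff p" using p(1) by (simp add: Wn_def)
      have src_p: "src x = deg G (snd p \<cdot> \<beta>)"
        using b by (simp add: vec_eq_iff src_def n deg_diff_def nat_add_distrib add.commute)
      have src: "int (src x $ i) = int (deg G x $ i) - n i" for i
        using b(1,2) unfolding src_p n deg_diff_def unfolding b(3) by simp
      have "src x \<in> M" using src_p b(4) by (simp add: M_def del: composable_deg)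
      \<comment> \<open>At \<open>x\<close>, only pairs of degree \<open>n\<close> reach back to
        paths of degree \<open>src x\<close>, so the full operator applied to this component has the
        value of the homogeneous part.\<close>
      moreover have "shift_op r (part (src x)) x = (if deg_diff r = n then shift_op r \<xi> x else 0)"
        if r: "r \<in> W" for r
      proof (cases "is_prefix (fst r) x")
        case True
        then obtain \<gamma> where g: "composable (fst r) \<gamma>" "x = fst r \<cdot> \<gamma>" by (auto simp: is_prefix_def)
        then have g': "composable (snd r) \<gamma>" using path_pairs_composable r W(2) by blast
        have "deg G (snd r \<cdot> \<gamma>) = src x \<longleftrightarrow> (\<forall>i. int (deg G (snd r \<cdot> \<gamma>) $ i) = int (src x $ i))"
          by (simp add: vec_eq_iff)
        also have "\<dots> \<longleftrightarrow> deg_diff r = n"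
          unfolding src using g g' by (auto simp: deg_diff_def fun_eq_iff algebra_simps)
        finally show ?thesis using g g' by (simp add: part_def del: composable_deg)
      qed (simp add: shift_op_def)
      then have "T (part (src x)) x = Tn \<xi> x"
        unfolding T_def Tn_def Wn_def
        by (intro sum.mono_neutral_cong_right) (use W in auto)
      ultimately show ?thesis by blast
    qed
    \<comment> \<open>Pythagoras: the support of \<open>Tn \<xi>\<close> is sorted by
      \<open>src\<close>, each class is bounded by \<open>T (part m)\<close>, and the
      \<open>part m\<close> have disjoint supports.\<close>
    have "(l2 (Tn \<xi>))\<^sup>2 = (\<Sum>x\<in>A. (cmod (T (part (src x)) x))\<^sup>2)"
      using l2_power2[of "Tn \<xi>"] agree by (simp add: A_def)
    also have "\<dots> = (\<Sum>m\<in>M. \<Sum>x | x \<in> A \<and> src x = m. (cmod (T (part (src x)) x))\<^sup>2)"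
      by (rule sum.group[symmetric]) (use A M agree in auto)
    also have "\<dots> \<le> (\<Sum>m\<in>M. (K * l2 (part m))\<^sup>2)"
    proof (rule sum_mono)
      fix m
      have "T (part m) \<in> fin_vec v"
        unfolding T_def using W part by (intro fin_vec_sum shift_op_fin_vec) auto
      then have finT: "finite {x. T (part m) x \<noteq> 0}" by (simp add: fin_vec_def)
      have "(\<Sum>x | x \<in> A \<and> src x = m. (cmod (T (part (src x)) x))\<^sup>2) = (\<Sum>x | x \<in> A \<and> src x = m. (cmod (T (part m) x))\<^sup>2)"
        by (rule sum.cong) auto
      also have "\<dots> \<le> (\<Sum>x\<in>A \<union> {x. T (part m) x \<noteq> 0}. (cmod (T (part m) x))\<^sup>2)"
        by (rule sum_mono2) (use A finT in auto)
      also have "\<dots> = (l2 (T (part m)))\<^sup>2"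
        by (rule l2_power2_superset[symmetric]) (use A finT in auto)
      also have "\<dots> \<le> (K * l2 (part m))\<^sup>2"
        using K part by (intro power_mono) (auto simp: bounded_op_def T_def)
      finally show "(\<Sum>x | x \<in> A \<and> src x = m. (cmod (T (part (src x)) x))\<^sup>2) \<le> (K * l2 (part m))\<^sup>2" .
    qed
    also have "\<dots> = K\<^sup>2 * (\<Sum>m\<in>M. \<Sum>x | x \<in> {x. \<xi> x \<noteq> 0} \<and> deg G x = m. (cmod (\<xi> x))\<^sup>2)"
    proof -
      have "(l2 (part m))\<^sup>2 = (\<Sum>x | x \<in> {x. \<xi> x \<noteq> 0} \<and> deg G x = m. (cmod (\<xi> x))\<^sup>2)" for m
        unfolding l2_power2 by (rule sum.cong) (auto simp: part_def)
      then show ?thesis by (simp add: power_mult_distrib sum_distrib_left)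
    qed
    also have "\<dots> = K\<^sup>2 * (l2 \<xi>)\<^sup>2"
      unfolding l2_power2 by (subst sum.group) (use fin M in \<open>auto simp: M_def\<close>)
    finally have "(l2 (Tn \<xi>))\<^sup>2 \<le> (K * l2 \<xi>)\<^sup>2" by (simp add: power_mult_distrib)
    then show ?thesis by (rule power2_le_imp_le) (simp add: K0)
  qed
  then have "bounded_op Tn K" using K0 by (auto simp: bounded_op_def)
  then show ?thesis by (simp add: Tn_def Wn_def)
qed

end

context cuntz_krieger
begin

text \<open>In \<open>adj x * x\<close> the degrees \<open>- n\<close> and \<open>n\<close> cancel,
  so \<open>core_norm_le\<close> applies to it.\<close>

lemma homogeneous_norm_le:
  assumes x: "represents W x T" and n: "\<And>p. p \<in> W \<Longrightarrow> deg_diff p = n" and K: "bounded_op T K"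
  shows "norm x \<le> K"
proof -
  have W: "finite W" "W \<subseteq> path_pairs" using x by (auto simp: represents_def)
  have K0: "0 \<le> K" using K by (simp add: bounded_op_def)
  define Z where "Z = (\<Union>p\<in>W. \<Union>r\<in>W. pair_prods (prod.swap p) r)"
  have sw: "prod.swap p \<in> path_pairs" if "p \<in> W" for p using that W swap_path_pairs by blast
  have Z: "finite Z"
    unfolding Z_def pair_prods_def using W sw
    by (intro finite_UN_I finite_imageI finite_MCE_pairs[OF fa]) (auto simp: path_pairs_iff)
  have ZP: "Z \<subseteq> path_pairs" unfolding Z_def using pair_prods_path_pairs sw W by blast
  obtain S where S: "represents Z (adj x * x) S" "bounded_op S (K * K)"
    by (rule represents_adj_mult_self[OF x K Z _ ZP]) (auto simp: Z_def)
  have "norm (adj x * x) \<le> K * K"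
  proof (rule core_norm_le[OF S(1) _ S(2)])
    fix z assume "z \<in> Z"
    then obtain p r where pr: "p \<in> W" "r \<in> W" "z \<in> pair_prods (prod.swap p) r" by (auto simp: Z_def)
    have "deg_diff z = (\<lambda>i. deg_diff (prod.swap p) i + deg_diff r i)"
      using pr W sw by (intro deg_diff_pair_prods) auto
    then have "deg_diff z = (\<lambda>i. 0)" using pr n by (simp add: deg_diff_swap)
    then show "deg G (fst z) = deg G (snd z)" using deg_diff_zero_iff by blast
  qed
  then have "(norm x)\<^sup>2 \<le> K\<^sup>2" by (simp add: cstar_identity power2_eq_square)
  then show ?thesis using K0 by (rule power2_le_imp_le)
qed

text \<open>Each homogeneous part of \<open>x\<close> has norm at most \<open>K\<close>, and the
  degrees lie in a cube with \<open>2 * m + 1\<close> values per coordinate.\<close>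

lemma norm_le_polynomial:
  assumes x: "represents W x T" and L: "\<And>p i. p \<in> W \<Longrightarrow> \<bar>deg_diff p i\<bar> \<le> int m" and K: "bounded_op T K"
  shows "norm x \<le> real (2 * m + 1) ^ CARD('k) * K"
proof -
  obtain c where c: "x = (\<Sum>p\<in>W. c p *\<^sub>C elem p)" "T = (\<lambda>\<xi> y. \<Sum>p\<in>W. c p * shift_op p \<xi> y)"
    using x unfolding represents_def by blast
  have W: "finite W" "W \<subseteq> path_pairs" using x by (auto simp: represents_def)
  have K0: "0 \<le> K" using K by (simp add: bounded_op_def)
  define D where "D = deg_diff ` W"
  define xn where "xn n = (\<Sum>p | p \<in> W \<and> deg_diff p = n. c p *\<^sub>C elem p)" for n
  have D: "finite D" using W by (simp add: D_def)
  have "x = (\<Sum>n\<in>D. xn n)"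
    unfolding c(1) xn_def by (rule sum.group[symmetric]) (use W D in \<open>auto simp: D_def\<close>)
  then have "norm x \<le> (\<Sum>n\<in>D. norm (xn n))" by (simp add: norm_sum)
  also have "\<dots> \<le> (\<Sum>n\<in>D. K)"
  proof (rule sum_mono)
    fix n
    let ?Wn = "{p. p \<in> W \<and> deg_diff p = n}"
    have "represents ?Wn (xn n) (\<lambda>\<xi> y. \<Sum>p\<in>?Wn. c p * shift_op p \<xi> y)"
      unfolding xn_def represents_def using W by auto
    moreover have "bounded_op (\<lambda>\<xi> y. \<Sum>p\<in>?Wn. c p * shift_op p \<xi> y) K"
      by (rule bounded_op_homogeneous_part[OF W K[unfolded c(2)]])
    ultimately show "norm (xn n) \<le> K" by (intro homogeneous_norm_le[where n = n]) auto
  qed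
  also have "\<dots> = real (card D) * K" by simp
  also have "\<dots> \<le> real (2 * m + 1) ^ CARD('k) * K"
  proof (rule mult_right_mono[OF _ K0])
    have fin: "finite (PiE (UNIV :: 'k set) (\<lambda>_. {- int m..int m}))" by (intro finite_PiE) auto
    have "D \<subseteq> PiE (UNIV :: 'k set) (\<lambda>_. {- int m..int m})"
    proof
      fix d assume "d \<in> D"
      then obtain p where p: "p \<in> W" "d = deg_diff p" by (auto simp: D_def)
      have "- int m \<le> d i \<and> d i \<le> int m" for i using L[OF p(1), of i] unfolding p(2) by linarith
      then show "d \<in> PiE (UNIV :: 'k set) (\<lambda>_. {- int m..int m})" by (simp add: PiE_iff)
    qed
    then have "card D \<le> card (PiE (UNIV :: 'k set) (\<lambda>_. {- int m..int m}))"
      by (rule card_mono[OF fin])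
    also have "\<dots> = (2 * m + 1) ^ CARD('k)" by (simp add: card_PiE nat_add_distrib nat_mult_distrib)
    finally show "real (card D) \<le> real (2 * m + 1) ^ CARD('k)" by (metis of_nat_le_iff of_nat_power)
  qed
  finally show ?thesis .
qed

text \<open>The bound on degree differences doubles with each squaring, so for the power
  \<open>2^j\<close> the polynomial factor is only exponential in \<open>j\<close>, and
  \<open>le_of_power_growth\<close> removes it.\<close>

lemma norm_le_bounded_op:
  assumes x: "represents W x T" and K: "bounded_op T K"
  shows "norm x \<le> K"
proof -
  have W: "finite W" "W \<subseteq> path_pairs" using x by (auto simp: represents_def)
  have K0: "0 \<le> K" using K by (simp add: bounded_op_def)
  have prods_fin: "finite (\<Union>p\<in>A. \<Union>r\<in>B. pair_prods p r)" if "finite A" "finite B" "A \<subseteq> path_pairs" "B \<subseteq> path_pairs" for A B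
    unfolding pair_prods_def using that
    by (intro finite_UN_I finite_imageI finite_MCE_pairs[OF fa]) (auto simp: path_pairs_iff)
  have prods_sub: "(\<Union>p\<in>A. \<Union>r\<in>B. pair_prods p r) \<subseteq> path_pairs" if "A \<subseteq> path_pairs" "B \<subseteq> path_pairs" for A B
    using that pair_prods_path_pairs by blast
  have prods_deg: "\<bar>deg_diff z i\<bar> \<le> a + b"
    if z: "z \<in> (\<Union>p\<in>A. \<Union>r\<in>B. pair_prods p r)" and AB: "A \<subseteq> path_pairs" "B \<subseteq> path_pairs"
      and le: "\<And>p i. p \<in> A \<Longrightarrow> \<bar>deg_diff p i\<bar> \<le> a" "\<And>p i. p \<in> B \<Longrightarrow> \<bar>deg_diff p i\<bar> \<le> b" for z A B a b i
  proof -
    obtain p r where pr: "p \<in> A" "r \<in> B" "z \<in> pair_prods p r" using z by blast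
    then have "p \<in> path_pairs" "r \<in> path_pairs" using AB by auto
    from deg_diff_pair_prods[OF pr(3) this] have "deg_diff z i = deg_diff p i + deg_diff r i" by simp
    then show ?thesis using le(1)[OF pr(1), of i] le(2)[OF pr(2), of i] by linarith
  qed
  define l where "l = nat (\<Sum>p\<in>W. \<Sum>i\<in>UNIV. \<bar>deg_diff p i\<bar>)"
  have l: "\<bar>deg_diff p i\<bar> \<le> int l" if "p \<in> W" for p i
  proof -
    have "\<bar>deg_diff p i\<bar> \<le> (\<Sum>i\<in>UNIV. \<bar>deg_diff p i\<bar>)" by (rule member_le_sum) auto
    also have "\<dots> \<le> (\<Sum>p\<in>W. \<Sum>i\<in>UNIV. \<bar>deg_diff p i\<bar>)"
      by (rule member_le_sum[OF that]) (auto intro: sum_nonneg W)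
    finally show ?thesis unfolding l_def by linarith
  qed
  have sw: "prod.swap ` W \<subseteq> path_pairs" using W swap_path_pairs by auto
  have l_swap: "\<bar>deg_diff p i\<bar> \<le> int l" if "p \<in> prod.swap ` W" for p i
  proof -
    obtain r where r: "r \<in> W" "p = prod.swap r" using \<open>p \<in> prod.swap ` W\<close> by blast
    then show ?thesis using l[of r i] unfolding r(2) deg_diff_swap by simp
  qed
  \<comment> \<open>Each index in \<open>adj x * x\<close> comes from two factors whose degree
    differences are bounded by \<open>l\<close>.\<close>
  define L where "L = l + l"
  let ?y = "adj x * x"
  have iter: "\<exists>Z R. represents Z (sq_iter j ?y) R \<and> bounded_op R ((K * K) ^ (2 ^ j)) \<and>
      (\<forall>p\<in>Z. \<forall>i. \<bar>deg_diff p i\<bar> \<le> int (2 ^ j * L))" for j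
  proof (induction j)
    case 0
    let ?Z = "\<Union>p\<in>prod.swap ` W. \<Union>r\<in>W. pair_prods p r"
    have Z: "finite ?Z" "?Z \<subseteq> path_pairs"
      by (rule prods_fin[OF finite_imageI[OF W(1)] W(1) sw W(2)] prods_sub[OF sw W(2)])+
    have "pair_prods (prod.swap p) r \<subseteq> ?Z" if "p \<in> W" "r \<in> W" for p r
      using that by blast
    then obtain S where S: "represents ?Z ?y S" "bounded_op S (K * K)"
      by (rule represents_adj_mult_self[OF x K Z(1) _ Z(2)])
    have "\<bar>deg_diff p i\<bar> \<le> int L" if "p \<in> ?Z" for p i
      using prods_deg[OF that sw W(2) l_swap l, of i] by (simp add: L_def)
    with S show ?case by (intro exI[of _ ?Z] exI[of _ S]) simp
  next
    case (Suc j)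
    then obtain Z R where R: "represents Z (sq_iter j ?y) R" "bounded_op R ((K * K) ^ (2 ^ j))"
      "\<And>p i. p \<in> Z \<Longrightarrow> \<bar>deg_diff p i\<bar> \<le> int (2 ^ j * L)" by blast
    have Z: "finite Z" "Z \<subseteq> path_pairs" using R(1) by (auto simp: represents_def)
    let ?Z = "\<Union>p\<in>Z. \<Union>r\<in>Z. pair_prods p r"
    have "represents ?Z (sq_iter (Suc j) ?y) (\<lambda>\<xi>. R (R \<xi>))"
      unfolding sq_iter.simps
      by (rule represents_mult[OF R(1) R(1) prods_fin[OF Z(1) Z(1) Z(2) Z(2)] _ prods_sub[OF Z(2) Z(2)]]) blast
    moreover have "bounded_op (\<lambda>\<xi>. R (R \<xi>)) ((K * K) ^ (2 ^ j) * (K * K) ^ (2 ^ j))"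
      by (rule bounded_op_comp[OF R(2) R(2) represents_fin_vec[OF R(1)]])
    then have "bounded_op (\<lambda>\<xi>. R (R \<xi>)) ((K * K) ^ (2 ^ Suc j))"
      by (simp add: mult_2 power_add)
    moreover have "\<bar>deg_diff p i\<bar> \<le> int (2 ^ Suc j * L)" if "p \<in> ?Z" for p i
      using prods_deg[OF that Z(2) Z(2) R(3) R(3), of i] by (simp add: algebra_simps)
    ultimately show ?case by blast
  qed
  let ?k = "CARD('k)"
  have "norm ?y \<le> K * K"
  proof (rule le_of_power_growth)
    fix j
    obtain Z R where R: "represents Z (sq_iter j ?y) R" "bounded_op R ((K * K) ^ (2 ^ j))"
      "\<And>p i. p \<in> Z \<Longrightarrow> \<bar>deg_diff p i\<bar> \<le> int (2 ^ j * L)" using iter[of j] by blast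
    have "norm ?y ^ (2 ^ j) = norm (sq_iter j ?y)" by (simp add: norm_sq_iter adj_mult adj_adj)
    also have "\<dots> \<le> real (2 * (2 ^ j * L) + 1) ^ ?k * (K * K) ^ (2 ^ j)"
      by (rule norm_le_polynomial[OF R(1) R(3) R(2)])
    \<comment> \<open>Since \<open>2 * (2 ^ j * L) + 1 \<le> (2 * L + 1) * 2 ^ j\<close>, the factor
      takes the form \<open>C * R ^ j\<close> with \<open>C = (2 * L + 1) ^ ?k\<close> and
      \<open>R = 2 ^ ?k\<close>.\<close>
    also have "\<dots> \<le> (real (2 * L + 1) * 2 ^ j) ^ ?k * (K * K) ^ (2 ^ j)"
      using K0 by (intro mult_right_mono power_mono) (auto simp: algebra_simps)
    also have "\<dots> = real (2 * L + 1) ^ ?k * (2 ^ ?k) ^ j * (K * K) ^ (2 ^ j)"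
      by (simp only: power_mult_distrib power_mult[symmetric] mult.commute[of j])
    finally show "norm ?y ^ (2 ^ j) \<le> real (2 * L + 1) ^ ?k * (2 ^ ?k) ^ j * (K * K) ^ (2 ^ j)" .
  qed (use K0 in auto)
  then have "(norm x)\<^sup>2 \<le> K\<^sup>2" by (simp add: cstar_identity power2_eq_square)
  then show ?thesis using K0 by (rule power2_le_imp_le)
qed

section \<open>Density of the span of the spanning elements\<close>

definition span_elems :: "'b set" where
  "span_elems = {x. \<exists>W T. represents W x T}"

lemma represents_union:
  assumes x: "represents W x T" and y: "represents W' y S"
  shows "represents (W \<union> W') x T" "represents (W \<union> W') y S"
  using represents_mono[OF x, of "W \<union> W'"] represents_mono[OF y, of "W \<union> W'"] x y
  by (auto simp: represents_def)

lemma span_elems_closed: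
  assumes x: "x \<in> span_elems" and y: "y \<in> span_elems"
  shows "x + y \<in> span_elems" "x * y \<in> span_elems" "adj x \<in> span_elems" "c *\<^sub>C x \<in> span_elems"
proof -
  obtain W T W' S where r: "represents W x T" "represents W' y S"
    using x y by (auto simp: span_elems_def)
  then have W: "finite W" "W \<subseteq> path_pairs" "finite W'" "W' \<subseteq> path_pairs"
    by (auto simp: represents_def)
  note u = represents_union[OF r]
  \<comment> \<open>Addition is written as a sum over the two booleans with coefficients 1.\<close>
  have "represents (W \<union> W') (\<Sum>b\<in>UNIV. 1 *\<^sub>C (if b then x else y)) (\<lambda>\<xi> z. \<Sum>b\<in>UNIV. 1 * (if b then T else S) \<xi> z)"
    by (rule represents_scaled_sum) (use W u in auto)
  moreover have "(\<Sum>b\<in>UNIV. 1 *\<^sub>C (if b then x else y)) = x + y"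
    by (simp add: UNIV_bool scaleC_one add.commute)
  ultimately show "x + y \<in> span_elems" unfolding span_elems_def by auto
  have "represents W (\<Sum>b\<in>{True}. c *\<^sub>C x) (\<lambda>\<xi> z. \<Sum>b\<in>{True}. c * T \<xi> z)"
    by (rule represents_scaled_sum) (use W r in auto)
  then show "c *\<^sub>C x \<in> span_elems" unfolding span_elems_def by auto
  show "adj x \<in> span_elems"
  proof (rule represents_adj[OF r(1)])
    fix S assume "represents (prod.swap ` W) (adj x) S"
    then show ?thesis by (auto simp: span_elems_def)
  qed
  have "finite (\<Union>p\<in>W. \<Union>q\<in>W'. pair_prods p q)"
    unfolding pair_prods_def using W
    by (intro finite_UN_I finite_imageI finite_MCE_pairs[OF fa]) (auto simp: path_pairs_iff)
  moreover have "(\<Union>p\<in>W. \<Union>q\<in>W'. pair_prods p q) \<subseteq> path_pairs"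
    using W pair_prods_path_pairs by blast
  ultimately have "represents (\<Union>p\<in>W. \<Union>q\<in>W'. pair_prods p q) (x * y) (\<lambda>\<xi>. T (S \<xi>))"
    by (intro represents_mult[OF r]) auto
  then show "x * y \<in> span_elems" by (auto simp: span_elems_def)
qed

lemma zero_span_elems: "0 \<in> span_elems"
  unfolding span_elems_def represents_def by (intro CollectI exI[of _ "{}"]) auto

lemma cstar_subalgebra_closure_span_elems: "cstar_subalgebra (closure span_elems)"
  unfolding cstar_subalgebra_def
proof (intro conjI ballI allI closed_closure)
  show "0 \<in> closure span_elems" using zero_span_elems closure_subset by blast
next
  fix x y assume "x \<in> closure span_elems" "y \<in> closure span_elems"
  then obtain a b where a: "\<And>n. a n \<in> span_elems" "a \<longlonglongrightarrow> x" and b: "\<And>n. b n \<in> span_elems" "b \<longlonglongrightarrow> y"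
    by (auto simp: closure_sequential)
  show "x + y \<in> closure span_elems" unfolding closure_sequential
    using a b span_elems_closed(1) by (intro exI[of _ "\<lambda>n. a n + b n"]) (auto intro: tendsto_add)
  show "x * y \<in> closure span_elems" unfolding closure_sequential
    using a b span_elems_closed(2) by (intro exI[of _ "\<lambda>n. a n * b n"]) (auto intro: tendsto_mult)
next
  fix x assume "x \<in> closure span_elems"
  then obtain a where a: "\<And>n. a n \<in> span_elems" "a \<longlonglongrightarrow> x"
    by (auto simp: closure_sequential)
  have "(\<lambda>n. adj (a n)) \<longlonglongrightarrow> adj x"
    by (rule continuous_on_tendsto_compose[OF continuous_on_adj[of UNIV] a(2)]) auto
  then show "adj x \<in> closure span_elems" unfolding closure_sequential
    using a span_elems_closed(3) by (intro exI[of _ "\<lambda>n. adj (a n)"]) blast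
  fix c
  have "(\<lambda>n. c *\<^sub>C a n) \<longlonglongrightarrow> c *\<^sub>C x"
    by (rule continuous_on_tendsto_compose[OF continuous_on_scaleC[of UNIV] a(2)]) auto
  then show "c *\<^sub>C x \<in> closure span_elems" unfolding closure_sequential
    using a span_elems_closed(4) by (intro exI[of _ "\<lambda>n. c *\<^sub>C a n"]) blast
qed

lemma t_span_elems: "f \<in> Mor G \<Longrightarrow> t f \<in> span_elems"
proof -
  assume f: "f \<in> Mor G"
  let ?p = "(f, Dom G f)"
  have "?p \<in> path_pairs" using f by (simp add: path_pairs_iff Dom_closed Dom_Dom)
  then have "represents {?p} (elem ?p) (shift_op ?p)" by (intro represents_single) auto
  \<comment> \<open>\<open>t (Dom G f)\<close> is a self-adjoint right unit for
    \<open>t f\<close>.\<close>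
  moreover have "elem ?p = t f"
    using t_vertex[OF Dom_vertex[OF f]] t_mult[OF composable_Dom[OF f]] Cmp_Dom[OF f]
    by (simp add: elem_def projection_def)
  ultimately show "t f \<in> span_elems" unfolding span_elems_def by auto
qed

lemma closure_span_elems_UNIV:
  assumes "cstar_subalgebra hull (t ` Mor G) = UNIV"
  shows "closure span_elems = UNIV"
proof -
  have "t ` Mor G \<subseteq> closure span_elems" using t_span_elems closure_subset by blast
  then have "cstar_subalgebra hull (t ` Mor G) \<subseteq> closure span_elems"
    using cstar_subalgebra_closure_span_elems by (rule hull_minimal)
  then show ?thesis using assms by auto
qed

end

section \<open>Faithfulness\<close>

theorem corollary9p4:
  fixes \<Lambda> :: "('m, 'k::finite) kgraph"
    and s :: "'m \<Rightarrow> 'a::cstar_algebra"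
    and t :: "'m \<Rightarrow> 'b::cstar_algebra"
  assumes "k_graph \<Lambda>"
    and "finitely_aligned \<Lambda>"
    and "\<And>v i. v \<in> vertices \<Lambda> \<Longrightarrow> infinite (paths_at \<Lambda> (axis i 1) v)"
    and "universal_CK_family \<Lambda> s TYPE('a)"
    and "universal_CK_family \<Lambda> s TYPE('b)"
    and "CK_family \<Lambda> t"
    and "\<And>v. v \<in> vertices \<Lambda> \<Longrightarrow> t v \<noteq> 0"
  shows "inj (induced_rep \<Lambda> s t)"
proof -
  define \<pi> where "\<pi> = induced_rep \<Lambda> s t"
  \<comment> \<open>Universality for the target algebra makes the description in
    \<open>induced_rep\<close> proper.\<close>
  have "\<exists>!\<pi>. sends_generators \<Lambda> s t \<pi>"
    using assms(5,6) unfolding universal_CK_family_def by blast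
  then have "sends_generators \<Lambda> s t \<pi>"
    unfolding \<pi>_def induced_rep_def by (rule theI')
  then have hom: "star_hom \<pi>" and gen: "\<And>f. f \<in> Mor \<Lambda> \<Longrightarrow> \<pi> (s f) = t f"
    by (auto simp: sends_generators_def)
  have CKs: "CK_family \<Lambda> s" and gens: "cstar_subalgebra hull (s ` Mor \<Lambda>) = UNIV"
    using assms(4) unfolding universal_CK_family_def by blast+
  interpret S: cuntz_krieger \<Lambda> s
    using assms(1,2) CKs by (simp add: cuntz_krieger_def cuntz_krieger_axioms_def)
  interpret T: nonzero_cuntz_krieger \<Lambda> t
    using assms by (simp add: nonzero_cuntz_krieger_def nonzero_cuntz_krieger_axioms_def
        cuntz_krieger_def cuntz_krieger_axioms_def)
  \<comment> \<open>\<open>x\<close> and \<open>\<pi> x\<close> have the same coefficients, hence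
    the same operator \<open>R\<close>. Non-vanishing of the \<open>t v\<close> gives
    \<open>bounded_op R (norm (\<pi> x))\<close>, and the upper estimate for the family
    \<open>s\<close> turns this into a bound on \<open>norm x\<close>.\<close>
  have "norm x \<le> norm (\<pi> x)" if x: "x \<in> S.span_elems" for x
  proof -
    obtain W R where r: "S.represents W x R" using x by (auto simp: S.span_elems_def)
    then obtain c where c: "x = (\<Sum>p\<in>W. c p *\<^sub>C S.elem p)" "R = (\<lambda>\<xi> y. \<Sum>p\<in>W. c p * S.shift_op p \<xi> y)"
      unfolding S.represents_def by blast
    have W: "finite W" "W \<subseteq> S.path_pairs" using r by (auto simp: S.represents_def)
    have "\<pi> (S.elem p) = T.elem p" if "p \<in> W" for p
      using that W(2) hom gen
      by (auto simp: S.elem_def T.elem_def S.path_pairs_iff star_hom_mult star_hom_adj)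
    then have "\<pi> x = (\<Sum>p\<in>W. c p *\<^sub>C T.elem p)"
      using hom by (simp add: c(1) star_hom_sum star_hom_scaleC)
    then have "T.represents W (\<pi> x) R"
      unfolding T.represents_def using W c(2) by blast
    then show ?thesis by (intro S.norm_le_bounded_op[OF r] T.bounded_op_norm)
  qed
  \<comment> \<open>By continuity of \<open>\<pi>\<close> the estimate extends from the dense span
    to the whole algebra.\<close>
  moreover have "closed {x. norm x \<le> norm (\<pi> x)}"
  proof -
    have "1-lipschitz_on UNIV \<pi>"
      by (rule lipschitz_onI)
        (simp_all add: dist_norm star_hom_contractive[OF hom] flip: star_hom_minus[OF hom])
    then have "continuous_on UNIV \<pi>" by (rule lipschitz_on_continuous_on)
    then show ?thesis by (intro closed_Collect_le continuous_intros)
  qed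
  ultimately have "closure S.span_elems \<subseteq> {x. norm x \<le> norm (\<pi> x)}"
    by (intro closure_minimal) auto
  then have le: "norm x \<le> norm (\<pi> x)" for x
    using S.closure_span_elems_UNIV[OF gens] by auto
  show ?thesis
    unfolding \<pi>_def[symmetric]
  proof (rule injI)
    fix x y assume "\<pi> x = \<pi> y"
    then have "norm (x - y) \<le> 0" using le[of "x - y"] star_hom_minus[OF hom] by simp
    then show "x = y" by simp
  qed
qed

end
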